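(* Let $\mathbf{X}=\{X_i\}_{i\ge 1}$ be any stationary ergodic source with finite alphabet $\mathcal{X}$, with rate-distortion function $R(D,\mathbf{X})$, and fix $\alpha>0$. Let $\{k_f^{(n)}\}$ be a sequence of positive integers with $k_f^{(n)}\to\infty$, put $K_f^{(n)}=|\mathcal{X}|^{2k_f^{(n)}+1}$, let $k=k_n$ be positive integers with $k_n\to\infty$ and $k_n=o(\log n)$, and let $$\beta_t^{(n)}=\frac{1}{T_0^{(n)}}\ln\left(\left\lfloor\frac{t}{K_f^{(n)}}\right\rfloor+1\right),\quad t\ge1,$$ for some $T_0^{(n)}>K_f^{(n)}\Delta$. Let $f^{K_f}_{\beta,\alpha,r}$ be the sliding-block code output after $r$ iterations of the simulated annealing Gibbs sampler over sliding-block codes (defined in the context) with input $X^n$, and let $\hat{X}^n$ be the result of applying this sliding-block code to $X^n$. Then $$\lim_{n\to\infty}\lim_{r\to\infty}\mathrm{E}\left[\frac1n\,\ell_{\mathsf{LZ}}(\hat{X}^n)+\alpha\, d_n(X^n,\hat{X}^n)\right]=\min_{D\ge0}\left[R(D,\mathbf{X})+\alpha D\right].$$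
   Context: All entropies, mutual informations and code lengths are in bits. $\hat{\mathcal{X}}$ is a finite reconstruction alphabet. Distortion: $d:\mathcal{X}\times\hat{\mathcal{X}}\to[0,\infty)$ and $d_n(x^n,y^n)=\frac1n\sum_{i=1}^n d(x_i,y_i)$. Rate-distortion function: $$R(D,\mathbf{X})=\lim_{n\to\infty}\ \min_{p(\hat{x}^n|x^n):\ \mathrm{E}\,d_n(X^n,\hat{X}^n)\le D}\ \frac1n I(X^n;\hat{X}^n),$$ where the minimum is over conditional pmfs on $\hat{\mathcal{X}}^n$ given $\mathcal{X}^n$ (value $+\infty$ if there are none satisfying the constraint). Conditional empirical entropy: for $y^n\in\hat{\mathcal{X}}^n$, $k<n$, $\mathbf{b}\in\hat{\mathcal{X}}^k$, $\beta\in\hat{\mathcal{X}}$, put $$m_{\beta,\mathbf{b}}(y^n)=\frac{1}{n-k}\left|\{k+1\le i\le n:\ y_{i-k}^{i-1}=\mathbf{b},\ y_i=\beta\}\right|.$$ Then $H_k(y^n)=H(Y_{k+1}\mid Y^k)$, where $Y^{k+1}$ has distribution $\mathrm{P}(Y^{k+1}=[\mathbf{b},\beta])=m_{\beta,\mathbf{b}}(y^n)$. $\ell_{\mathsf{LZ}}(y^n)$ is the length in bits of the description of $y^n$ by the (1978, incremental parsing) Lempel-Ziv lossless code: $y^n$ is parsed sequentially into phrases, each being the shortest string not already appearing as a phrase (except possibly the last one), and each phrase is encoded by a pointer to the earlier phrase (or empty string) that is its prefix together with its last symbol. Sliding-block (SB) code: an SB code of window length $2k_f+1$ is a function $f:\mathcal{X}^{2k_f+1}\to\hat{\mathcal{X}}$,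 identified with the vector $f^{K_f}\in\hat{\mathcal{X}}^{K_f}$, $K_f=|\mathcal{X}|^{2k_f+1}$, of its values on an enumeration of $\mathcal{X}^{2k_f+1}$. Applying it to $x^n$ gives $y^n=y^n[x^n,f^{K_f}]$ with $y_i=f(x_{i-k_f}^{i+k_f})$, $1\le i\le n$, where indices of $x$ are read cyclically ($x_{i+n}=x_i$). Energy: for given $x^n$, $\mathcal{E}(f^{K_f})=n\left[H_k(y^n)+\alpha d_n(x^n,y^n)\right]$ with $y^n=y^n[x^n,f^{K_f}]$, and $$\Delta=\max_{1\le i\le K_f}\ \max_{f^{i-1}\in\hat{\mathcal{X}}^{i-1},\,f_{i+1}^{K_f}\in\hat{\mathcal{X}}^{K_f-i},\,\vartheta,\theta\in\hat{\mathcal{X}}}\left|\mathcal{E}(f^{i-1}\vartheta f_{i+1}^{K_f})-\mathcal{E}(f^{i-1}\theta f_{i+1}^{K_f})\right|.$$ $\mathcal{E}$ and $\Delta$ depend on $x^n$; the requirement $T_0^{(n)}>K_f^{(n)}\Delta$ is for every $x^n\in\mathcal{X}^n$. Algorithm (input $x^n,k_f,k,\alpha,\{\beta_t\},r$): start from an arbitrary $f^{K_f}\in\hat{\mathcal{X}}^{K_f}$. For $t=1,\dots,r$: draw $i\in\{1,\dots,K_f\}$ uniformly at random; replace $f_i$ by a random symbol equal to $\theta\in\hat{\mathcal{X}}$ with probability $$\frac{e^{-\beta_t\mathcal{E}(f^{i-1}\theta f_{i+1}^{K_f})}}{\sum_{\vartheta\in\hat{\mathcal{X}}}e^{-\beta_t\mathcal{E}(f^{i-1}\vartheta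 f_{i+1}^{K_f})}}.$$ The output is the final $f^{K_f}$. The randomness used in the algorithm is independent of the source, and the randomization variables used at different drawings are independent of each other. The expectation is over both the source and the algorithm's randomness. *)

theory Defs
  imports
    "HOL-Probability.Probability"
    "HOL-Library.Log_Nat"
    "HOL-Library.Landau_Symbols"
begin

text \<open>
  Sequences are indexed from 0: \<open>X i\<close> is the letter usually written \<open>X\<^sub>i\<^sub>+\<^sub>1\<close>, and a block of
  length \<open>n\<close> is a list whose entry \<open>!i\<close> is the letter number \<open>i + 1\<close>. The finite alphabets are
  types of class \<open>finite\<close>.
\<close>

section \<open>Sources\<close>

abbreviation seq_space :: "(nat \<Rightarrow> 'a) measure" where
  "seq_space \<equiv> \<Pi>\<^sub>M i\<in>UNIV. count_space UNIV"

definition path_law :: "'w measure \<Rightarrow> (nat \<Rightarrow> 'w \<Rightarrow> 'a) \<Rightarrow> (nat \<Rightarrow> 'a) measure" where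
  "path_law M X = distr M seq_space (\<lambda>\<omega> i. X i \<omega>)"

definition shift :: "(nat \<Rightarrow> 'a) \<Rightarrow> nat \<Rightarrow> 'a" where
  "shift x = (\<lambda>i. x (Suc i))"

definition stationary :: "'w measure \<Rightarrow> (nat \<Rightarrow> 'w \<Rightarrow> 'a) \<Rightarrow> bool" where
  "stationary M X \<longleftrightarrow> distr (path_law M X) seq_space shift = path_law M X"

definition ergodic :: "'w measure \<Rightarrow> (nat \<Rightarrow> 'w \<Rightarrow> 'a) \<Rightarrow> bool" where
  "ergodic M X \<longleftrightarrow>
     (\<forall>A \<in> sets seq_space. shift -` A = A \<longrightarrow> measure (path_law M X) A \<in> {0, 1})"

definition stationary_ergodic_source :: "'w measure \<Rightarrow> (nat \<Rightarrow> 'w \<Rightarrow> 'a::finite) \<Rightarrow> bool" where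
  "stationary_ergodic_source M X \<longleftrightarrow>
     prob_space M \<and> (\<forall>i. X i \<in> measurable M (count_space UNIV)) \<and>
     stationary M X \<and> ergodic M X"

definition block :: "(nat \<Rightarrow> 'w \<Rightarrow> 'a) \<Rightarrow> nat \<Rightarrow> 'w \<Rightarrow> 'a list" where
  "block X n \<omega> = map (\<lambda>i. X i \<omega>) [0..<n]"

definition block_pmf :: "'w measure \<Rightarrow> (nat \<Rightarrow> 'w \<Rightarrow> 'a) \<Rightarrow> nat \<Rightarrow> 'a list pmf" where
  "block_pmf M X n = embed_pmf (\<lambda>xs. measure M {\<omega> \<in> space M. block X n \<omega> = xs})"


section \<open>Rate-distortion function\<close>

definition dist_n :: "('a \<Rightarrow> 'b \<Rightarrow> real) \<Rightarrow> 'a list \<Rightarrow> 'b list \<Rightarrow> real" where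
  "dist_n d xs ys = (\<Sum>i<length xs. d (xs ! i) (ys ! i)) / real (length xs)"

definition mutual_info :: "('x \<times> 'y) pmf \<Rightarrow> real" where
  "mutual_info p =
     prob_space.mutual_information (measure_pmf p) 2 (count_space UNIV) (count_space UNIV) fst snd"

definition joint_pmf :: "'x pmf \<Rightarrow> ('x \<Rightarrow> 'y pmf) \<Rightarrow> ('x \<times> 'y) pmf" where
  "joint_pmf p W = bind_pmf p (\<lambda>x. map_pmf (Pair x) (W x))"

definition test_channels :: "nat \<Rightarrow> ('a list \<Rightarrow> 'b list pmf) set" where
  "test_channels n = {W. \<forall>xs. length xs = n \<longrightarrow> set_pmf (W xs) \<subseteq> {ys. length ys = n}}"

text \<open>
  The infimum over the (compact) set of feasible channels is attained when that set is nonempty;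
  it is \<open>\<infinity>\<close> when there is no feasible channel.
\<close>

definition rate_distortion_n ::
  "'w measure \<Rightarrow> (nat \<Rightarrow> 'w \<Rightarrow> 'a::finite) \<Rightarrow> ('a \<Rightarrow> 'b::finite \<Rightarrow> real) \<Rightarrow> nat \<Rightarrow> real \<Rightarrow> ereal" where
  "rate_distortion_n M X d n D =
     Inf {ereal (mutual_info (joint_pmf (block_pmf M X n) W) / real n) | W.
            W \<in> test_channels n \<and>
            measure_pmf.expectation (joint_pmf (block_pmf M X n) W)
              (\<lambda>(xs, ys). dist_n d xs ys) \<le> D}"

definition rate_distortion ::
  "'w measure \<Rightarrow> (nat \<Rightarrow> 'w \<Rightarrow> 'a::finite) \<Rightarrow> ('a \<Rightarrow> 'b::finite \<Rightarrow> real) \<Rightarrow> real \<Rightarrow> ereal" where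
  "rate_distortion M X d D = lim (\<lambda>n. rate_distortion_n M X d n D)"


section \<open>Conditional empirical entropy\<close>

definition emp_freq :: "nat \<Rightarrow> 'b list \<Rightarrow> 'b list \<Rightarrow> 'b \<Rightarrow> real" where
  "emp_freq k ys b \<beta> =
     real (card {i. k \<le> i \<and> i < length ys \<and> take k (drop (i - k) ys) = b \<and> ys ! i = \<beta>})
       / real (length ys - k)"

text \<open>A probability distribution only when \<open>k < length ys\<close>.\<close>

definition emp_pmf :: "nat \<Rightarrow> 'b list \<Rightarrow> ('b list \<times> 'b) pmf" where
  "emp_pmf k ys = embed_pmf (\<lambda>(b, \<beta>). emp_freq k ys b \<beta>)"

definition emp_cond_entropy :: "nat \<Rightarrow> 'b::finite list \<Rightarrow> real" where
  "emp_cond_entropy k ys =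
     prob_space.conditional_entropy (measure_pmf (emp_pmf k ys)) 2
       (count_space UNIV) (count_space UNIV) snd fst"


section \<open>Lempel-Ziv code length\<close>

text \<open>
  \<open>lz_parse P w ys\<close> continues the incremental parsing on the remaining input \<open>ys\<close>, where \<open>P\<close> lists
  the completed phrases and \<open>w\<close> is the current, still incomplete phrase. Only the last phrase may
  coincide with an earlier one.
\<close>

primrec lz_parse :: "'b list list \<Rightarrow> 'b list \<Rightarrow> 'b list \<Rightarrow> 'b list list" where
  "lz_parse P w [] = (if w = [] then P else P @ [w])"
| "lz_parse P w (y # ys) =
     (if w @ [y] \<in> set P then lz_parse P (w @ [y]) ys else lz_parse (P @ [w @ [y]]) [] ys)"

definition lz_phrases :: "'b list \<Rightarrow> 'b list list" where
  "lz_phrases ys = lz_parse [] [] ys"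

text \<open>
  The pointer of the phrase with index \<open>j\<close> (counted from 0) selects one of \<open>j + 1\<close> candidates: the
  \<open>j\<close> earlier phrases and the empty string. It and the last symbol are written with fixed lengths.
\<close>

definition lz_length :: "'b::finite list \<Rightarrow> nat" where
  "lz_length ys = (\<Sum>j<length (lz_phrases ys). ceillog2 (j + 1) + ceillog2 CARD('b))"


section \<open>Sliding-block codes\<close>

text \<open>
  The vector of values of a code is indexed by the windows themselves instead of by their positions
  in an enumeration.
\<close>

definition windows :: "nat \<Rightarrow> 'a list set" where
  "windows kf = {w. length w = 2 * kf + 1}"

definition sb_codes :: "nat \<Rightarrow> ('a list \<Rightarrow> 'b) set" where
  "sb_codes kf = windows kf \<rightarrow>\<^sub>E UNIV"

definition cyclic_window :: "nat \<Rightarrow> 'a list \<Rightarrow> nat \<Rightarrow> 'a list" where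
  "cyclic_window kf xs i =
     map (\<lambda>j. xs ! nat ((int i + j) mod int (length xs))) [- int kf..int kf]"

definition sb_apply :: "nat \<Rightarrow> ('a list \<Rightarrow> 'b) \<Rightarrow> 'a list \<Rightarrow> 'b list" where
  "sb_apply kf f xs = map (\<lambda>i. f (cyclic_window kf xs i)) [0..<length xs]"

definition energy ::
  "('a \<Rightarrow> 'b::finite \<Rightarrow> real) \<Rightarrow> real \<Rightarrow> nat \<Rightarrow> nat \<Rightarrow> 'a list \<Rightarrow> ('a list \<Rightarrow> 'b) \<Rightarrow> real" where
  "energy d \<alpha> k kf xs f =
     real (length xs) *
       (emp_cond_entropy k (sb_apply kf f xs) + \<alpha> * dist_n d xs (sb_apply kf f xs))"

definition max_energy_diff ::
  "('a::finite \<Rightarrow> 'b::finite \<Rightarrow> real) \<Rightarrow> real \<Rightarrow> nat \<Rightarrow> nat \<Rightarrow> 'a list \<Rightarrow> real" where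
  "max_energy_diff d \<alpha> k kf xs =
     Max {\<bar>energy d \<alpha> k kf xs (f(w := \<xi>)) - energy d \<alpha> k kf xs (f(w := \<theta>))\<bar> | f w \<xi> \<theta>.
            f \<in> sb_codes kf \<and> w \<in> windows kf}"


section \<open>Simulated annealing\<close>

definition gibbs_pmf ::
  "(('a list \<Rightarrow> 'b::finite) \<Rightarrow> real) \<Rightarrow> real \<Rightarrow> ('a list \<Rightarrow> 'b) \<Rightarrow> 'a list \<Rightarrow> 'b pmf" where
  "gibbs_pmf E \<beta> f w =
     embed_pmf (\<lambda>\<theta>. exp (- \<beta> * E (f(w := \<theta>))) / (\<Sum>\<xi>\<in>UNIV. exp (- \<beta> * E (f(w := \<xi>)))))"

definition gibbs_step ::
  "nat \<Rightarrow> (('a list \<Rightarrow> 'b::finite) \<Rightarrow> real) \<Rightarrow> real \<Rightarrow> ('a list \<Rightarrow> 'b) \<Rightarrow> ('a list \<Rightarrow> 'b) pmf" where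
  "gibbs_step kf E \<beta> f =
     bind_pmf (pmf_of_set (windows kf)) (\<lambda>w. map_pmf (\<lambda>\<theta>. f(w := \<theta>)) (gibbs_pmf E \<beta> f w))"

text \<open>Distribution of the code after \<open>r\<close> iterations; iteration \<open>t\<close> uses \<open>\<beta> t\<close>, \<open>t \<ge> 1\<close>.\<close>

primrec annealing ::
  "nat \<Rightarrow> (('a list \<Rightarrow> 'b::finite) \<Rightarrow> real) \<Rightarrow> (nat \<Rightarrow> real) \<Rightarrow> ('a list \<Rightarrow> 'b) \<Rightarrow> nat
     \<Rightarrow> ('a list \<Rightarrow> 'b) pmf" where
  "annealing kf E \<beta> f0 0 = return_pmf f0"
| "annealing kf E \<beta> f0 (Suc r) = bind_pmf (annealing kf E \<beta> f0 r) (gibbs_step kf E (\<beta> (Suc r)))"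

text \<open>
  The algorithm's randomness is independent of the source, so the joint expectation is the
  expectation over the source of the expectation over the algorithm run on the realised block.
\<close>

definition expected_cost ::
  "'w measure \<Rightarrow> (nat \<Rightarrow> 'w \<Rightarrow> 'a) \<Rightarrow> ('a \<Rightarrow> 'b::finite \<Rightarrow> real) \<Rightarrow> real \<Rightarrow> nat \<Rightarrow> nat
     \<Rightarrow> (nat \<Rightarrow> real) \<Rightarrow> ('a list \<Rightarrow> 'a list \<Rightarrow> 'b) \<Rightarrow> nat \<Rightarrow> nat \<Rightarrow> real" where
  "expected_cost M X d \<alpha> k kf \<beta> f0 n r =
     (\<integral>\<omega>. (let xs = block X n \<omega> in
            measure_pmf.expectation (annealing kf (energy d \<alpha> k kf xs) \<beta> (f0 xs) r)
              (\<lambda>f. real (lz_length (sb_apply kf f xs)) / real n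
                    + \<alpha> * dist_n d xs (sb_apply kf f xs))) \<partial>M)"

end

theory Submission
  imports Defs "HOL-Real_Asymp.Real_Asymp"
begin

text \<open>
  For a fixed source block the Gibbs sampler converges to the uniform law on the energy minimisers:
  during the \<open>j\<close>-th sweep of \<open>K\<^sub>f\<close> steps every code is reached with probability at least
  \<open>c / (j + 2)\<close>, a divergent series, while the Gibbs laws of consecutive sweeps differ by \<open>o(1 / j)\<close>.
  So the limit over \<open>r\<close> is the expected Lempel-Ziv cost of a minimiser.

  From below, the Lempel-Ziv lengths of the words of length \<open>n\<close> have Kraft sum at most \<open>n + 1\<close>, hence
  the expected length is at least the mutual information up to \<open>log (n + 1)\<close>.

  From above, Ziv's inequality bounds the Lempel-Ziv length by \<open>n H\<^sub>k + o(n)\<close>, uniformly in the word,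
  so it suffices to exhibit one code of fixed window whose stationary cost is nearly minimal. A greedy
  covering argument turns a test channel on blocks of length \<open>N\<close> into a variable-length block code
  losing only \<open>O(log N)\<close> bits, without any asymptotic equipartition. The blocks are placed at a fixed
  phase modulo \<open>N\<close> relative to the last occurrence of a rare word; averaged over the \<open>N\<close> phases the
  block positions are uniform, so some phase does as well as the block code. Ergodicity enters only
  in that the rare word recurs. If there is no rare word, the number of words of each length is
  bounded and the letterwise optimal reproduction has rate zero.

  The minimum over \<open>D\<close> is attained because \<open>R\<close> is convex and right-continuous at its smallest
  feasible distortion: there, few letters have to be changed, which costs little information.
\<close>

text \<open>The condition on \<open>T0\<close> makes the sweep bound harmonic: in sweep
  \<open>j\<close> the inverse temperature is at most \<open>ln (j + 2) / T0\<close>, each of the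
  \<open>Kf\<close> steps costs a factor \<open>exp (- \<beta> * \<Delta>)\<close>, and the product
  of these factors is at least \<open>1 / (j + 2)\<close>. A minimiser is chosen after the whole
  block has been seen, so its output is not a stationary process and nothing is known about its
  statistics. This is why both comparisons with the Lempel-Ziv length, the Kraft sum and Ziv's
  inequality, range over all words. The minimiser is compared in energy with one fixed code, block
  by block, and only for that code is an expectation over the source computed; consistency of the
  marginals of the block laws then suffices. Entropies of output processes never appear. A code is
  always accompanied by a freely chosen law or subprobability kernel, and its rate is measured by
  the mean of minus the logarithm of that kernel, an upper bound for every entropy involved.\<close>

abbreviation expect :: "'x pmf \<Rightarrow> ('x \<Rightarrow> real) \<Rightarrow> real" where
  "expect \<equiv> measure_pmf.expectation"

section \<open>Relative entropy and empirical entropy\<close>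

text \<open>Termwise tangent bound \<open>ln t \<le> t - 1\<close>, where \<open>t\<close> is the
  quotient of the total ratio \<open>sum a I / B\<close> by the individual ratio
  \<open>a i / b i\<close>. An upper bound \<open>B\<close> in place of \<open>sum b I\<close>
  admits subprobabilities as second argument.\<close>

lemma log_sum_inequality:
  fixes a b :: "'i \<Rightarrow> real"
  assumes "finite I" and a: "\<And>i. i \<in> I \<Longrightarrow> 0 \<le> a i" and b: "\<And>i. i \<in> I \<Longrightarrow> 0 \<le> b i"
    and ab: "\<And>i. i \<in> I \<Longrightarrow> b i = 0 \<Longrightarrow> a i = 0" and B: "sum b I \<le> B"
  shows "sum a I * log 2 (sum a I / B) \<le> (\<Sum>i\<in>I. a i * log 2 (a i / b i))"
proof (cases "sum a I = 0")
  case True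
  then have "\<And>i. i \<in> I \<Longrightarrow> a i = 0"
    using a assms(1) by (simp add: sum_nonneg_eq_0_iff)
  then show ?thesis using True by simp
next
  case False
  then have A: "sum a I > 0" using a by (simp add: less_le sum_nonneg)
  then obtain i where "i \<in> I" "a i \<noteq> 0" by (metis False sum.neutral)
  then have "sum b I > 0"
    using ab b assms(1) by (intro sum_pos2[of I i]) (auto simp: less_le)
  with B have B0: "B > 0" by simp
  have *: "a i * (ln (sum a I / B) + 1) - b i * (sum a I / B) \<le> a i * ln (a i / b i)" if "i \<in> I" for i
  proof (cases "a i = 0")
    case True then show ?thesis using b[OF that] A B0 by simp
  next
    case False
    then have ai: "a i > 0" and bi: "b i > 0" using a[OF that] b[OF that] ab[OF that] by (auto simp: less_le)
    define t where "t = (sum a I / B) * b i / a i"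
    have t: "t > 0" using ai bi A B0 by (simp add: t_def)
    have "ln t \<le> t - 1" using t by (rule ln_le_minus_one)
    moreover have "ln t = ln (sum a I / B) - ln (a i / b i)"
      using ai bi A B0 by (simp add: t_def ln_mult ln_div)
    ultimately have "a i * (ln (sum a I / B) - ln (a i / b i)) \<le> a i * (t - 1)"
      using ai by simp
    moreover have "a i * t = b i * (sum a I / B)" using ai by (simp add: t_def)
    ultimately show ?thesis by (simp add: algebra_simps)
  qed
  have "sum a I * ln (sum a I / B) \<le> sum a I * (ln (sum a I / B) + 1) - sum b I * (sum a I / B)"
    using mult_right_mono[OF B, of "sum a I / B"] A B0 by (simp add: algebra_simps)
  also have "\<dots> = (\<Sum>i\<in>I. a i * (ln (sum a I / B) + 1) - b i * (sum a I / B))"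
    by (simp only: sum_subtractf sum_distrib_right[symmetric])
  also have "\<dots> \<le> (\<Sum>i\<in>I. a i * ln (a i / b i))" by (intro sum_mono *)
  finally show ?thesis
    by (simp add: log_def sum_divide_distrib[symmetric] divide_right_mono)
qed

section \<open>Expectations over finite supports\<close>

lemma expectation_finite:
  fixes f :: "'x \<Rightarrow> real"
  assumes "finite A" "set_pmf p \<subseteq> A"
  shows "expect p f = (\<Sum>x\<in>A. pmf p x * f x)"
  using integral_measure_pmf_real[of A p f] assms by (auto simp: mult.commute)

lemma expectation_mono_finite:
  fixes f g :: "'x \<Rightarrow> real"
  assumes "finite (set_pmf p)" "\<And>x. x \<in> set_pmf p \<Longrightarrow> f x \<le> g x"
  shows "expect p f \<le> expect p g"
  using assms by (simp add: expectation_finite[OF assms(1) order_refl] sum_mono mult_left_mono)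

lemma expectation_cong:
  fixes f g :: "'x \<Rightarrow> real"
  assumes "\<And>x. x \<in> set_pmf p \<Longrightarrow> f x = g x"
  shows "expect p f = expect p g"
  using assms by (intro integral_cong_AE) (auto simp: AE_measure_pmf_iff)

lemma expectation_le_const:
  fixes f :: "'x \<Rightarrow> real"
  assumes "finite (set_pmf p)" "\<And>x. x \<in> set_pmf p \<Longrightarrow> f x \<le> c"
  shows "expect p f \<le> c"
  using expectation_mono_finite[OF assms(1), of f "\<lambda>_. c"] assms(2) by simp

lemma expectation_ge_const:
  fixes f :: "'x \<Rightarrow> real"
  assumes "finite (set_pmf p)" "\<And>x. x \<in> set_pmf p \<Longrightarrow> c \<le> f x"
  shows "c \<le> expect p f"
  using expectation_mono_finite[OF assms(1), of "\<lambda>_. c" f] assms(2) by simp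

lemma expectation_bind_finite:
  fixes f :: "'y \<Rightarrow> real"
  assumes "finite (set_pmf p)" "\<And>x. x \<in> set_pmf p \<Longrightarrow> finite (set_pmf (W x))"
  shows "expect (bind_pmf p W) f
      = expect p (\<lambda>x. expect (W x) f)"
proof -
  let ?B = "\<Union>x\<in>set_pmf p. set_pmf (W x)"
  have fB: "finite ?B" using assms by auto
  have "expect (bind_pmf p W) f = (\<Sum>y\<in>?B. (\<Sum>x\<in>set_pmf p. pmf p x * pmf (W x) y) * f y)"
    using fB assms by (simp add: expectation_finite[of ?B] pmf_bind expectation_finite[of "set_pmf p" p])
  also have "\<dots> = (\<Sum>x\<in>set_pmf p. pmf p x * (\<Sum>y\<in>?B. pmf (W x) y * f y))"
    by (simp add: sum_distrib_left sum_distrib_right mult.assoc sum.swap[of _ "set_pmf p" ?B])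
  also have "\<dots> = (\<Sum>x\<in>set_pmf p. pmf p x * expect (W x) f)"
    using fB by (intro sum.cong refl arg_cong2[where f="(*)"] expectation_finite[symmetric]) auto
  finally show ?thesis using assms by (simp add: expectation_finite[of "set_pmf p" p])
qed

text \<open>Where \<open>pmf Q x = 0\<close> the quotient is \<open>0\<close> and its logarithm
  \<open>0\<close> instead of infinity, so the inequalities below assume inclusions of
  supports.\<close>

definition kl :: "'x pmf \<Rightarrow> 'x pmf \<Rightarrow> real" where
  "kl P Q = expect P (\<lambda>x. log 2 (pmf P x / pmf Q x))"

lemma kl_sum:
  assumes "finite A" "set_pmf P \<subseteq> A"
  shows "kl P Q = (\<Sum>x\<in>A. pmf P x * log 2 (pmf P x / pmf Q x))"
  unfolding kl_def by (rule expectation_finite[OF assms])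

lemma sum_pmf_le_1: "finite A \<Longrightarrow> sum (pmf Q) A \<le> 1"
  by (metis measure_measure_pmf_finite measure_pmf.prob_le_1)

lemma kl_nonneg:
  assumes "finite (set_pmf P)" "set_pmf P \<subseteq> set_pmf Q"
  shows "0 \<le> kl P Q"
proof -
  have "sum (pmf P) (set_pmf P) = 1" using assms(1) by (intro sum_pmf_eq_1) auto
  with log_sum_inequality[OF assms(1), of "pmf P" "pmf Q" 1] show ?thesis
    using assms by (simp add: kl_sum[OF assms(1) order_refl] sum_pmf_le_1 subset_iff set_pmf_iff pmf_nonneg)
qed

text \<open>Joint convexity of relative entropy. For every outcome \<open>y\<close> the log sum
  inequality is applied to the terms of the two mixtures; the common mixing weight
  \<open>pmf p x\<close> cancels in the quotients.\<close>

lemma kl_bind_le: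
  assumes fp: "finite (set_pmf p)" and fW: "\<And>x. x \<in> set_pmf p \<Longrightarrow> finite (set_pmf (W x))"
    and sub: "\<And>x. x \<in> set_pmf p \<Longrightarrow> set_pmf (W x) \<subseteq> set_pmf (V x)"
  shows "kl (bind_pmf p W) (bind_pmf p V) \<le> expect p (\<lambda>x. kl (W x) (V x))"
proof -
  let ?B = "\<Union>x\<in>set_pmf p. set_pmf (W x)"
  have fB: "finite ?B" using assms by auto
  have pb: "pmf (bind_pmf p U) y = (\<Sum>x\<in>set_pmf p. pmf p x * pmf (U x) y)" for U :: "_ \<Rightarrow> 'b pmf" and y
    by (simp add: pmf_bind expectation_finite[OF fp order_refl])
  have "kl (bind_pmf p W) (bind_pmf p V)
      = (\<Sum>y\<in>?B. pmf (bind_pmf p W) y * log 2 (pmf (bind_pmf p W) y / pmf (bind_pmf p V) y))"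
    using fB by (intro kl_sum) auto
  also have "\<dots> \<le> (\<Sum>y\<in>?B. \<Sum>x\<in>set_pmf p. pmf p x * pmf (W x) y * log 2 (pmf p x * pmf (W x) y / (pmf p x * pmf (V x) y)))"
  proof (rule sum_mono)
    fix y
    show "pmf (bind_pmf p W) y * log 2 (pmf (bind_pmf p W) y / pmf (bind_pmf p V) y)
      \<le> (\<Sum>x\<in>set_pmf p. pmf p x * pmf (W x) y * log 2 (pmf p x * pmf (W x) y / (pmf p x * pmf (V x) y)))"
      unfolding pb using fp
    proof (rule log_sum_inequality)
      fix x assume "x \<in> set_pmf p" "pmf p x * pmf (V x) y = 0"
      then show "pmf p x * pmf (W x) y = 0" using sub[of x] by (auto simp: set_pmf_iff)
    qed auto
  qed
  also have "\<dots> = (\<Sum>x\<in>set_pmf p. pmf p x * (\<Sum>y\<in>?B. pmf (W x) y * log 2 (pmf (W x) y / pmf (V x) y)))"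
    by (subst sum.swap) (auto simp: sum_distrib_left mult.assoc set_pmf_iff intro!: sum.cong)
  also have "\<dots> = (\<Sum>x\<in>set_pmf p. pmf p x * kl (W x) (V x))"
    using fB by (intro sum.cong refl arg_cong2[where f="(*)"] kl_sum[symmetric]) auto
  finally show ?thesis by (simp add: expectation_finite[OF fp order_refl])
qed

lemma pmf_map_finite:
  assumes "finite A" "set_pmf P \<subseteq> A"
  shows "pmf (map_pmf h P) y = (\<Sum>x\<in>{x\<in>A. h x = y}. pmf P x)"
proof -
  have "pmf (map_pmf h P) y = measure_pmf.prob P (h -` {y})" by (simp add: pmf_map)
  also have "\<dots> = measure_pmf.prob P {x\<in>A. h x = y}"
    using assms by (intro measure_pmf.finite_measure_eq_AE) (auto simp: AE_measure_pmf_iff)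
  also have "\<dots> = (\<Sum>x\<in>{x\<in>A. h x = y}. pmf P x)" using assms by (intro measure_measure_pmf_finite) auto
  finally show ?thesis .
qed

lemma pmf_map_ge_sum:
  assumes "finite A" "\<And>x. x \<in> A \<Longrightarrow> h x = y"
  shows "sum (pmf P) A \<le> pmf (map_pmf h P) y"
proof -
  have "sum (pmf P) A = measure_pmf.prob P A" using assms by (simp add: measure_measure_pmf_finite)
  also have "\<dots> \<le> measure_pmf.prob P (h -` {y})" using assms by (intro measure_pmf.finite_measure_mono) auto
  finally show ?thesis by (simp add: pmf_map)
qed

text \<open>Data processing: the log sum inequality on each fibre of \<open>h\<close>. Since
  \<open>Q\<close> may have mass on a fibre outside the support of \<open>P\<close>, the
  denominators are only bounded by the image mass.\<close>

lemma kl_map_le: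
  assumes fP: "finite (set_pmf P)" and sub: "set_pmf P \<subseteq> set_pmf Q"
  shows "kl (map_pmf h P) (map_pmf h Q) \<le> kl P Q"
proof -
  let ?A = "set_pmf P"
  have "kl (map_pmf h P) (map_pmf h Q)
      = (\<Sum>y\<in>h ` ?A. pmf (map_pmf h P) y * log 2 (pmf (map_pmf h P) y / pmf (map_pmf h Q) y))"
    using fP by (intro kl_sum) auto
  also have "\<dots> \<le> (\<Sum>y\<in>h ` ?A. \<Sum>x\<in>{x\<in>?A. h x = y}. pmf P x * log 2 (pmf P x / pmf Q x))"
  proof (rule sum_mono)
    fix y
    show "pmf (map_pmf h P) y * log 2 (pmf (map_pmf h P) y / pmf (map_pmf h Q) y)
      \<le> (\<Sum>x\<in>{x\<in>?A. h x = y}. pmf P x * log 2 (pmf P x / pmf Q x))"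
      unfolding pmf_map_finite[OF fP order_refl] using fP
    proof (intro log_sum_inequality)
      show "sum (pmf Q) {x \<in> ?A. h x = y} \<le> pmf (map_pmf h Q) y" using fP by (intro pmf_map_ge_sum) auto
    qed (use sub fP in \<open>auto simp: subset_iff pmf_eq_0_set_pmf\<close>)
  qed
  also have "\<dots> = (\<Sum>x\<in>?A. pmf P x * log 2 (pmf P x / pmf Q x))"
    using fP by (subst sum.image_gen[of ?A _ h]) auto
  finally show ?thesis by (simp add: kl_sum[OF fP order_refl])
qed

lemma kl_pair:
  assumes "finite (set_pmf P1)" "finite (set_pmf P2)"
    and "set_pmf P1 \<subseteq> set_pmf Q1" "set_pmf P2 \<subseteq> set_pmf Q2"
  shows "kl (pair_pmf P1 P2) (pair_pmf Q1 Q2) = kl P1 Q1 + kl P2 Q2"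
proof -
  have "kl (pair_pmf P1 P2) (pair_pmf Q1 Q2) =
     (\<Sum>x\<in>set_pmf P1. \<Sum>y\<in>set_pmf P2. pmf P1 x * pmf P2 y * log 2 (pmf P1 x * pmf P2 y / (pmf Q1 x * pmf Q2 y)))"
    using assms by (auto simp: kl_sum[of "set_pmf P1 \<times> set_pmf P2"] sum.cartesian_product pmf_pair intro!: sum.cong)
  also have "\<dots> = (\<Sum>x\<in>set_pmf P1. \<Sum>y\<in>set_pmf P2. pmf P2 y * (pmf P1 x * log 2 (pmf P1 x / pmf Q1 x))
        + pmf P1 x * (pmf P2 y * log 2 (pmf P2 y / pmf Q2 y)))"
  proof (intro sum.cong refl)
    fix x y assume "x \<in> set_pmf P1" "y \<in> set_pmf P2"
    then have "pmf P1 x > 0" "pmf Q1 x > 0" "pmf P2 y > 0" "pmf Q2 y > 0"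
      using assms by (auto simp: pmf_positive_iff)
    then show "pmf P1 x * pmf P2 y * log 2 (pmf P1 x * pmf P2 y / (pmf Q1 x * pmf Q2 y)) =
       pmf P2 y * (pmf P1 x * log 2 (pmf P1 x / pmf Q1 x)) + pmf P1 x * (pmf P2 y * log 2 (pmf P2 y / pmf Q2 y))"
      by (simp add: log_mult log_divide algebra_simps)
  qed
  also have "\<dots> = (\<Sum>y\<in>set_pmf P2. pmf P2 y) * (\<Sum>x\<in>set_pmf P1. pmf P1 x * log 2 (pmf P1 x / pmf Q1 x))
     + (\<Sum>x\<in>set_pmf P1. pmf P1 x) * (\<Sum>y\<in>set_pmf P2. pmf P2 y * log 2 (pmf P2 y / pmf Q2 y))"
    by (simp add: sum.distrib sum_distrib_left sum_distrib_right sum_product mult.assoc sum.swap[of _ "set_pmf P2" "set_pmf P1"])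
  also have "\<dots> = kl P1 Q1 + kl P2 Q2"
    using assms by (simp add: sum_pmf_eq_1 kl_sum[OF assms(1) order_refl] kl_sum[OF assms(2) order_refl])
  finally show ?thesis .
qed


section \<open>Mutual information of a channel\<close>

lemma distributed_measure_pmf:
  "distributed (measure_pmf p) (count_space UNIV) f (\<lambda>y. ennreal (pmf (map_pmf f p) y))"
proof -
  have "distr (measure_pmf p) (count_space UNIV) f = measure_pmf (map_pmf f p)"
    by (simp add: map_pmf_rep_eq)
  then show ?thesis
    by (simp add: distributed_def measure_pmf_eq_density[symmetric])
qed

text \<open>Countability makes the product of the two counting measures a counting measure again, so
  the pmfs serve as the densities of the general formula.\<close>

lemma mutual_info_eq:
  fixes q :: "('x::countable \<times> 'y::countable) pmf"
  assumes "finite (set_pmf q)"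
  shows "mutual_info q = expect q
     (\<lambda>(x,y). log 2 (pmf q (x,y) / (pmf (map_pmf fst q) x * pmf (map_pmf snd q) y)))"
proof -
  interpret information_space "measure_pmf q" 2
    by unfold_locales simp
  have sig: "sigma_finite_measure (count_space (UNIV::'x set))" "sigma_finite_measure (count_space (UNIV::'y set))"
    by (auto intro!: sigma_finite_measure_count_space)
  have pr: "count_space (UNIV::'x set) \<Otimes>\<^sub>M count_space (UNIV::'y set) = count_space UNIV"
    using pair_measure_countable[of "UNIV::'x set" "UNIV::'y set"] by simp
  have d: "distributed (measure_pmf q) (count_space UNIV \<Otimes>\<^sub>M count_space UNIV) (\<lambda>x. (fst x, snd x)) (\<lambda>y. ennreal (pmf q y))"
    using distributed_measure_pmf[of q "\<lambda>x. x"] by (simp add: pr)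
  have "mutual_info q = (\<integral>x. pmf q x * log 2 (pmf q x / (pmf (map_pmf fst q) (fst x) * pmf (map_pmf snd q) (snd x))) \<partial>count_space UNIV)"
    unfolding mutual_info_def
    by (subst mutual_information_distr[OF sig distributed_measure_pmf _ distributed_measure_pmf _ d]) (auto simp: pr)
  also have "\<dots> = expect q (\<lambda>x. log 2 (pmf q x / (pmf (map_pmf fst q) (fst x) * pmf (map_pmf snd q) (snd x))))"
    unfolding measure_pmf_eq_density by (subst integral_density) (auto simp: AE_count_space)
  finally show ?thesis by (simp add: case_prod_unfold)
qed

lemma map_fst_joint: "map_pmf fst (joint_pmf p W) = p"
  by (simp add: joint_pmf_def map_bind_pmf map_pmf_comp bind_return_pmf')

lemma map_snd_joint: "map_pmf snd (joint_pmf p W) = bind_pmf p W"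
  by (simp add: joint_pmf_def map_bind_pmf map_pmf_comp)

lemma set_joint: "set_pmf (joint_pmf p W) = Sigma (set_pmf p) (\<lambda>x. set_pmf (W x))"
  by (auto simp: joint_pmf_def)

lemma pmf_joint: "pmf (joint_pmf p W) (x, y) = pmf p x * pmf (W x) y"
proof -
  have "pmf (joint_pmf p W) (x, y) = expect p (\<lambda>z. pmf (map_pmf (Pair z) (W z)) (x, y))"
    by (simp add: joint_pmf_def pmf_bind)
  also have "\<dots> = expect p (\<lambda>z. indicator {x} z * pmf (W x) y)"
  proof (rule Bochner_Integration.integral_cong[OF refl])
    fix z
    have "pmf (map_pmf (Pair z) (W z)) (x, y) = measure_pmf.prob (W z) (Pair z -` {(x,y)})"
      by (simp add: pmf_map)
    also have "Pair z -` {(x,y)} = (if z = x then {y} else {})" by auto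
    finally show "pmf (map_pmf (Pair z) (W z)) (x, y) = indicator {x} z * pmf (W x) y"
      by (simp add: measure_pmf_single)
  qed
  finally show ?thesis by (simp add: measure_pmf_single)
qed

lemma expectation_joint:
  fixes f :: "'x \<Rightarrow> 'y \<Rightarrow> real"
  assumes "finite (set_pmf p)" "\<And>x. x \<in> set_pmf p \<Longrightarrow> finite (set_pmf (W x))"
  shows "expect (joint_pmf p W) (\<lambda>(x, y). f x y)
    = expect p (\<lambda>x. expect (W x) (f x))"
  using assms by (simp add: joint_pmf_def expectation_bind_finite)

lemma mutual_info_joint:
  fixes p :: "'x::countable pmf" and W :: "'x \<Rightarrow> 'y::countable pmf"
  assumes fp: "finite (set_pmf p)" and fW: "\<And>x. x \<in> set_pmf p \<Longrightarrow> finite (set_pmf (W x))"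
  shows "mutual_info (joint_pmf p W) = expect p (\<lambda>x. kl (W x) (bind_pmf p W))"
proof -
  have "finite (set_pmf (joint_pmf p W))" using assms by (simp add: set_joint)
  then have "mutual_info (joint_pmf p W) = expect (joint_pmf p W)
     (\<lambda>(x,y). log 2 (pmf p x * pmf (W x) y / (pmf p x * pmf (bind_pmf p W) y)))"
    by (simp add: mutual_info_eq map_fst_joint map_snd_joint pmf_joint)
  also have "\<dots> = expect (joint_pmf p W) (\<lambda>(x,y). log 2 (pmf (W x) y / pmf (bind_pmf p W) y))"
    by (rule expectation_cong) (auto simp: set_joint set_pmf_iff)
  finally show ?thesis using assms by (simp add: expectation_joint kl_def)
qed

lemma mutual_info_nonneg:
  fixes p :: "'x::countable pmf" and W :: "'x \<Rightarrow> 'y::countable pmf"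
  assumes fp: "finite (set_pmf p)" and fW: "\<And>x. x \<in> set_pmf p \<Longrightarrow> finite (set_pmf (W x))"
  shows "0 \<le> mutual_info (joint_pmf p W)"
  using assms by (subst mutual_info_joint) (auto intro!: expectation_ge_const kl_nonneg)

text \<open>The output law of the channel is the best comparison law: replacing it by
  \<open>Q\<close> raises the mean divergence by exactly \<open>kl (bind_pmf p W) Q \<ge> 0\<close>.
  The upper bounds on information below come from a convenient choice of \<open>Q\<close>.\<close>

lemma mutual_info_le:
  fixes p :: "'x::countable pmf" and W :: "'x \<Rightarrow> 'y::countable pmf"
  assumes fp: "finite (set_pmf p)" and fW: "\<And>x. x \<in> set_pmf p \<Longrightarrow> finite (set_pmf (W x))"
    and sub: "\<And>x. x \<in> set_pmf p \<Longrightarrow> set_pmf (W x) \<subseteq> set_pmf Q"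
  shows "mutual_info (joint_pmf p W) \<le> expect p (\<lambda>x. kl (W x) Q)"
proof -
  let ?B = "bind_pmf p W"
  have fB: "finite (set_pmf ?B)" using assms by auto
  have kl: "kl (W x) ?B = kl (W x) Q - expect (W x) (\<lambda>y. log 2 (pmf ?B y / pmf Q y))"
    if "x \<in> set_pmf p" for x
  proof -
    have "pmf (W x) y * log 2 (pmf (W x) y / pmf ?B y)
      = pmf (W x) y * log 2 (pmf (W x) y / pmf Q y) - pmf (W x) y * log 2 (pmf ?B y / pmf Q y)"
      if "y \<in> set_pmf (W x)" for y
    proof -
      have "y \<in> set_pmf ?B" "y \<in> set_pmf Q" using that \<open>x \<in> set_pmf p\<close> sub by auto
      then have "pmf (W x) y > 0" "pmf ?B y > 0" "pmf Q y > 0" using that by (auto simp: pmf_positive_iff)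
      then show ?thesis by (simp add: log_divide algebra_simps)
    qed
    then show ?thesis using fW[OF that]
      by (simp add: kl_sum[OF fW[OF that] order_refl] expectation_finite[OF fW[OF that] order_refl] sum_subtractf)
  qed
  have "mutual_info (joint_pmf p W)
     = expect p (\<lambda>x. kl (W x) Q - expect (W x) (\<lambda>y. log 2 (pmf ?B y / pmf Q y)))"
    using fp fW by (subst mutual_info_joint) (auto intro!: expectation_cong simp: kl)
  also have "\<dots> = expect p (\<lambda>x. kl (W x) Q) - kl ?B Q"
    unfolding kl_def[of ?B] by (subst expectation_bind_finite[OF fp fW])
      (auto simp: expectation_finite[OF fp order_refl] sum_subtractf right_diff_distrib)
  also have "\<dots> \<le> expect p (\<lambda>x. kl (W x) Q)"
    using kl_nonneg[OF fB, of Q] sub by auto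
  finally show ?thesis .
qed


section \<open>Conditional empirical entropy as an average over positions\<close>

lemma conditional_entropy_pmf:
  fixes q :: "('x::countable \<times> 'y::countable) pmf"
  shows "prob_space.conditional_entropy (measure_pmf q) 2 (count_space UNIV) (count_space UNIV) snd fst
     = expect q (\<lambda>z. - log 2 (pmf q z / pmf (map_pmf fst q) (fst z)))"
proof -
  interpret information_space "measure_pmf q" 2
    by unfold_locales simp
  let ?s = "map_pmf (\<lambda>x. (snd x, fst x)) q"
  have sig: "sigma_finite_measure (count_space (UNIV::'x set))" "sigma_finite_measure (count_space (UNIV::'y set))"
    by (auto intro!: sigma_finite_measure_count_space)
  have pr: "count_space (UNIV::'y set) \<Otimes>\<^sub>M count_space (UNIV::'x set) = count_space UNIV"
    using pair_measure_countable[of "UNIV::'y set" "UNIV::'x set"] by simp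
  have d: "distributed (measure_pmf q) (count_space UNIV \<Otimes>\<^sub>M count_space UNIV) (\<lambda>x. (snd x, fst x)) (\<lambda>y. ennreal (pmf ?s y))"
    using distributed_measure_pmf[of q "\<lambda>x. (snd x, fst x)"] by (simp add: pr)
  have s: "pmf ?s (b, a) = pmf q (a, b)" for a b
    using pmf_map_inj'[of "\<lambda>x. (snd x, fst x)" q "(a, b)"] by (auto simp: inj_def)
  have "prob_space.conditional_entropy (measure_pmf q) 2 (count_space UNIV) (count_space UNIV) snd fst
     = - (\<integral>x. pmf ?s x * log 2 (pmf ?s x / pmf (map_pmf fst q) (snd x)) \<partial>count_space UNIV)"
    by (subst conditional_entropy_generic_eq[OF sig(2,1) distributed_measure_pmf _ d]) (auto simp: pr case_prod_unfold)
  also have "\<dots> = - expect ?s (\<lambda>x. log 2 (pmf ?s x / pmf (map_pmf fst q) (snd x)))"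
    unfolding measure_pmf_eq_density[of ?s] by (subst integral_density) (auto simp: AE_count_space)
  finally show ?thesis by (simp add: s case_prod_unfold)
qed

definition context_of :: "nat \<Rightarrow> 'b list \<Rightarrow> nat \<Rightarrow> 'b list" where
  "context_of k ys i = take k (drop (i - k) ys)"

text \<open>The empirical law belongs to a uniformly chosen position together with its context,
  which turns expectations under it into averages along the word.\<close>

lemma emp_pmf_eq:
  assumes "k < length ys"
  shows "emp_pmf k ys = map_pmf (\<lambda>i. (context_of k ys i, ys ! i)) (pmf_of_set {k..<length ys})"
proof -
  let ?p = "map_pmf (\<lambda>i. (context_of k ys i, ys ! i)) (pmf_of_set {k..<length ys})"
  have "(\<lambda>(b, \<beta>). emp_freq k ys b \<beta>) = pmf ?p"
  proof (rule ext, clarify)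
    fix b \<beta>
    have "{k..<length ys} \<inter> (\<lambda>i. (context_of k ys i, ys ! i)) -` {(b, \<beta>)}
      = {i. k \<le> i \<and> i < length ys \<and> take k (drop (i - k) ys) = b \<and> ys ! i = \<beta>}"
      by (auto simp: context_of_def)
    then show "emp_freq k ys b \<beta> = pmf ?p (b, \<beta>)"
      using assms by (simp add: pmf_map measure_pmf_of_set emp_freq_def)
  qed
  then show ?thesis
    unfolding emp_pmf_def using type_definition.Rep_inverse[OF td_pmf_embed_pmf, of ?p] by simp
qed

text \<open>A context that does not occur gets the zero row, so the row sums are \<open>1\<close> or
  \<open>0\<close>.\<close>

definition emp_kernel :: "nat \<Rightarrow> 'b list \<Rightarrow> 'b list \<Rightarrow> 'b \<Rightarrow> real" where
  "emp_kernel k ys b \<beta> = pmf (emp_pmf k ys) (b, \<beta>) / pmf (map_pmf fst (emp_pmf k ys)) b"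

lemma emp_cond_entropy_eq:
  fixes ys :: "'b::finite list"
  assumes "k < length ys"
  shows "emp_cond_entropy k ys
    = (\<Sum>i\<in>{k..<length ys}. - log 2 (emp_kernel k ys (context_of k ys i) (ys ! i))) / real (length ys - k)"
proof -
  have "emp_cond_entropy k ys = expect (emp_pmf k ys)
      (\<lambda>z. - log 2 (emp_kernel k ys (fst z) (snd z)))"
    unfolding emp_cond_entropy_def by (subst conditional_entropy_pmf) (simp add: emp_kernel_def)
  also have "\<dots> = expect (pmf_of_set {k..<length ys})
      (\<lambda>i. - log 2 (emp_kernel k ys (context_of k ys i) (ys ! i)))"
    by (subst (1) emp_pmf_eq[OF assms]) simp
  also have "\<dots> = (\<Sum>i\<in>{k..<length ys}. - log 2 (emp_kernel k ys (context_of k ys i) (ys ! i))) / real (length ys - k)"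
    using assms by (subst integral_pmf_of_set) auto
  finally show ?thesis .
qed

lemma pmf_map_fst_eq:
  fixes q :: "('x \<times> 'y::finite) pmf"
  shows "pmf (map_pmf fst q) b = (\<Sum>\<beta>\<in>UNIV. pmf q (b, \<beta>))"
proof -
  have "pmf (map_pmf fst q) b = measure_pmf.prob q (Pair b ` UNIV)"
    by (auto simp: pmf_map intro!: arg_cong[where f="measure_pmf.prob q"])
  also have "\<dots> = (\<Sum>\<beta>\<in>UNIV. pmf q (b, \<beta>))"
    by (subst measure_measure_pmf_finite) (auto simp: sum.reindex inj_on_def)
  finally show ?thesis .
qed

lemma emp_kernel_nonneg: "0 \<le> emp_kernel k ys b \<beta>"
  by (simp add: emp_kernel_def)

lemma emp_kernel_sum_le_1:
  fixes ys :: "'b::finite list"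
  shows "(\<Sum>\<beta>\<in>UNIV. emp_kernel k ys b \<beta>) \<le> 1"
  by (simp add: emp_kernel_def sum_divide_distrib[symmetric] pmf_map_fst_eq)

lemma emp_kernel_pos:
  fixes ys :: "'b::finite list"
  assumes "k \<le> i" "i < length ys"
  shows "0 < emp_kernel k ys (context_of k ys i) (ys ! i)"
proof -
  have "(context_of k ys i, ys ! i) \<in> set_pmf (emp_pmf k ys)" using assms by (simp add: emp_pmf_eq)
  moreover from this have "context_of k ys i \<in> set_pmf (map_pmf fst (emp_pmf k ys))" by force
  ultimately show ?thesis by (simp add: emp_kernel_def pmf_positive del: set_map_pmf)
qed

lemma emp_cond_entropy_nonneg:
  fixes ys :: "'b::finite list"
  assumes "k < length ys"
  shows "0 \<le> emp_cond_entropy k ys"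
  unfolding emp_cond_entropy_eq[OF assms]
proof (intro divide_nonneg_nonneg sum_nonneg)
  fix i assume i: "i \<in> {k..<length ys}"
  have "emp_kernel k ys (context_of k ys i) (ys ! i) \<le> (\<Sum>\<beta>\<in>UNIV. emp_kernel k ys (context_of k ys i) \<beta>)"
    by (intro member_le_sum emp_kernel_nonneg) auto
  also note emp_kernel_sum_le_1
  finally show "0 \<le> - log 2 (emp_kernel k ys (context_of k ys i) (ys ! i))"
    using emp_kernel_pos[of k i ys] i by simp
qed simp

text \<open>The excess of the right side is the divergence of the empirical law from the weights
  with the same context marginal and kernel \<open>q\<close>. These weights have total at most
  \<open>1\<close>, so the log sum inequality shows that the excess is nonnegative.\<close>

lemma emp_cond_entropy_le:
  fixes ys :: "'b::finite list"
  assumes k: "k < length ys" and q0: "\<And>b \<beta>. 0 \<le> q b \<beta>" and q1: "\<And>b. (\<Sum>\<beta>\<in>UNIV. q b \<beta>) \<le> 1"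
    and pos: "\<And>i. k \<le> i \<Longrightarrow> i < length ys \<Longrightarrow> 0 < q (context_of k ys i) (ys ! i)"
  shows "emp_cond_entropy k ys
     \<le> (\<Sum>i\<in>{k..<length ys}. - log 2 (q (context_of k ys i) (ys ! i))) / real (length ys - k)"
proof -
  let ?P = "emp_pmf k ys" let ?P1 = "map_pmf fst ?P" and ?f = "\<lambda>i. (context_of k ys i, ys ! i)"
  have set: "set_pmf ?P = ?f ` {k..<length ys}" using k by (simp add: emp_pmf_eq)
  then have fin: "finite (set_pmf ?P)" by simp
  have "(\<Sum>z\<in>set_pmf ?P. pmf ?P1 (fst z) * q (fst z) (snd z))
      \<le> (\<Sum>z\<in>set_pmf ?P1 \<times> UNIV. pmf ?P1 (fst z) * q (fst z) (snd z))"
    using fin by (intro sum_mono2) (auto simp: q0 intro: rev_image_eqI)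
  also have "\<dots> = (\<Sum>b\<in>set_pmf ?P1. pmf ?P1 b * (\<Sum>\<beta>\<in>UNIV. q b \<beta>))"
    by (simp add: sum_distrib_left sum.cartesian_product case_prod_unfold)
  also have "\<dots> \<le> (\<Sum>b\<in>set_pmf ?P1. pmf ?P1 b * 1)" by (intro sum_mono mult_left_mono q1) auto
  also have "\<dots> \<le> 1" using fin by (simp add: sum_pmf_le_1)
  finally have le1: "(\<Sum>z\<in>set_pmf ?P. pmf ?P1 (fst z) * q (fst z) (snd z)) \<le> 1" .
  have P1pos: "pmf ?P1 (fst z) > 0" if "z \<in> set_pmf ?P" for z
    using that by (auto simp: pmf_positive_iff)
  have qpos: "q (fst z) (snd z) > 0" if "z \<in> set_pmf ?P" for z
    using that pos unfolding set by auto
  have "0 \<le> (\<Sum>z\<in>set_pmf ?P. pmf ?P z * log 2 (pmf ?P z / (pmf ?P1 (fst z) * q (fst z) (snd z))))"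
  proof -
    have "sum (pmf ?P) (set_pmf ?P) = 1" using fin by (intro sum_pmf_eq_1) auto
    with log_sum_inequality[OF fin, of "pmf ?P" "\<lambda>z. pmf ?P1 (fst z) * q (fst z) (snd z)" 1] le1 q0
    show ?thesis using P1pos qpos by (force simp: less_le)
  qed
  also have "\<dots> = (\<Sum>z\<in>set_pmf ?P. pmf ?P z * (log 2 (emp_kernel k ys (fst z) (snd z)) - log 2 (q (fst z) (snd z))))"
  proof (intro sum.cong refl)
    fix z assume z: "z \<in> set_pmf ?P"
    then have "pmf ?P z > 0" by (simp add: pmf_positive)
    with P1pos[OF z] qpos[OF z]
    show "pmf ?P z * log 2 (pmf ?P z / (pmf ?P1 (fst z) * q (fst z) (snd z)))
      = pmf ?P z * (log 2 (emp_kernel k ys (fst z) (snd z)) - log 2 (q (fst z) (snd z)))"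
      by (simp add: emp_kernel_def log_divide log_mult)
  qed
  also have "\<dots> = expect ?P (\<lambda>z. log 2 (emp_kernel k ys (fst z) (snd z)) - log 2 (q (fst z) (snd z)))"
    by (rule expectation_finite[OF fin order_refl, symmetric])
  also have "\<dots> = (\<Sum>i\<in>{k..<length ys}. log 2 (emp_kernel k ys (context_of k ys i) (ys ! i))
        - log 2 (q (context_of k ys i) (ys ! i))) / real (length ys - k)"
    using k by (subst (1) emp_pmf_eq[OF k]) (simp add: integral_pmf_of_set)
  finally show ?thesis
    unfolding emp_cond_entropy_eq[OF k] by (simp add: sum_subtractf diff_divide_distrib sum_negf)
qed

section \<open>Convergence of the annealing Gibbs sampler\<close>

lemma finite_windows: "finite (windows kf :: 'a::finite list set)"
  and card_windows: "card (windows kf :: 'a::finite list set) = CARD('a) ^ (2 * kf + 1)"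
  and windows_nonempty: "windows kf \<noteq> ({} :: 'a list set)"
proof -
  show "finite (windows kf :: 'a::finite list set)"
    using finite_lists_length_eq[of "UNIV :: 'a set" "2 * kf + 1"] by (simp add: windows_def)
  show "card (windows kf :: 'a::finite list set) = CARD('a) ^ (2 * kf + 1)"
    using card_lists_length_eq[of "UNIV :: 'a set" "2 * kf + 1"] by (simp add: windows_def)
  have "replicate (2 * kf + 1) undefined \<in> (windows kf :: 'a list set)" by (simp add: windows_def)
  then show "windows kf \<noteq> ({} :: 'a list set)" by blast
qed

lemma finite_sb_codes: "finite (sb_codes kf :: ('a::finite list \<Rightarrow> 'b::finite) set)"
  unfolding sb_codes_def by (intro finite_PiE finite_windows) auto

lemma sb_codes_nonempty: "sb_codes kf \<noteq> ({} :: ('a list \<Rightarrow> 'b) set)"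
  unfolding sb_codes_def by (simp add: PiE_eq_empty_iff)

lemma sb_codes_upd: "f \<in> sb_codes kf \<Longrightarrow> w \<in> windows kf \<Longrightarrow> f(w := \<theta>) \<in> sb_codes kf"
  by (auto simp: sb_codes_def PiE_def extensional_def)

lemma pmf_bind_ge: "pmf p x * pmf (k x) y \<le> pmf (bind_pmf p k) y"
proof -
  have "pmf p x * pmf (k x) y = (\<integral>z. indicator {x} z * pmf (k x) y \<partial>measure_pmf p)"
    by (simp add: measure_pmf_single)
  also have "\<dots> \<le> (\<integral>z. pmf (k z) y \<partial>measure_pmf p)"
    by (intro integral_mono measure_pmf.integrable_const_bound[where B=1])
       (auto simp: pmf_le_1 indicator_def)
  finally show ?thesis by (simp add: pmf_bind)
qed

lemma pmf_gibbs_pmf: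
  "pmf (gibbs_pmf E \<beta> f w) \<theta> = exp (- \<beta> * E (f(w := \<theta>))) / (\<Sum>\<xi>\<in>UNIV. exp (- \<beta> * E (f(w := \<xi>))))"
  unfolding gibbs_pmf_def
proof (rule pmf_embed_pmf)
  have pos: "(\<Sum>\<xi>\<in>UNIV. exp (- \<beta> * E (f(w := \<xi>)))) > 0" by (intro sum_pos) auto
  then show "0 \<le> exp (- \<beta> * E (f(w := \<theta>))) / (\<Sum>\<xi>\<in>UNIV. exp (- \<beta> * E (f(w := \<xi>))))" for \<theta>
    by simp
  show "(\<integral>\<^sup>+\<theta>. ennreal (exp (- \<beta> * E (f(w := \<theta>))) / (\<Sum>\<xi>\<in>UNIV. exp (- \<beta> * E (f(w := \<xi>))))) \<partial>count_space UNIV) = 1"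
    using pos by (subst nn_integral_count_space_finite)
      (auto simp: sum_ennreal sum_nonneg sum_divide_distrib[symmetric])
qed

text \<open>Each term of the normalising sum is at most \<open>exp (b * \<Delta>)\<close> times the
  numerator, and there are \<open>CARD('b)\<close> terms; the uniform choice of the window gives the
  remaining factor.\<close>

lemma gibbs_step_ge:
  fixes E :: "('a::finite list \<Rightarrow> 'b::finite) \<Rightarrow> real"
  assumes \<beta>: "0 \<le> \<beta>" "\<beta> \<le> b" and w: "w \<in> windows kf"
    and \<Delta>: "\<And>\<xi>. \<bar>E (f(w := \<xi>)) - E (f(w := \<theta>))\<bar> \<le> \<Delta>"
  shows "exp (- b * \<Delta>) / (CARD('a) ^ (2 * kf + 1) * CARD('b)) \<le> pmf (gibbs_step kf E \<beta> f) (f(w := \<theta>))"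
proof -
  have D0: "0 \<le> \<Delta>" using \<Delta>[of \<theta>] by simp
  have "exp (- b * \<Delta>) / CARD('b) \<le> pmf (gibbs_pmf E \<beta> f w) \<theta>"
  proof -
    have "(\<Sum>\<xi>\<in>UNIV. exp (- \<beta> * E (f(w := \<xi>)))) \<le> (\<Sum>\<xi>\<in>(UNIV::'b set). exp (- \<beta> * E (f(w := \<theta>))) * exp (b * \<Delta>))"
    proof (rule sum_mono)
      fix \<xi>
      have "\<beta> * (E (f(w := \<theta>)) - E (f(w := \<xi>))) \<le> b * \<Delta>"
        using \<Delta>[of \<xi>] \<beta> D0 mult_left_mono[of "E (f(w := \<theta>)) - E (f(w := \<xi>))" \<Delta> \<beta>]
          mult_right_mono[of \<beta> b \<Delta>] by linarith
      then show "exp (- \<beta> * E (f(w := \<xi>))) \<le> exp (- \<beta> * E (f(w := \<theta>))) * exp (b * \<Delta>)"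
        by (simp add: exp_add[symmetric] algebra_simps)
    qed
    also have "\<dots> = CARD('b) * (exp (- \<beta> * E (f(w := \<theta>))) * exp (b * \<Delta>))" by simp
    finally have "exp (- \<beta> * E (f(w := \<theta>))) / (CARD('b) * (exp (- \<beta> * E (f(w := \<theta>))) * exp (b * \<Delta>)))
        \<le> pmf (gibbs_pmf E \<beta> f w) \<theta>"
      unfolding pmf_gibbs_pmf by (intro divide_left_mono mult_pos_pos sum_pos) auto
    then show ?thesis by (simp add: exp_minus field_simps)
  qed
  also have "\<dots> \<le> pmf (map_pmf (\<lambda>\<theta>. f(w := \<theta>)) (gibbs_pmf E \<beta> f w)) (f(w := \<theta>))"
    by (simp add: pmf_map measure_pmf_single[symmetric] del: measure_pmf_single)
       (intro measure_pmf.finite_measure_mono, auto)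
  finally have "pmf (pmf_of_set (windows kf)) w * (exp (- b * \<Delta>) / CARD('b))
      \<le> pmf (pmf_of_set (windows kf)) w * pmf (map_pmf (\<lambda>\<theta>. f(w := \<theta>)) (gibbs_pmf E \<beta> f w)) (f(w := \<theta>))"
    by (intro mult_left_mono) auto
  also have "\<dots> \<le> pmf (gibbs_step kf E \<beta> f) (f(w := \<theta>))"
    unfolding gibbs_step_def by (rule pmf_bind_ge)
  finally show ?thesis
    using w windows_nonempty[where 'a='a, of kf] finite_windows[where 'a='a, of kf]
    by (simp add: card_windows)
qed

lemma set_gibbs_step:
  fixes E :: "('a::finite list \<Rightarrow> 'b::finite) \<Rightarrow> real"
  shows "f \<in> sb_codes kf \<Longrightarrow> set_pmf (gibbs_step kf E \<beta> f) \<subseteq> sb_codes kf"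
  by (auto simp: gibbs_step_def finite_windows windows_nonempty intro!: sb_codes_upd)

lemma set_annealing:
  fixes E :: "('a::finite list \<Rightarrow> 'b::finite) \<Rightarrow> real"
  shows "f \<in> sb_codes kf \<Longrightarrow> set_pmf (annealing kf E \<beta> f r) \<subseteq> sb_codes kf"
  using set_gibbs_step by (induction r) (auto, blast)

lemma annealing_add:
  "annealing kf E \<beta> f (t + j) = bind_pmf (annealing kf E \<beta> f t) (\<lambda>g. annealing kf E (\<lambda>i. \<beta> (t + i)) g j)"
  by (induction j) (simp_all add: bind_return_pmf' bind_assoc_pmf)

text \<open>One path suffices: visit every window exactly once in a fixed order and write the value
  of \<open>g\<close> there. Its probability is at least the product of the single step
  bounds.\<close>

lemma annealing_minorization:
  fixes E :: "('a::finite list \<Rightarrow> 'b::finite) \<Rightarrow> real"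
  assumes \<Delta>: "\<And>f w \<xi> \<theta>. f \<in> sb_codes kf \<Longrightarrow> w \<in> windows kf \<Longrightarrow> \<bar>E (f(w := \<xi>)) - E (f(w := \<theta>))\<bar> \<le> \<Delta>"
    and \<beta>: "\<And>i. 1 \<le> i \<Longrightarrow> i \<le> CARD('a) ^ (2 * kf + 1) \<Longrightarrow> 0 \<le> \<beta> i \<and> \<beta> i \<le> b"
    and f: "f \<in> sb_codes kf" and g: "g \<in> sb_codes kf"
  shows "(exp (- b * \<Delta>) / (CARD('a) ^ (2 * kf + 1) * CARD('b))) ^ (CARD('a) ^ (2 * kf + 1))
     \<le> pmf (annealing kf E \<beta> f (CARD('a) ^ (2 * kf + 1))) g"
proof -
  let ?a = "exp (- b * \<Delta>) / (CARD('a) ^ (2 * kf + 1) * CARD('b))"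
  \<comment> \<open>\<open>override_on f g (set ws)\<close> is the code after the windows listed in
    \<open>ws\<close> have been rewritten.\<close>
  have gen: "distinct ws \<Longrightarrow> set ws \<subseteq> windows kf \<Longrightarrow> length ws \<le> CARD('a) ^ (2 * kf + 1) \<Longrightarrow>
     ?a ^ length ws \<le> pmf (annealing kf E \<beta> f (length ws)) (override_on f g (set ws))
     \<and> override_on f g (set ws) \<in> sb_codes kf" for ws
  proof (induction ws rule: rev_induct)
    case Nil then show ?case using f by simp
  next
    case (snoc w ws)
    let ?h = "override_on f g (set ws)"
    have eq: "override_on f g (set (ws @ [w])) = ?h(w := g w)"
      by (auto simp: override_on_def fun_eq_iff)
    have h: "?h \<in> sb_codes kf" "?a ^ length ws \<le> pmf (annealing kf E \<beta> f (length ws)) ?h"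
      using snoc by auto
    have "?a ^ length ws * ?a \<le> pmf (annealing kf E \<beta> f (length ws)) ?h
        * pmf (gibbs_step kf E (\<beta> (Suc (length ws))) ?h) (?h(w := g w))"
    proof (intro mult_mono h gibbs_step_ge)
      show "\<bar>E (?h(w := \<xi>)) - E (?h(w := g w))\<bar> \<le> \<Delta>" for \<xi>
        using \<Delta>[OF h(1)] snoc by auto
    qed (use \<beta>[of "Suc (length ws)"] snoc in auto)
    also have "\<dots> \<le> pmf (annealing kf E \<beta> f (Suc (length ws))) (?h(w := g w))"
      by (simp add: pmf_bind_ge)
    finally have "?a ^ length (ws @ [w]) \<le> pmf (annealing kf E \<beta> f (length (ws @ [w]))) (?h(w := g w))"
      by (simp add: mult.commute del: annealing.simps)
    moreover have "?h(w := g w) \<in> sb_codes kf" using h(1) snoc.prems by (intro sb_codes_upd) auto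
    ultimately show ?case unfolding eq by blast
  qed
  obtain ws where ws: "set ws = (windows kf :: 'a list set)" "distinct ws"
    using finite_distinct_list[OF finite_windows] by blast
  have len: "length ws = CARD('a) ^ (2 * kf + 1)" using distinct_card[OF ws(2)] ws(1) by (simp add: card_windows)
  \<comment> \<open>Codes are extensional, so agreement on all windows is equality.\<close>
  have "override_on f g (windows kf) = g"
    using f g by (auto simp: override_on_def fun_eq_iff sb_codes_def PiE_def extensional_def)
  with gen[of ws] ws len show ?thesis by simp
qed

section \<open>Kernels acting on weights and their contraction\<close>

definition act :: "'s set \<Rightarrow> ('s \<Rightarrow> 's pmf) \<Rightarrow> ('s \<Rightarrow> real) \<Rightarrow> 's \<Rightarrow> real" where
  "act S k v y = (\<Sum>x\<in>S. v x * pmf (k x) y)"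

definition l1 :: "'s set \<Rightarrow> ('s \<Rightarrow> real) \<Rightarrow> ('s \<Rightarrow> real) \<Rightarrow> real" where
  "l1 S u v = (\<Sum>x\<in>S. \<bar>u x - v x\<bar>)"

lemma pmf_bind_act:
  assumes "finite S" "set_pmf p \<subseteq> S"
  shows "pmf (bind_pmf p k) y = act S k (pmf p) y"
  using integral_measure_pmf_real[of S p "\<lambda>x. pmf (k x) y"] assms
  by (auto simp: act_def pmf_bind mult.commute)

lemma act_bind:
  assumes "finite S" "\<And>x. x \<in> S \<Longrightarrow> set_pmf (k x) \<subseteq> S"
  shows "act S (\<lambda>x. bind_pmf (k x) h) v y = act S h (act S k v) y"
proof -
  have "act S (\<lambda>x. bind_pmf (k x) h) v y = (\<Sum>x\<in>S. v x * (\<Sum>z\<in>S. pmf (k x) z * pmf (h z) y))"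
    unfolding act_def using assms pmf_bind_act[of S "k _" h y]
    by (intro sum.cong) (auto simp: act_def)
  also have "\<dots> = act S h (act S k v) y"
    unfolding act_def sum_distrib_left sum_distrib_right by (subst sum.swap) (simp add: mult.assoc)
  finally show ?thesis .
qed

lemma act_cong: "(\<And>x. x \<in> S \<Longrightarrow> u x = v x) \<Longrightarrow> act S k u = act S k v"
  by (auto simp: act_def fun_eq_iff)

text \<open>Doeblin's argument. As \<open>u\<close> and \<open>v\<close> have equal mass,
  subtracting \<open>a\<close> from all entries of the kernel does not affect the difference of the
  images, and the remaining entries are nonnegative with row sums \<open>1 - a * card S\<close>.
  With \<open>a = 0\<close> it says that a kernel never increases the distance.\<close>

lemma l1_act_le:
  assumes S: "finite S" and k: "\<And>x. x \<in> S \<Longrightarrow> set_pmf (k x) \<subseteq> S"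
    and a: "\<And>x y. x \<in> S \<Longrightarrow> y \<in> S \<Longrightarrow> a \<le> pmf (k x) y" and uv: "sum u S = sum v S"
  shows "l1 S (act S k u) (act S k v) \<le> (1 - a * card S) * l1 S u v"
proof -
  have "l1 S (act S k u) (act S k v) = (\<Sum>y\<in>S. \<bar>\<Sum>x\<in>S. (u x - v x) * (pmf (k x) y - a)\<bar>)"
  proof -
    have "(\<Sum>x\<in>S. (u x - v x) * (pmf (k x) y - a)) = act S k u y - act S k v y" for y
      using uv by (simp add: act_def left_diff_distrib right_diff_distrib sum_subtractf sum_distrib_right[symmetric])
    then show ?thesis by (simp add: l1_def)
  qed
  also have "\<dots> \<le> (\<Sum>y\<in>S. \<Sum>x\<in>S. \<bar>u x - v x\<bar> * (pmf (k x) y - a))"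
    using a by (intro sum_mono order.trans[OF sum_abs]) (auto simp: abs_mult)
  also have "\<dots> = (\<Sum>x\<in>S. \<bar>u x - v x\<bar> * (\<Sum>y\<in>S. pmf (k x) y - a))"
    by (subst sum.swap) (simp add: sum_distrib_left)
  also have "\<dots> = (\<Sum>x\<in>S. \<bar>u x - v x\<bar> * (1 - a * card S))"
    using S k by (simp add: sum_subtractf sum_pmf_eq_1 mult.commute)
  finally show ?thesis by (simp add: l1_def sum_distrib_left mult.commute)
qed

lemma l1_triangle: "l1 S u w \<le> l1 S u v + l1 S v w"
  unfolding l1_def sum.distrib[symmetric] by (intro sum_mono) linarith

lemma l1_nonneg: "0 \<le> l1 S u v" by (simp add: l1_def sum_nonneg)

section \<open>Gibbs weights: invariance and dependence on the temperature\<close>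

definition gibbs_weight :: "'s set \<Rightarrow> ('s \<Rightarrow> real) \<Rightarrow> real \<Rightarrow> 's \<Rightarrow> real" where
  "gibbs_weight S E \<beta> x = exp (- \<beta> * E x) / (\<Sum>y\<in>S. exp (- \<beta> * E y))"

lemma pmf_map_upd:
  "pmf (map_pmf (\<lambda>\<theta>. f(w := \<theta>)) p) g = (if f(w := g w) = g then pmf p (g w) else 0)"
proof -
  have "(\<lambda>\<theta>. f(w := \<theta>)) -` {g} = (if f(w := g w) = g then {g w} else {})"
    by (auto split: if_splits)
  then show ?thesis by (simp add: pmf_map measure_pmf_single)
qed

lemma pmf_gibbs_step:
  fixes E :: "('a::finite list \<Rightarrow> 'b::finite) \<Rightarrow> real"
  shows "pmf (gibbs_step kf E \<beta> f) g =
    (\<Sum>w\<in>windows kf. if f(w := g w) = g then pmf (gibbs_pmf E \<beta> f w) (g w) else 0) / card (windows kf :: 'a list set)"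
  unfolding gibbs_step_def pmf_bind
  by (subst integral_pmf_of_set) (auto simp: finite_windows windows_nonempty pmf_map_upd)

text \<open>Codes that are exchanged by rewriting the window \<open>w\<close> agree off
  \<open>w\<close>, so both transitions have the same normalising sum and each side carries the
  product of the same two exponentials.\<close>

lemma gibbs_detailed_balance:
  fixes E :: "('a::finite list \<Rightarrow> 'b::finite) \<Rightarrow> real"
  shows "exp (- \<beta> * E f) * pmf (gibbs_step kf E \<beta> f) g = exp (- \<beta> * E g) * pmf (gibbs_step kf E \<beta> g) f"
proof -
  have "exp (- \<beta> * E f) * (if f(w := g w) = g then pmf (gibbs_pmf E \<beta> f w) (g w) else 0)
    = exp (- \<beta> * E g) * (if g(w := f w) = f then pmf (gibbs_pmf E \<beta> g w) (f w) else 0)" for w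
  proof (cases "f(w := g w) = g")
    case True
    then have "g(w := f w) = f" "\<And>\<xi>. g(w := \<xi>) = f(w := \<xi>)"
      by (metis fun_upd_triv fun_upd_upd)+
    with True show ?thesis by (simp add: pmf_gibbs_pmf)
  next
    case False
    then have "g(w := f w) \<noteq> f" by (metis fun_upd_triv fun_upd_upd)
    with False show ?thesis by simp
  qed
  then show ?thesis unfolding pmf_gibbs_step by (simp add: sum_distrib_left)
qed

lemma gibbs_step_invariant:
  fixes E :: "('a::finite list \<Rightarrow> 'b::finite) \<Rightarrow> real"
  assumes g: "g \<in> sb_codes kf"
  shows "act (sb_codes kf) (gibbs_step kf E \<beta>) (gibbs_weight (sb_codes kf) E \<beta>) g = gibbs_weight (sb_codes kf) E \<beta> g"
proof -
  let ?Z = "\<Sum>y\<in>sb_codes kf. exp (- \<beta> * E y)"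
  have "act (sb_codes kf) (gibbs_step kf E \<beta>) (gibbs_weight (sb_codes kf) E \<beta>) g
     = (\<Sum>f\<in>sb_codes kf. exp (- \<beta> * E f) * pmf (gibbs_step kf E \<beta> f) g) / ?Z"
    by (simp add: act_def gibbs_weight_def sum_divide_distrib)
  also have "(\<Sum>f\<in>sb_codes kf. exp (- \<beta> * E f) * pmf (gibbs_step kf E \<beta> f) g)
     = exp (- \<beta> * E g) * (\<Sum>f\<in>sb_codes kf. pmf (gibbs_step kf E \<beta> g) f)"
    unfolding sum_distrib_left by (rule sum.cong[OF refl gibbs_detailed_balance])
  also have "(\<Sum>f\<in>sb_codes kf. pmf (gibbs_step kf E \<beta> g) f) = 1"
    by (rule sum_pmf_eq_1[OF finite_sb_codes set_gibbs_step[OF g]])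
  finally show ?thesis by (simp add: gibbs_weight_def[of _ _ _ g])
qed

lemma annealing_invariant:
  fixes E :: "('a::finite list \<Rightarrow> 'b::finite) \<Rightarrow> real"
  assumes "\<And>i. 1 \<le> i \<Longrightarrow> i \<le> m \<Longrightarrow> \<beta> i = b" "g \<in> sb_codes kf"
  shows "act (sb_codes kf) (\<lambda>f. annealing kf E \<beta> f m) (gibbs_weight (sb_codes kf) E b) g = gibbs_weight (sb_codes kf) E b g"
  using assms
proof (induction m arbitrary: g)
  case 0
  have "act (sb_codes kf) (\<lambda>f. return_pmf f) (gibbs_weight (sb_codes kf) E b) g
     = (\<Sum>f\<in>sb_codes kf. if f = g then gibbs_weight (sb_codes kf) E b f else 0)"
    unfolding act_def by (intro sum.cong) (auto simp: indicator_def)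
  with 0 show ?case by (simp add: finite_sb_codes)
next
  case (Suc m)
  have "act (sb_codes kf) (\<lambda>f. annealing kf E \<beta> f (Suc m)) (gibbs_weight (sb_codes kf) E b) g
     = act (sb_codes kf) (gibbs_step kf E b) (act (sb_codes kf) (\<lambda>f. annealing kf E \<beta> f m) (gibbs_weight (sb_codes kf) E b)) g"
    using Suc.prems by (simp add: act_bind[OF finite_sb_codes set_annealing])
  also have "\<dots> = act (sb_codes kf) (gibbs_step kf E b) (gibbs_weight (sb_codes kf) E b) g"
    by (subst act_cong[where u="act _ _ _"]) (use Suc in auto)
  finally show ?case using gibbs_step_invariant[OF Suc.prems(2)] by simp
qed

lemma sum_gibbs_weight:
  assumes "finite S" "S \<noteq> {}"
  shows "sum (gibbs_weight S E \<beta>) S = 1"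
proof -
  have "(\<Sum>y\<in>S. exp (- \<beta> * E y)) > 0" using assms by (intro sum_pos) auto
  then show ?thesis by (simp add: gibbs_weight_def sum_divide_distrib[symmetric])
qed

text \<open>Permits an energy with minimum \<open>0\<close>, for which the partition sum is at least
  \<open>1\<close> and the exponentials converge as the temperature falls.\<close>

lemma gibbs_weight_shift: "gibbs_weight S E \<beta> x = gibbs_weight S (\<lambda>y. E y - m) \<beta> x"
proof -
  have e: "exp (- \<beta> * (E y - m)) = exp (- \<beta> * E y) * exp (\<beta> * m)" for y
    by (simp add: exp_add[symmetric] algebra_simps)
  show ?thesis unfolding gibbs_weight_def e by (simp add: sum_distrib_right[symmetric])
qed

text \<open>An unnormalised weight changes by at most
  \<open>(b' - b) * E x * exp (- b * E x)\<close>. With minimal energy \<open>0\<close> the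
  partition sums are at least \<open>1\<close>, and their change contributes once more the same
  total; hence the factor \<open>2\<close>.\<close>

lemma l1_gibbs_weight_le:
  assumes S: "finite S" and E: "\<And>x. x \<in> S \<Longrightarrow> 0 \<le> E x" and x0: "x0 \<in> S" "E x0 = 0" and b: "b \<le> b'" "0 \<le> b"
  shows "l1 S (gibbs_weight S E b) (gibbs_weight S E b') \<le> 2 * (b' - b) * (\<Sum>x\<in>S. E x * exp (- b * E x))"
proof -
  define w where "w = (\<lambda>\<beta> x. exp (- \<beta> * E x))"
  define Z where "Z = (\<lambda>\<beta>. sum (w \<beta>) S)"
  define h where "h = (\<lambda>x. E x * exp (- b * E x))"
  have Z1: "Z \<beta> \<ge> 1" for \<beta>
    using member_le_sum[of x0 S "w \<beta>"] S x0 by (simp add: Z_def w_def)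
  have wpos: "w \<beta> x > 0" for \<beta> x by (simp add: w_def)
  have d: "0 \<le> w b x - w b' x" "w b x - w b' x \<le> (b' - b) * h x" if "x \<in> S" for x
  proof -
    have "1 + (b - b') * E x \<le> exp ((b - b') * E x)" by (rule exp_ge_add_one_self)
    then have "exp (- b * E x) * (1 + (b - b') * E x) \<le> exp (- b * E x) * exp ((b - b') * E x)"
      by simp
    also have "\<dots> = w b' x" by (simp add: w_def exp_add[symmetric] algebra_simps)
    finally show "w b x - w b' x \<le> (b' - b) * h x" by (simp add: w_def h_def algebra_simps)
    show "0 \<le> w b x - w b' x" using E[OF that] b by (simp add: w_def mult_right_mono)
  qed
  have Zd: "0 \<le> Z b - Z b'" "Z b - Z b' \<le> (b' - b) * sum h S"
    unfolding Z_def sum_subtractf[symmetric] sum_distrib_left by (auto intro!: sum_nonneg sum_mono d)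
  have hS: "0 \<le> sum h S" using E by (auto simp: h_def intro!: sum_nonneg)
  have "\<bar>w b x / Z b - w b' x / Z b'\<bar> \<le> (b' - b) * h x + w b' x / Z b' * ((b' - b) * sum h S)" if x: "x \<in> S" for x
  proof -
    have "w b x / Z b - w b' x / Z b' = (w b x - w b' x) / Z b - w b' x / Z b' * ((Z b - Z b') / Z b)"
      using Z1[of b] Z1[of b'] by (simp add: field_simps)
    also have "\<bar>\<dots>\<bar> \<le> (w b x - w b' x) / Z b + w b' x / Z b' * ((Z b - Z b') / Z b)"
      using d(1)[OF x] Zd(1) Z1[of b] Z1[of b'] wpos[of b' x] 
      by (intro order.trans[OF abs_triangle_ineq4]) (simp add: abs_mult)
    also have "\<dots> \<le> (w b x - w b' x) + w b' x / Z b' * (Z b - Z b')"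
    proof (intro add_mono mult_left_mono)
      show "(w b x - w b' x) / Z b \<le> w b x - w b' x" "(Z b - Z b') / Z b \<le> Z b - Z b'"
        using d(1)[OF x] Zd(1) Z1[of b] by (simp_all add: divide_le_eq mult_left_le mult_le_cancel_left1)
      show "0 \<le> w b' x / Z b'" using wpos[of b' x] Z1[of b'] by simp
    qed
    also have "\<dots> \<le> (b' - b) * h x + w b' x / Z b' * ((b' - b) * sum h S)"
      using d(2)[OF x] Zd(2) wpos[of b' x] Z1[of b'] by (intro add_mono mult_left_mono) auto
    finally show ?thesis .
  qed
  then have "l1 S (gibbs_weight S E b) (gibbs_weight S E b')
      \<le> (\<Sum>x\<in>S. (b' - b) * h x + w b' x / Z b' * ((b' - b) * sum h S))"
    unfolding l1_def gibbs_weight_def by (intro sum_mono) (simp add: w_def Z_def)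
  also have "\<dots> = (b' - b) * sum h S + (sum (w b') S / Z b') * ((b' - b) * sum h S)"
    by (simp only: sum.distrib sum_distrib_left[symmetric] sum_distrib_right[symmetric] sum_divide_distrib[symmetric])
  also have "sum (w b') S / Z b' = 1" using Z1[of b'] by (simp add: Z_def)
  finally show ?thesis by (simp add: h_def algebra_simps)
qed

text \<open>Once \<open>\<delta> j \<le> \<epsilon> * (c / (j + 2))\<close>, the excess
  \<open>D j - \<epsilon>\<close> shrinks by the factor \<open>1 - c / (j + 2)\<close>. The product
  of these factors is of order \<open>(j + 2) powr (- c)\<close>, because the harmonic series
  diverges logarithmically.\<close>

lemma harmonic_contraction_tendsto_0:
  fixes D \<delta> :: "nat \<Rightarrow> real"
  assumes c: "0 < c" "c \<le> 1" and D: "\<And>j. 0 \<le> D j"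
    and step: "\<And>j. 1 \<le> j \<Longrightarrow> D (Suc j) \<le> (1 - c / (real j + 2)) * D j + \<delta> j"
    and \<delta>: "(\<lambda>j. real (j + 2) * \<delta> j) \<longlonglongrightarrow> 0"
  shows "D \<longlonglongrightarrow> 0"
proof (rule LIMSEQ_I)
  fix r :: real assume r: "0 < r"
  define \<epsilon> where "\<epsilon> = r / 2"
  have "\<epsilon> * c > 0" using r c by (simp add: \<epsilon>_def)
  with \<delta> have "\<forall>\<^sub>F j in sequentially. \<bar>real (j + 2) * \<delta> j\<bar> < \<epsilon> * c"
    by (auto simp: tendsto_iff dist_real_def)
  then obtain J0 where J0: "\<And>j. j \<ge> J0 \<Longrightarrow> \<bar>real (j + 2) * \<delta> j\<bar> < \<epsilon> * c"
    by (auto simp: eventually_sequentially)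
  define J where "J = max 1 J0"
  have \<delta>_le: "\<delta> j \<le> \<epsilon> * (c / (real j + 2))" if "j \<ge> J" for j
  proof -
    have "(real j + 2) * \<delta> j \<le> \<epsilon> * c" using J0[of j] that by (auto simp: J_def add.commute)
    then show ?thesis by (simp add: pos_le_divide_eq mult.commute)
  qed
  \<comment> \<open>The \<open>max 0\<close> keeps \<open>C\<close> nonnegative, so that the factors
    in the induction may be replaced by upper bounds.\<close>
  define C where "C = max 0 (D J - \<epsilon>) * exp (c * ln (real J + 2))"
  have C0: "C \<ge> 0" by (simp add: C_def)
  have bound: "D j - \<epsilon> \<le> C * exp (- c * ln (real j + 2))" if "j \<ge> J" for j
    using that
  proof (induction j rule: dec_induct)
    case base
    show ?case by (simp add: C_def mult.assoc exp_add[symmetric])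
  next
    case (step j)
    define t where "t = c / (real j + 2)"
    have t: "0 \<le> 1 - t" using c by (simp add: t_def field_simps)
    have "D (Suc j) - \<epsilon> \<le> (1 - t) * (D j - \<epsilon>)"
    proof -
      have "D (Suc j) \<le> (1 - t) * D j + \<delta> j" "\<delta> j \<le> \<epsilon> * t"
        using assms(4)[of j] \<delta>_le[of j] step.hyps by (simp_all add: J_def t_def)
      moreover have "(1 - t) * (D j - \<epsilon>) = (1 - t) * D j - \<epsilon> + \<epsilon> * t" by (simp add: algebra_simps)
      ultimately show ?thesis by linarith
    qed
    also have "\<dots> \<le> (1 - t) * (C * exp (- c * ln (real j + 2)))"
      using t step.IH by (intro mult_left_mono) auto
    also have "\<dots> \<le> exp (- t) * (C * exp (- c * ln (real j + 2)))"
      using exp_ge_add_one_self[of "- t"] C0 by (intro mult_right_mono) auto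
    also have "\<dots> = C * exp (- t - c * ln (real j + 2))" by (simp add: exp_add[symmetric] algebra_simps)
    also have "\<dots> \<le> C * exp (- c * ln (real (Suc j) + 2))"
    proof -
      have "ln (real (Suc j) + 2) - ln (real j + 2) = ln ((real j + 3) / (real j + 2))"
        by (simp add: ln_div add.commute)
      also have "\<dots> \<le> (real j + 3) / (real j + 2) - 1" by (intro ln_le_minus_one) auto
      also have "\<dots> = 1 / (real j + 2)" by (simp add: field_simps)
      finally have "c * (ln (real (Suc j) + 2) - ln (real j + 2)) \<le> c * (1 / (real j + 2))"
        using c by (intro mult_left_mono) auto
      then show ?thesis using C0 by (intro mult_left_mono) (auto simp: t_def algebra_simps)
    qed
    finally show ?case .
  qed
  have "(\<lambda>j. C * exp (- c * ln (real j + 2))) \<longlonglongrightarrow> 0" using c by real_asymp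
  then have "\<forall>\<^sub>F j in sequentially. C * exp (- c * ln (real j + 2)) < \<epsilon>"
    using r by (intro order_tendstoD(2)) (auto simp: \<epsilon>_def)
  then have "\<forall>\<^sub>F j in sequentially. norm (D j - 0) < r"
    using eventually_ge_at_top[of J]
  proof eventually_elim
    case (elim j)
    with bound[of j] D[of j] show ?case by (simp add: \<epsilon>_def)
  qed
  then show "\<exists>no. \<forall>n\<ge>no. norm (D n - 0) < r" by (simp add: eventually_sequentially)
qed

section \<open>Concentration on the minimisers and convergence of the sampler\<close>

definition minimizers :: "'s set \<Rightarrow> ('s \<Rightarrow> real) \<Rightarrow> 's set" where
  "minimizers S E = {x\<in>S. \<forall>y\<in>S. E x \<le> E y}"

lemma minimizers_nonempty:
  assumes "finite S" "S \<noteq> {}"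
  shows "minimizers S E \<noteq> {}"
proof -
  obtain x where "x \<in> S" "E x = Min (E ` S)" using Min_in[of "E ` S"] assms by fastforce
  then show ?thesis using assms by (auto simp: minimizers_def)
qed

lemma gibbs_weight_tendsto:
  assumes S: "finite S" "S \<noteq> {}" and x: "x \<in> S" and b: "filterlim b at_top F"
  shows "((\<lambda>j. gibbs_weight S E (b j) x) \<longlongrightarrow> pmf (pmf_of_set (minimizers S E)) x) F"
proof -
  obtain x0 where x0: "x0 \<in> minimizers S E" using minimizers_nonempty[OF S] by blast
  define E' where "E' = (\<lambda>y. E y - E x0)"
  have E': "y \<in> minimizers S E \<longleftrightarrow> E' y = 0" "E' y \<ge> 0" if "y \<in> S" for y
  proof -
    have 1: "E x0 \<le> E z" if "z \<in> S" for z using x0 that by (simp add: minimizers_def)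
    then show "E' y \<ge> 0" using that by (simp add: E'_def)
    show "y \<in> minimizers S E \<longleftrightarrow> E' y = 0"
    proof
      assume "y \<in> minimizers S E"
      then have "E y \<le> E x0" using x0 by (simp add: minimizers_def)
      with 1[OF that] show "E' y = 0" by (simp add: E'_def)
    next
      assume "E' y = 0"
      then show "y \<in> minimizers S E" using that 1 by (simp add: E'_def minimizers_def)
    qed
  qed
  have lim: "((\<lambda>j. exp (- b j * E' y)) \<longlongrightarrow> indicator (minimizers S E) y) F" if y: "y \<in> S" for y
  proof (cases "y \<in> minimizers S E")
    case True then show ?thesis using E'(1)[OF y] by simp
  next
    case False
    then have pos: "E' y > 0" using E'[OF y] by linarith
    have "LIM j F. b j * E' y :> at_top"
      by (rule filterlim_at_top_mult_tendsto_pos[OF tendsto_const pos b])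
    then have "LIM j F. - (b j * E' y) :> at_bot"
      by (simp only: filterlim_uminus_at_bot_at_top filterlim_uminus_at_top[symmetric])
    then have "((\<lambda>j. exp (- (b j * E' y))) \<longlongrightarrow> 0) F"
      by (rule filterlim_compose[OF exp_at_bot])
    with False show ?thesis by simp
  qed
  have fm: "finite (minimizers S E)" and sub: "minimizers S E \<subseteq> S" using S by (auto simp: minimizers_def)
  have card: "(\<Sum>y\<in>S. indicator (minimizers S E) y) = real (card (minimizers S E))"
  proof -
    have "(\<Sum>y\<in>S. indicator (minimizers S E) y) = (\<Sum>y\<in>minimizers S E. 1 :: real)"
      using S sub by (intro sum.mono_neutral_cong_right) auto
    then show ?thesis by simp
  qed
  have "((\<lambda>j. gibbs_weight S E' (b j) x) \<longlongrightarrow> indicator (minimizers S E) x / card (minimizers S E)) F"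
    unfolding gibbs_weight_def
  proof (intro tendsto_divide lim x)
    show "((\<lambda>j. \<Sum>y\<in>S. exp (- b j * E' y)) \<longlongrightarrow> real (card (minimizers S E))) F"
      unfolding card[symmetric] by (intro tendsto_sum lim)
  qed (use x0 fm in \<open>auto simp: card_eq_0_iff\<close>)
  moreover have "gibbs_weight S E' (b j) x = gibbs_weight S E (b j) x" for j
    unfolding E'_def by (rule gibbs_weight_shift[symmetric])
  moreover have "pmf (pmf_of_set (minimizers S E)) x = indicator (minimizers S E) x / card (minimizers S E)"
    using x0 fm by (intro pmf_of_set) auto
  ultimately show ?thesis by (simp only:)
qed

text \<open>The distance \<open>D j\<close> to the current Gibbs law is followed at the multiples of
  \<open>K\<close> only. A sweep contracts it, the change of temperature adds
  \<open>\<delta> j\<close>, and between the multiples it cannot grow.\<close>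

lemma annealing_tendsto:
  fixes E :: "('a::finite list \<Rightarrow> 'b::finite) \<Rightarrow> real" and g :: "('a list \<Rightarrow> 'b) \<Rightarrow> real" and K :: nat
  assumes K: "K = CARD('a) ^ (2 * kf + 1)"
    and \<Delta>: "\<And>f w \<xi> \<theta>. f \<in> sb_codes kf \<Longrightarrow> w \<in> windows kf \<Longrightarrow> \<bar>E (f(w := \<xi>)) - E (f(w := \<theta>))\<bar> \<le> \<Delta>"
    and T0: "0 < T0" "real K * \<Delta> \<le> T0"
    and \<beta>: "\<And>t. 1 \<le> t \<Longrightarrow> \<beta> t = 1 / T0 * ln (real_of_int \<lfloor>real t / real K\<rfloor> + 1)"
    and f0: "f0 \<in> sb_codes kf"
  shows "(\<lambda>r. expect (annealing kf E \<beta> f0 r) g)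
     \<longlonglongrightarrow> expect (pmf_of_set (minimizers (sb_codes kf) E)) g"
proof -
  let ?S = "sb_codes kf :: ('a list \<Rightarrow> 'b) set"
  let ?G = "gibbs_weight ?S E"
  note fS = finite_sb_codes[where 'a='a and 'b='b, of kf] and neS = sb_codes_nonempty[where 'a='a and 'b='b, of kf]
  have K0: "K > 0" by (simp add: K)
  define b where "b = (\<lambda>j. 1 / T0 * ln (real j + 1))"
  have \<beta>b: "\<beta> t = b (t div K)" if "1 \<le> t" for t
    using \<beta>[OF that] by (simp add: b_def floor_divide_of_nat_eq)
  have b0: "0 \<le> b j" for j using T0 by (simp add: b_def)
  have bmono: "b i \<le> b j" if "i \<le> j" for i j using T0 that by (simp add: b_def divide_right_mono)
  obtain f1 w1 where "f1 \<in> ?S" "w1 \<in> (windows kf :: 'a list set)" using neS windows_nonempty by blast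
  then have \<Delta>0: "0 \<le> \<Delta>" using \<Delta>[of f1 w1 undefined undefined] by simp
  define \<mu> where "\<mu> = (\<lambda>r. pmf (annealing kf E \<beta> f0 r))"
  have sum\<mu>: "sum (\<mu> r) ?S = 1" for r
    unfolding \<mu>_def by (rule sum_pmf_eq_1[OF fS set_annealing[OF f0]])
  define D where "D = (\<lambda>j. l1 ?S (\<mu> (j * K)) (?G (b j)))"
  define \<kappa> where "\<kappa> = (\<lambda>j m f. annealing kf E (\<lambda>i. \<beta> (j * K + i)) f m)"
  have \<mu>_add: "\<mu> (j * K + m) = act ?S (\<kappa> j m) (\<mu> (j * K))" for j m
    unfolding \<mu>_def \<kappa>_def annealing_add by (rule ext) (rule pmf_bind_act[OF fS set_annealing[OF f0]])
  have set\<kappa>: "set_pmf (\<kappa> j m f) \<subseteq> ?S" if "f \<in> ?S" for j m f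
    unfolding \<kappa>_def using set_annealing[OF that] .
  have inv: "act ?S (\<kappa> j m) (?G (b j)) g = ?G (b j) g" if "1 \<le> j" "m < K" "g \<in> ?S" for j m g
    unfolding \<kappa>_def
  proof (rule annealing_invariant)
    fix i assume "1 \<le> i" "i \<le> m"
    with that K0 have "(j * K + i) div K = j" by (simp add: div_nat_eqI)
    then show "\<beta> (j * K + i) = b j" using \<open>1 \<le> i\<close> by (simp add: \<beta>b)
  qed (use that in auto)
  have l1_congR: "l1 ?S u v = l1 ?S u v'" if "\<And>x. x \<in> ?S \<Longrightarrow> v x = v' x" for u v v'
    unfolding l1_def using that by (intro sum.cong) auto
  define H where "H = (\<lambda>j. \<Sum>x\<in>?S. (E x - Min (E ` ?S)) * exp (- b j * (E x - Min (E ` ?S))))"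
  define \<delta> where "\<delta> = (\<lambda>j. l1 ?S (?G (b j)) (?G (b (Suc j))))"
  have \<delta>_le: "\<delta> j \<le> 2 * (1 / T0 * (1 / (real j + 1))) * H j" for j
  proof -
    let ?E = "\<lambda>x. E x - Min (E ` ?S)"
    obtain x0 where x0: "x0 \<in> ?S" "E x0 = Min (E ` ?S)"
      using Min_in[of "E ` ?S"] fS neS by fastforce
    have "\<delta> j = l1 ?S (gibbs_weight ?S ?E (b j)) (gibbs_weight ?S ?E (b (Suc j)))"
      unfolding \<delta>_def l1_def by (intro sum.cong refl) (simp add: gibbs_weight_shift[of ?S E _ _ "Min (E ` ?S)"])
    also have "\<dots> \<le> 2 * (b (Suc j) - b j) * H j"
      unfolding H_def using x0 fS by (intro l1_gibbs_weight_le) (auto simp: b0 bmono)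
    also have "\<dots> \<le> 2 * (1 / T0 * (1 / (real j + 1))) * H j"
    proof (intro mult_right_mono mult_left_mono)
      have "b (Suc j) - b j = 1 / T0 * ln ((real j + 2) / (real j + 1))"
        by (simp add: b_def ln_div algebra_simps diff_divide_distrib)
      also have "\<dots> \<le> 1 / T0 * ((real j + 2) / (real j + 1) - 1)"
        using T0 by (intro mult_left_mono ln_le_minus_one) auto
      also have "(real j + 2) / (real j + 1) - 1 = 1 / (real j + 1)" by (simp add: field_simps)
      finally show "b (Suc j) - b j \<le> 1 / T0 * (1 / (real j + 1))" .
      show "0 \<le> H j" unfolding H_def using fS by (intro sum_nonneg) auto
    qed auto
    finally show ?thesis .
  qed
  have blim: "filterlim b at_top sequentially" unfolding b_def using T0 by real_asymp
  \<comment> \<open>Codes of minimal energy contribute \<open>0\<close> and all others decay with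
    \<open>b\<close>. This improves the drift from \<open>O(1 / j)\<close> to
    \<open>o(1 / j)\<close>, as the harmonic contraction requires.\<close>
  have Hlim: "H \<longlonglongrightarrow> 0"
  proof -
    have "(\<lambda>j. e * exp (- b j * e)) \<longlonglongrightarrow> 0" if "e \<ge> 0" for e :: real
    proof (cases "e = 0")
      case False
      with that have "e > 0" by simp
      then show ?thesis unfolding b_def using T0 by real_asymp
    qed simp
    then have "H \<longlonglongrightarrow> (\<Sum>x\<in>?S. 0)" unfolding H_def using fS by (intro tendsto_sum) auto
    then show ?thesis by simp
  qed
  have \<delta>lim: "(\<lambda>j. real (j + 2) * \<delta> j) \<longlonglongrightarrow> 0"
  proof (rule tendsto_sandwich)
    show "\<forall>\<^sub>F j in sequentially. 0 \<le> real (j + 2) * \<delta> j" by (simp add: \<delta>_def l1_nonneg)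
    show "\<forall>\<^sub>F j in sequentially. real (j + 2) * \<delta> j \<le> (real j + 2) / (real j + 1) * (2 / T0) * H j"
      using mult_left_mono[OF \<delta>_le, of "real (_ + 2)"] by (intro always_eventually) (simp add: field_simps)
    have "(\<lambda>j. (real j + 2) / (real j + 1)) \<longlonglongrightarrow> 1" by real_asymp
    from tendsto_mult[OF tendsto_mult[OF this tendsto_const[of "2 / T0"]] Hlim]
    show "(\<lambda>j. (real j + 2) / (real j + 1) * (2 / T0) * H j) \<longlonglongrightarrow> 0" by (simp only: mult_zero_right)
  qed auto
  define c where "c = 1 / (real K * CARD('b)) ^ K"
  have c0: "c > 0" using K0 by (simp add: c_def)
  \<comment> \<open>In this sweep the parameter is at most
    \<open>b (Suc j) = ln (j + 2) / T0\<close>. Over \<open>K\<close> steps the exponent is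
    \<open>real K * \<Delta> / T0 * ln (j + 2) \<le> ln (j + 2)\<close>, which leaves
    \<open>1 / (j + 2)\<close>.\<close>
  have minor: "c / (real j + 2) \<le> pmf (\<kappa> j K f) g" if "f \<in> ?S" "g \<in> ?S" for j f g
  proof -
    have "c / (real j + 2) = c * exp (- ln (real j + 2))" by (simp add: exp_minus field_simps)
    also have "\<dots> \<le> c * exp (- (real K * \<Delta>) / T0 * ln (real j + 2))"
    proof -
      have "real K * \<Delta> / T0 * ln (real j + 2) \<le> 1 * ln (real j + 2)"
        using T0 by (intro mult_right_mono) auto
      then show ?thesis using c0 by simp
    qed
    also have "\<dots> = (exp (- b (Suc j) * \<Delta>) / (real K * CARD('b))) ^ K"
      by (simp add: c_def b_def power_divide exp_of_nat_mult[symmetric] mult_ac add.commute)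
    also have "\<dots> \<le> pmf (\<kappa> j K f) g"
      unfolding \<kappa>_def K of_nat_mult[symmetric]
    proof (rule annealing_minorization[where E=E and kf=kf and \<Delta>=\<Delta> and b="b (Suc j)" and f=f and g=g])
      fix i assume i: "1 \<le> i" "i \<le> CARD('a) ^ (2 * kf + 1)"
      then have "(j * K + i) div K \<le> Suc j"
      proof -
        have "(j * K + i) div K \<le> (Suc j * K) div K" using i by (intro div_le_mono) (simp add: K)
        also have "\<dots> = Suc j" using K0 by simp
        finally show ?thesis .
      qed
      then show "0 \<le> \<beta> (j * CARD('a) ^ (2 * kf + 1) + i) \<and> \<beta> (j * CARD('a) ^ (2 * kf + 1) + i) \<le> b (Suc j)"
        using i \<beta>b[of "j * K + i"] b0 bmono unfolding K[symmetric] by simp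
    qed (use that \<Delta> in auto)
    finally show ?thesis .
  qed
  have step: "D (Suc j) \<le> (1 - c / (real j + 2)) * D j + \<delta> j" if j: "1 \<le> j" for j
  proof -
    have "D (Suc j) = l1 ?S (act ?S (\<kappa> j K) (\<mu> (j * K))) (?G (b (Suc j)))"
      using \<mu>_add[of j K] by (simp add: D_def add.commute)
    also have "\<dots> \<le> l1 ?S (act ?S (\<kappa> j K) (\<mu> (j * K))) (act ?S (\<kappa> j K) (?G (b j)))
        + l1 ?S (act ?S (\<kappa> j K) (?G (b j))) (?G (b (Suc j)))" by (rule l1_triangle)
    also have "l1 ?S (act ?S (\<kappa> j K) (\<mu> (j * K))) (act ?S (\<kappa> j K) (?G (b j)))
        \<le> (1 - c / (real j + 2) * card ?S) * D j"
      unfolding D_def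
      by (intro l1_act_le[OF fS set\<kappa> minor]) (auto simp: sum\<mu> sum_gibbs_weight[OF fS neS])
    also have "\<dots> \<le> (1 - c / (real j + 2)) * D j"
    proof (intro mult_right_mono diff_left_mono)
      have "1 \<le> real (card ?S)" using fS neS by (simp add: Suc_le_eq card_gt_0_iff)
      then show "c / (real j + 2) \<le> c / (real j + 2) * real (card ?S)"
        using c0 mult_left_mono[of 1 "real (card ?S)" "c / (real j + 2)"] by simp
    qed (simp add: D_def l1_nonneg)
    also have "l1 ?S (act ?S (\<kappa> j K) (?G (b j))) (?G (b (Suc j))) \<le> \<delta> j"
    proof -
      obtain m where m: "K = Suc m" using K0 gr0_implies_Suc by blast
      \<comment> \<open>Iteration \<open>(j + 1) * K\<close>, the last of the sweep, already uses
        the next parameter. The \<open>m = K - 1\<close> iterations before it fix the old Gibbs law;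
        this one fixes the new law and does not increase distances.\<close>
      have last: "\<beta> (j * K + Suc m) = b (Suc j)" using K0 by (simp add: \<beta>b m[symmetric])
      have "act ?S (\<kappa> j K) (?G (b j)) = act ?S (gibbs_step kf E (b (Suc j))) (act ?S (\<kappa> j m) (?G (b j)))"
        using last act_bind[OF fS, of "\<kappa> j m" "gibbs_step kf E (b (Suc j))" "?G (b j)"] set\<kappa>
        by (intro ext) (simp add: \<kappa>_def m[symmetric] , simp add: m)
      also have "\<dots> = act ?S (gibbs_step kf E (b (Suc j))) (?G (b j))"
        using inv[OF j, of m] m by (intro act_cong) auto
      finally have "l1 ?S (act ?S (\<kappa> j K) (?G (b j))) (?G (b (Suc j)))
         = l1 ?S (act ?S (gibbs_step kf E (b (Suc j))) (?G (b j))) (act ?S (gibbs_step kf E (b (Suc j))) (?G (b (Suc j))))"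
        by (simp add: l1_congR[OF gibbs_step_invariant])
      also have "\<dots> \<le> (1 - (0::real) * card ?S) * l1 ?S (?G (b j)) (?G (b (Suc j)))"
        by (intro l1_act_le[OF fS set_gibbs_step]) (auto simp: sum_gibbs_weight[OF fS neS])
      finally show ?thesis by (simp add: \<delta>_def)
    qed
    finally show ?thesis by simp
  qed
  have "1 \<le> real (K * CARD('b))" using K0 by (simp add: Suc_le_eq del: of_nat_mult)
  then have "1 \<le> (real K * CARD('b)) ^ K" by (simp add: one_le_power)
  then have "c \<le> 1" unfolding c_def by (metis divide_le_eq_1_pos less_le_trans zero_less_one)
  then have Dlim: "D \<longlonglongrightarrow> 0"
    using c0 step \<delta>lim by (intro harmonic_contraction_tendsto_0[of c D \<delta>]) (auto simp: D_def l1_nonneg)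
  have divlim: "filterlim (\<lambda>r. r div K) at_top sequentially"
    unfolding filterlim_at_top
  proof (intro allI)
    fix Z show "\<forall>\<^sub>F r in sequentially. Z \<le> r div K"
      using eventually_ge_at_top[of "Z * K"] by eventually_elim (simp add: K0 less_eq_div_iff_mult_less_eq)
  qed
  \<comment> \<open>At a time \<open>r\<close> that is not a multiple of \<open>K\<close> the
    parameter has been constant since \<open>(r div K) * K\<close>, so the partial sweep fixes the
    Gibbs law.\<close>
  have close: "(\<lambda>r. l1 ?S (\<mu> r) (?G (b (r div K)))) \<longlonglongrightarrow> 0"
  proof (rule tendsto_sandwich[OF _ _ tendsto_const filterlim_compose[OF Dlim divlim]])
    show "\<forall>\<^sub>F r in sequentially. l1 ?S (\<mu> r) (?G (b (r div K))) \<le> D (r div K)"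
      using eventually_ge_at_top[of K]
    proof eventually_elim
      case (elim r)
      let ?j = "r div K" and ?m = "r mod K"
      have j: "1 \<le> ?j" using elim K0 by (simp add: Suc_le_eq div_greater_zero_iff)
      have "l1 ?S (\<mu> r) (?G (b ?j)) = l1 ?S (act ?S (\<kappa> ?j ?m) (\<mu> (?j * K))) (act ?S (\<kappa> ?j ?m) (?G (b ?j)))"
        using \<mu>_add[of ?j ?m] l1_congR[OF inv[OF j, of ?m]] K0 by simp
      also have "\<dots> \<le> (1 - (0::real) * card ?S) * D ?j"
        unfolding D_def by (intro l1_act_le[OF fS set\<kappa>]) (auto simp: sum\<mu> sum_gibbs_weight[OF fS neS])
      finally show ?case by simp
    qed
  qed (simp add: l1_nonneg)
  let ?U = "pmf_of_set (minimizers ?S E)"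
  have "(\<lambda>r. \<mu> r x) \<longlonglongrightarrow> pmf ?U x" if x: "x \<in> ?S" for x
  proof -
    have "(\<lambda>r. \<mu> r x - ?G (b (r div K)) x) \<longlonglongrightarrow> 0"
    proof (rule Lim_null_comparison[OF _ close])
      show "\<forall>\<^sub>F r in sequentially. norm (\<mu> r x - ?G (b (r div K)) x) \<le> l1 ?S (\<mu> r) (?G (b (r div K)))"
        unfolding l1_def using member_le_sum[OF x, of "\<lambda>x. \<bar>\<mu> _ x - ?G (b (_ div K)) x\<bar>"] fS
        by (intro always_eventually) simp
    qed
    moreover have "(\<lambda>r. ?G (b (r div K)) x) \<longlonglongrightarrow> pmf ?U x"
      by (rule gibbs_weight_tendsto[OF fS neS x filterlim_compose[OF blim divlim]])
    ultimately show ?thesis using tendsto_add by fastforce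
  qed
  then have "(\<lambda>r. \<Sum>x\<in>?S. \<mu> r x * g x) \<longlonglongrightarrow> (\<Sum>x\<in>?S. pmf ?U x * g x)"
    by (intro tendsto_intros) auto
  moreover have "expect (annealing kf E \<beta> f0 r) g = (\<Sum>x\<in>?S. \<mu> r x * g x)" for r
    using set_annealing[OF f0] by (subst integral_measure_pmf_real[OF fS]) (auto simp: \<mu>_def mult.commute)
  moreover have "expect ?U g = (\<Sum>x\<in>?S. pmf ?U x * g x)"
  proof (subst integral_measure_pmf_real[OF fS])
    have "finite (minimizers ?S E)" using fS by (simp add: minimizers_def)
    then show "x \<in> ?S" if "x \<in> set_pmf ?U" for x
      using that minimizers_nonempty[OF fS neS, of E] by (auto simp: minimizers_def)
  qed (auto simp: mult.commute)
  ultimately show ?thesis by simp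
qed

section \<open>Lempel-Ziv: Kraft sum and Ziv inequality\<close>

text \<open>Exactly what a decoder of pointer and letter relies on. The last phrase, which may
  repeat an earlier one, satisfies it as well, so the complete parsing is covered.\<close>

definition prefix_parsing :: "'b list list \<Rightarrow> bool" where
  "prefix_parsing R \<longleftrightarrow> (\<forall>i<length R. R ! i \<noteq> [] \<and> (butlast (R ! i) = [] \<or> butlast (R ! i) \<in> set (take i R)))"

lemma prefix_parsing_snoc:
  "prefix_parsing (P @ [v]) \<longleftrightarrow> prefix_parsing P \<and> v \<noteq> [] \<and> (butlast v = [] \<or> butlast v \<in> set P)"
  by (auto simp: prefix_parsing_def nth_append less_Suc_eq)

text \<open>The unfinished phrase \<open>w\<close> is empty or a completed phrase, so its one-letter
  extension is a legitimate new phrase. If the input ends inside \<open>w\<close>, then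
  \<open>w\<close> repeats a completed phrase, whose own prefix is already present.\<close>

lemma lz_parse_invariant:
  assumes "prefix_parsing P" "distinct P" "w = [] \<or> w \<in> set P"
  shows "concat (lz_parse P w ys) = concat P @ w @ ys \<and> prefix_parsing (lz_parse P w ys)
     \<and> distinct (butlast (lz_parse P w ys))"
  using assms
proof (induction ys arbitrary: P w)
  case Nil
  show ?case
  proof (cases "w = []")
    case True then show ?thesis using Nil by (simp add: distinct_butlast)
  next
    case False
    then obtain i where "i < length P" "w = P ! i" using Nil by (auto simp: in_set_conv_nth)
    then have "butlast w = [] \<or> butlast w \<in> set P"
      using Nil(1) by (auto simp: prefix_parsing_def dest: in_set_takeD)
    then show ?thesis using Nil False by (simp add: prefix_parsing_snoc)
  qed
next
  case (Cons y ys)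
  show ?case
  proof (cases "w @ [y] \<in> set P")
    case True
    then show ?thesis using Cons.IH[of P "w @ [y]"] Cons.prems by simp
  next
    case False
    then show ?thesis using Cons.IH[of "P @ [w @ [y]]" "[]"] Cons.prems
      by (simp add: prefix_parsing_snoc)
  qed
qed

lemma concat_lz_phrases: "concat (lz_phrases ys) = ys"
  and prefix_parsing_lz_phrases: "prefix_parsing (lz_phrases ys)"
  and distinct_butlast_lz_phrases: "distinct (butlast (lz_phrases ys))"
  using lz_parse_invariant[of "[]" "[]" ys] by (auto simp: lz_phrases_def prefix_parsing_def)

lemma prefix_parsing_nonempty: "prefix_parsing R \<Longrightarrow> [] \<notin> set R"
  by (auto simp: prefix_parsing_def in_set_conv_nth)

lemma length_le_length_concat: "[] \<notin> set R \<Longrightarrow> length R \<le> length (concat R)"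
proof (induction R)
  case (Cons w R)
  then show ?case by (cases w) auto
qed simp

text \<open>The last of \<open>c + 1\<close> phrases is determined by its prefix, which is empty or
  one of the \<open>c\<close> phrases before it, and by its last letter. The factors match the
  summands of the code length one by one.\<close>

lemma card_prefix_parsings:
  fixes c :: nat
  defines "A \<equiv> \<lambda>c. {R :: 'b::finite list list. length R = c \<and> prefix_parsing R}"
  shows "finite (A c) \<and> card (A c) \<le> (\<Prod>j<c. (j + 1) * CARD('b))"
proof (induction c)
  case 0
  have "A 0 = {[]}" by (auto simp: A_def prefix_parsing_def)
  then show ?case by simp
next
  case (Suc c)
  let ?S = "SIGMA R:A c. insert [] (set R) \<times> (UNIV :: 'b set)"
  have sub: "A (Suc c) \<subseteq> (\<lambda>(R, u, b). R @ [u @ [b]]) ` ?S"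
  proof
    fix R assume R: "R \<in> A (Suc c)"
    then obtain P v where Pv: "R = P @ [v]" "length P = c"
      by (cases R rule: rev_cases) (auto simp: A_def)
    with R have "prefix_parsing P" "v \<noteq> []" "butlast v = [] \<or> butlast v \<in> set P"
      by (auto simp: A_def prefix_parsing_snoc)
    then have "R = (\<lambda>(R, u, b). R @ [u @ [b]]) (P, butlast v, last v)" "(P, butlast v, last v) \<in> ?S"
      using Pv by (auto simp: A_def)
    then show "R \<in> (\<lambda>(R, u, b). R @ [u @ [b]]) ` ?S" by blast
  qed
  have fin: "finite ?S" using Suc by (intro finite_SigmaI) auto
  have "card (A (Suc c)) \<le> card ?S" using sub fin by (rule surj_card_le[rotated])
  also have "\<dots> = (\<Sum>R\<in>A c. card (insert [] (set R)) * CARD('b))"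
    using Suc by (subst card_SigmaI) (auto simp: card_cartesian_product)
  also have "\<dots> \<le> (\<Sum>R\<in>A c. (c + 1) * CARD('b))"
  proof (intro sum_mono mult_right_mono)
    fix R assume "R \<in> A c"
    then have "card (set R) \<le> c" using card_length[of R] by (simp add: A_def)
    then show "card (insert [] (set R)) \<le> c + 1" using card_insert_le_m1[of "c+1" "set R" "[]"] by simp
  qed simp
  also have "\<dots> = card (A c) * ((c + 1) * CARD('b))" by simp
  also have "\<dots> \<le> (\<Prod>j<c. (j + 1) * CARD('b)) * ((c + 1) * CARD('b))"
    using Suc by (intro mult_right_mono) auto
  finally show ?case using finite_subset[OF sub] fin by simp
qed

text \<open>The length depends only on the number \<open>c\<close> of phrases, and at most
  \<open>2 ^ len c\<close> parsings have \<open>c\<close> phrases, so each \<open>c\<close>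
  contributes at most \<open>1\<close>; the bound counts the values \<open>0, ..., n\<close>. Words
  are recovered from their parsings by concatenation.\<close>

theorem lz_kraft:
  "(\<Sum>ys\<in>{ys :: 'b::finite list. length ys = n}. (1/2) ^ lz_length ys) \<le> real n + 1"
proof -
  define A where "A = (\<lambda>c. {R :: 'b list list. length R = c \<and> prefix_parsing R})"
  define len where "len = (\<lambda>c. \<Sum>j<c. ceillog2 (j + 1) + ceillog2 CARD('b))"
  have lz: "lz_length ys = len (length (lz_phrases ys))" for ys :: "'b list"
    by (simp add: lz_length_def len_def)
  have card: "finite (A c)" "card (A c) \<le> (\<Prod>j<c. (j + 1) * CARD('b))" for c
    using card_prefix_parsings[where 'b='b, of c] by (auto simp: A_def)
  have A1: "real (card (A c)) * (1/2) ^ len c \<le> 1" for c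
  proof -
    have "(\<Prod>j<c. (j + 1) * CARD('b)) \<le> (\<Prod>j<c. 2 ^ ceillog2 (j + 1) * 2 ^ ceillog2 CARD('b))"
      by (intro prod_mono conjI mult_mono le_two_power_ceillog2) auto
    also have "\<dots> = 2 ^ len c" by (simp add: len_def power_sum power_add)
    finally have "card (A c) \<le> 2 ^ len c" using card(2)[of c] by simp
    then have "real (card (A c)) \<le> 2 ^ len c" by (metis of_nat_le_iff of_nat_power of_nat_numeral)
    then show ?thesis by (simp add: power_one_over field_simps)
  qed
  let ?L = "{ys :: 'b list. length ys = n}"
  let ?h = "\<lambda>ys :: 'b list. (length (lz_phrases ys), lz_phrases ys)"
  have inj: "inj_on ?h ?L" by (rule inj_onI) (metis concat_lz_phrases prod.inject)
  have sub: "?h ` ?L \<subseteq> Sigma {..n} A"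
  proof clarify
    fix ys :: "'b list"
    have "length (lz_phrases ys) \<le> length ys"
      by (metis length_le_length_concat prefix_parsing_nonempty prefix_parsing_lz_phrases concat_lz_phrases)
    then show "length (lz_phrases ys) \<in> {..length ys} \<and> lz_phrases ys \<in> A (length (lz_phrases ys))"
      by (simp add: A_def prefix_parsing_lz_phrases)
  qed
  have "(\<Sum>ys\<in>?L. (1/2 :: real) ^ lz_length ys) = (\<Sum>z\<in>?h ` ?L. (1/2) ^ len (fst z))"
    by (subst sum.reindex[OF inj]) (simp add: lz)
  also have "\<dots> \<le> (\<Sum>z\<in>Sigma {..n} A. (1/2) ^ len (fst z))"
    using sub card by (intro sum_mono2) auto
  also have "\<dots> = (\<Sum>c\<le>n. \<Sum>R\<in>A c. (1/2) ^ len c)"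
    using card by (subst sum.Sigma) (auto intro!: sum.cong)
  also have "\<dots> \<le> (\<Sum>c\<le>n. 1)" using A1 by (intro sum_mono) simp
  finally show ?thesis by simp
qed

section \<open>Markov weights of words and Ziv's inequality\<close>

definition last_part :: "nat \<Rightarrow> 'b list \<Rightarrow> 'b list" where
  "last_part k s = drop (length s - k) s"

lemma last_part_append: "last_part k (last_part k s @ t) = last_part k (s @ t)"
proof (cases "length s \<le> k")
  case True then show ?thesis by (simp add: last_part_def)
next
  case False
  show ?thesis
  proof (cases "length t \<le> k")
    case True
    then have "k - (k - length t) = length t" by simp
    with True False show ?thesis by (simp add: last_part_def add.commute)
  qed (use False in \<open>simp add: last_part_def\<close>)
qed

lemma length_last_part: "length (last_part k s) = min k (length s)"
  by (simp add: last_part_def)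

lemma last_part_take_eq_context_of: "k \<le> i \<Longrightarrow> i \<le> length ys \<Longrightarrow> last_part k (take i ys) = context_of k ys i"
  by (simp add: last_part_def context_of_def drop_take)

text \<open>The state is the recent past, and near the beginning of a word it is shorter than
  \<open>k\<close>; such short pasts are states of their own.\<close>

primrec markov_weight :: "nat \<Rightarrow> ('b list \<Rightarrow> 'b \<Rightarrow> real) \<Rightarrow> 'b list \<Rightarrow> 'b list \<Rightarrow> real" where
  "markov_weight k q s [] = 1"
| "markov_weight k q s (b # w) = q s b * markov_weight k q (last_part k (s @ [b])) w"

lemma markov_weight_append:
  "markov_weight k q (last_part k s) (u @ v)
    = markov_weight k q (last_part k s) u * markov_weight k q (last_part k (s @ u)) v"
proof (induction u arbitrary: s)
  case (Cons b u)
  have "last_part k (last_part k s @ [b]) = last_part k (s @ [b])" by (rule last_part_append)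
  then show ?case using Cons[of "s @ [b]"] by simp
qed simp

lemma markov_weight_eq_prod:
  "markov_weight k q (last_part k p) w = (\<Prod>i<length w. q (last_part k (p @ take i w)) (w ! i))"
proof (induction w arbitrary: p)
  case (Cons b w)
  have "last_part k (last_part k p @ [b]) = last_part k (p @ [b])" by (rule last_part_append)
  then show ?case using Cons[of "p @ [b]"]
    by (simp add: prod.lessThan_Suc_shift del: prod.lessThan_Suc)
qed simp

lemma lists_Suc: "{w. length w = Suc l} = (\<lambda>(b, w). b # w) ` (UNIV \<times> {w. length w = l})"
  by (auto simp: length_Suc_conv image_def)

lemma finite_lists_length: "finite {w :: 'b::finite list. length w = l}"
  using finite_lists_length_eq[of "UNIV :: 'b set" l] by simp

lemma markov_weight_sum_le_1:
  fixes q :: "'b::finite list \<Rightarrow> 'b \<Rightarrow> real"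
  assumes q: "\<And>s b. 0 \<le> q s b" "\<And>s. (\<Sum>b\<in>UNIV. q s b) \<le> 1"
  shows "(\<Sum>w\<in>{w. length w = l}. markov_weight k q s w) \<le> 1"
proof (induction l arbitrary: s)
  case (Suc l)
  have "(\<Sum>w\<in>{w. length w = Suc l}. markov_weight k q s w)
     = (\<Sum>b\<in>UNIV. q s b * (\<Sum>w\<in>{w. length w = l}. markov_weight k q (last_part k (s @ [b])) w))"
    unfolding lists_Suc by (subst sum.reindex)
      (auto simp: inj_on_def sum.cartesian_product sum_distrib_left case_prod_unfold)
  also have "\<dots> \<le> (\<Sum>b\<in>UNIV. q s b * 1)" using q Suc by (intro sum_mono mult_left_mono) auto
  finally show ?case using q(2)[of s] by simp
qed simp

lemma markov_weight_nonneg: "(\<And>s b. 0 \<le> q s b) \<Longrightarrow> 0 \<le> markov_weight k q s w"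
  by (induction w arbitrary: s) auto

lemma card_lists_le: "finite {s :: 'b::finite list. length s \<le> k}"
  "card {s :: 'b::finite list. length s \<le> k} \<le> (k + 1) * CARD('b) ^ k"
proof -
  show "finite {s :: 'b::finite list. length s \<le> k}"
    using finite_lists_length_le[of "UNIV :: 'b set" k] by simp
  have "card {s :: 'b::finite list. length s \<le> k} = (\<Sum>i\<le>k. CARD('b) ^ i)"
    using card_lists_length_le[of "UNIV :: 'b set" k] by simp
  also have "\<dots> \<le> (\<Sum>i\<le>k. CARD('b) ^ k)" by (intro sum_mono power_increasing) (auto simp: Suc_le_eq)
  finally show "card {s :: 'b::finite list. length s \<le> k} \<le> (k + 1) * CARD('b) ^ k" by simp
qed

lemma markov_weight_concat:
  "markov_weight k q [] (concat ws)
     = (\<Prod>j<length ws. markov_weight k q (last_part k (concat (take j ws))) (ws ! j))"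
proof (induction ws rule: rev_induct)
  case (snoc w ws)
  have "last_part k [] = ([] :: 'a list)" by (simp add: last_part_def)
  then have "markov_weight k q [] (concat ws @ w)
      = markov_weight k q [] (concat ws) * markov_weight k q (last_part k (concat ws)) w"
    using markov_weight_append[of k q "[]" "concat ws" w] by simp
  with snoc show ?case by (simp add: nth_append)
qed simp

lemma sum_inverse_consecutive_le_1: "(\<Sum>l=1..n. 1 / (real l * (real l + 1))) \<le> 1"
proof -
  have "(\<Sum>l=1..n. 1 / (real l * (real l + 1))) = 1 - 1 / (real n + 1)"
  proof (induction n)
    case (Suc n)
    have "1 / (real (Suc n) * (real (Suc n) + 1)) = 1 / (real n + 1) - 1 / (real (Suc n) + 1)"
      by (simp add: field_simps)
    with Suc show ?case by simp
  qed simp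
  then show ?thesis by simp
qed

text \<open>The weights \<open>a j\<close> come from a subprobability on words: uniform over the at
  most \<open>m\<close> states, length \<open>l\<close> with weight
  \<open>1 / (l * (l + 1))\<close>, then the Markov weight. Distinct phrases have total weight at
  most \<open>1\<close>, and comparison with \<open>c\<close> equal weights yields
  \<open>c * ln c\<close> on the left.\<close>

theorem ziv_inequality:
  fixes q :: "'b::finite list \<Rightarrow> 'b \<Rightarrow> real" and ws :: "'b list list"
  assumes q: "\<And>s b. 0 \<le> q s b" "\<And>s. (\<Sum>b\<in>UNIV. q s b) \<le> 1"
    and ws: "distinct ws" "[] \<notin> set ws" and pos: "0 < markov_weight k q [] (concat ws)"
    and n: "length (concat ws) \<le> n" and c: "c = length ws" "c > 0"
  shows "c * ln c \<le> - ln (markov_weight k q [] (concat ws)) + c * ln ((k + 1) * CARD('b) ^ k)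
           + 2 * c * ln (n / c + 1)"
proof -
  let ?M = "markov_weight k q"
  define s where "s = (\<lambda>j. last_part k (concat (take j ws)))"
  define St where "St = {s :: 'b list. length s \<le> k}"
  define m where "m = real ((k + 1) * CARD('b) ^ k)"
  define e where "e = (\<lambda>l::nat. 1 / (real l * (real l + 1)))"
  define a where "a = (\<lambda>j. ?M (s j) (ws ! j) * e (length (ws ! j)) / m)"
  have m0: "m > 0" unfolding m_def of_nat_0_less_iff by simp
  have e0: "e l \<ge> 0" for l by (simp add: e_def)
  have M0: "?M t w \<ge> 0" for t w using markov_weight_nonneg q(1) by blast
  have len: "1 \<le> length (ws ! j)" if "j < c" for j
    using ws(2) that c nth_mem[of j ws] by (metis One_nat_def Suc_leI length_greater_0_conv)
  have lensum: "(\<Sum>j<c. length (ws ! j)) = length (concat ws)"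
    by (simp add: length_concat c sum_list_sum_nth atLeast0LessThan)
  have lenle: "length (ws ! j) \<le> n" if "j < c" for j
    using member_le_sum[of j "{..<c}" "\<lambda>j. length (ws ! j)"] that n lensum by simp
  have prod: "?M [] (concat ws) = (\<Prod>j<c. ?M (s j) (ws ! j))"
    by (simp add: markov_weight_concat s_def c)
  then have Mpos: "?M (s j) (ws ! j) > 0" if "j < c" for j
    using pos M0 that by (metis finite_lessThan lessThan_iff less_le prod_zero_iff)
  have apos: "a j > 0" if "j < c" for j
    using Mpos[OF that] len[OF that] m0 by (auto simp: a_def e_def intro!: divide_pos_pos mult_pos_pos)
  \<comment> \<open>The state in which a phrase is read is replaced by a sum over all states, at the
    price \<open>m\<close>. The phrases being distinct, each word then occurs at most once.\<close>
  have suma: "(\<Sum>j<c. a j) \<le> 1"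
  proof -
    have "(\<Sum>j<c. ?M (s j) (ws ! j) * e (length (ws ! j)))
       \<le> (\<Sum>j<c. \<Sum>t\<in>St. ?M t (ws ! j) * e (length (ws ! j)))"
    proof (rule sum_mono)
      fix j
      have "s j \<in> St" by (simp add: s_def St_def length_last_part)
      then show "?M (s j) (ws ! j) * e (length (ws ! j)) \<le> (\<Sum>t\<in>St. ?M t (ws ! j) * e (length (ws ! j)))"
        using M0 e0 card_lists_le(1)[where 'b='b, of k] by (intro member_le_sum[of "s j" St "\<lambda>t. ?M t (ws ! j) * e (length (ws ! j))"]) (auto simp: St_def)
    qed
    also have "\<dots> = (\<Sum>t\<in>St. \<Sum>w\<in>set ws. ?M t w * e (length w))"
      by (subst sum.swap) (simp add: c sum.distinct_set_conv_list[OF ws(1)] sum_list_sum_nth atLeast0LessThan)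
    also have "\<dots> \<le> (\<Sum>t\<in>St. \<Sum>w\<in>(\<Union>l\<in>{1..n}. {w. length w = l}). ?M t w * e (length w))"
    proof (intro sum_mono sum_mono2)
      show "set ws \<subseteq> (\<Union>l\<in>{1..n}. {w. length w = l})"
        using len lenle c by (auto simp: in_set_conv_nth)
    qed (auto simp: M0 e0 finite_lists_length)
    also have "\<dots> = (\<Sum>t\<in>St. \<Sum>l=1..n. e l * (\<Sum>w\<in>{w. length w = l}. ?M t w))"
      by (subst sum.UNION_disjoint) (auto simp: finite_lists_length sum_distrib_left mult.commute)
    also have "\<dots> \<le> (\<Sum>t\<in>St. \<Sum>l=1..n. e l * 1)"
      using e0 markov_weight_sum_le_1[OF q] by (intro sum_mono mult_left_mono) auto
    also have "\<dots> \<le> (\<Sum>t\<in>St. 1)"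
      using sum_inverse_consecutive_le_1[of n] by (intro sum_mono) (simp add: e_def)
    also have "\<dots> \<le> m" using card_lists_le(2)[where 'b='b, of k] by (simp add: St_def m_def del: of_nat_mult of_nat_add of_nat_power)
    finally show ?thesis using m0 by (simp add: a_def sum_divide_distrib[symmetric])
  qed
  \<comment> \<open>Gibbs' inequality against the uniform weights \<open>1 / c\<close>, through
    \<open>ln t \<le> t - 1\<close> at \<open>t = c * a j\<close>.\<close>
  have "0 \<le> c - c * (\<Sum>j<c. a j)" using mult_left_mono[OF suma, of "real c"] by simp
  also have "\<dots> = (\<Sum>j<c. 1 - c * a j)" by (simp add: sum_subtractf sum_distrib_left)
  also have "\<dots> \<le> (\<Sum>j<c. - ln (c * a j))"
  proof (rule sum_mono)
    fix j assume "j \<in> {..<c}"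
    then show "1 - c * a j \<le> - ln (c * a j)" using ln_le_minus_one[of "c * a j"] apos c by simp
  qed
  also have "\<dots> \<le> (\<Sum>j<c. - ln (?M (s j) (ws ! j)) + (ln m + 2 * ln (real (length (ws ! j)) + 1)) - ln c)"
  proof (rule sum_mono)
    fix j assume "j \<in> {..<c}"
    then have j: "j < c" by simp
    let ?l = "real (length (ws ! j))"
    have l: "?l \<ge> 1" using len[OF j] by simp
    have "ln (c * a j) = ln c + (ln (?M (s j) (ws ! j)) - ln ?l - ln (?l + 1) - ln m)"
    proof -
      have "ln (C * (M * (1 / (l * (l + 1))) / m)) = ln C + (ln M - ln l - ln (l + 1) - ln m)"
        if "C > 0" "M > 0" "l > 0" for C M l :: real
        using that m0 by (simp add: ln_mult ln_div)
      from this[of "real c" "?M (s j) (ws ! j)" ?l] show ?thesis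
        using Mpos[OF j] c l unfolding a_def e_def by linarith
    qed
    moreover have "ln ?l \<le> ln (?l + 1)" using l by (intro ln_mono) auto
    ultimately show "- ln (c * a j) \<le> - ln (?M (s j) (ws ! j)) + (ln m + 2 * ln (?l + 1)) - ln c"
      by linarith
  qed
  also have "\<dots> = - ln (?M [] (concat ws)) + c * ln m + 2 * (\<Sum>j<c. ln (real (length (ws ! j)) + 1)) - c * ln c"
    using Mpos unfolding prod by (subst ln_prod) (auto simp: less_le sum.distrib sum_subtractf sum_negf sum_distrib_left)
  \<comment> \<open>Jensen's inequality by the tangent at \<open>B = n / c + 1\<close>, a bound on
    the mean of phrase length plus one.\<close>
  also have "(\<Sum>j<c. ln (real (length (ws ! j)) + 1)) \<le> c * ln (n / c + 1)"
  proof -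
    define B where "B = n / c + 1"
    have "B > 0" unfolding B_def by (rule add_nonneg_pos) auto
    moreover have "c * B = n + c" using c by (simp add: B_def distrib_left)
    ultimately have B: "B > 0" "c * B = n + c" by auto
    have "(\<Sum>j<c. ln (real (length (ws ! j)) + 1)) \<le> (\<Sum>j<c. ln B + ((real (length (ws ! j)) + 1) / B - 1))"
    proof (rule sum_mono)
      fix j
      have "ln ((real (length (ws ! j)) + 1) / B) \<le> (real (length (ws ! j)) + 1) / B - 1"
        using B by (intro ln_le_minus_one) (auto intro!: divide_pos_pos add_nonneg_pos)
      then show "ln (real (length (ws ! j)) + 1) \<le> ln B + ((real (length (ws ! j)) + 1) / B - 1)"
        using B by (subst (asm) ln_div) auto
    qed
    also have "\<dots> = c * ln B + (real (\<Sum>j<c. length (ws ! j)) + c) / B - c"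
      by (simp add: sum.distrib sum_subtractf sum_divide_distrib[symmetric])
    also have "\<dots> \<le> c * ln B + (n + c) / B - c"
      using n B by (simp add: lensum divide_right_mono)
    also have "\<dots> = c * ln B" using B by (simp add: field_simps)
    finally show ?thesis by (simp add: B_def)
  qed
  finally show ?thesis by (simp add: m_def)
qed

text \<open>Each word longer than \<open>t\<close> uses at least \<open>t + 1\<close> letters of the
  concatenation; the shorter ones are bounded by the number of words of length at most
  \<open>t\<close>.\<close>

lemma length_distinct_words_le:
  fixes ws :: "'b::finite list list" and n t :: nat
  assumes ws: "distinct ws" and n: "length (concat ws) \<le> n"
  shows "length ws \<le> n / (t + 1) + (t + 1) * CARD('b) ^ t"
proof -
  let ?S = "filter (\<lambda>w. length w \<le> t) ws" and ?L = "filter (\<lambda>w. \<not> length w \<le> t) ws"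
  have "length ws = length ?S + length ?L" by (simp add: sum_length_filter_compl)
  moreover have "length ?S \<le> (t + 1) * CARD('b) ^ t"
  proof -
    have "length ?S = card (set ?S)" using ws by (intro distinct_card[symmetric]) simp
    also have "\<dots> \<le> card {s :: 'b list. length s \<le> t}" by (intro card_mono card_lists_le(1)) auto
    finally show ?thesis using card_lists_le(2)[where 'b='b, of t] by simp
  qed
  moreover have "length ?L * (t + 1) \<le> length (concat ws)"
    by (induction ws) (auto simp: algebra_simps)
  then have "real (length ?L) * (t + 1) \<le> n"
    using n unfolding of_nat_mult[symmetric] of_nat_le_iff by linarith
  then have "real (length ?L) \<le> n / (t + 1)" by (simp add: field_simps)
  ultimately have "real (length ws) \<le> real ((t + 1) * CARD('b) ^ t) + n / (t + 1)"
    by (simp only: of_nat_add of_nat_le_iff[symmetric, where 'a=real])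
  then show ?thesis by (simp only: add.commute)
qed


section \<open>From the number of phrases to the empirical entropy\<close>

lemma log2_card_contexts_le: "log 2 ((k + 1) * CARD('b::finite) ^ k) \<le> k * (1 + log 2 CARD('b))"
proof -
  have "log 2 (real k + 1) \<le> k"
  proof -
    have "k + 1 \<le> 2 ^ k" by (metis Suc_eq_plus1 Suc_leI less_exp)
    then have "real k + 1 \<le> 2 powr k" by (simp add: powr_realpow) (metis of_nat_Suc of_nat_le_iff of_nat_numeral of_nat_power add.commute Suc_eq_plus1)
    then show ?thesis by (subst log_le_iff) auto
  qed
  moreover have "log 2 ((k + 1) * CARD('b) ^ k) = log 2 (real k + 1) + k * log 2 CARD('b)"
  proof -
    have "log 2 ((real k + 1) * real CARD('b) ^ k) = log 2 (real k + 1) + log 2 (real CARD('b) ^ k)"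
      by (intro log_mult_pos) auto
    then show ?thesis by (simp add: log_nat_power algebra_simps)
  qed
  ultimately show ?thesis by (simp add: algebra_simps)
qed

text \<open>Rounding costs at most one bit for the pointer and one for the letter, hence the
  \<open>2\<close>. The final phrase lies outside \<open>c\<close>, because only the others are
  known to be distinct; its pointer is bounded crudely by
  \<open>log 2 (c + 1) \<le> c\<close>.\<close>

lemma lz_length_le_phrases:
  fixes ys :: "'b::finite list"
  defines "c \<equiv> length (butlast (lz_phrases ys))"
  shows "lz_length ys \<le> c * log 2 c + c + (c + 1) * (2 + log 2 CARD('b))"
proof -
  let ?L = "log 2 CARD('b)"
  have ceil: "ceillog2 m \<le> log 2 m + 1" if "m > 0" for m using ceillog2_less_log[OF that] by simp
  have "length (lz_phrases ys) \<le> c + 1" by (simp add: c_def)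
  then have "lz_length ys \<le> (\<Sum>j<c + 1. ceillog2 (j + 1) + ceillog2 CARD('b))"
    unfolding lz_length_def by (intro sum_mono2) auto
  then have "real (lz_length ys) \<le> (\<Sum>j<c + 1. real (ceillog2 (j + 1)) + real (ceillog2 CARD('b)))"
    by (metis (mono_tags, lifting) of_nat_add of_nat_le_iff of_nat_sum sum.cong)
  also have "\<dots> \<le> (\<Sum>j<c + 1. log 2 (j + 1) + (2 + ?L))"
    using ceil[of "_ + 1"] ceil[of "CARD('b)"] by (intro sum_mono) (smt (verit) zero_less_card_finite zero_less_Suc Suc_eq_plus1)
  also have "\<dots> = (\<Sum>j<c. log 2 (j + 1)) + log 2 (c + 1) + (c + 1) * (2 + ?L)" by (simp add: sum.distrib algebra_simps)
  also have "(\<Sum>j<c. log 2 (j + 1)) \<le> (\<Sum>j<c. log 2 c)" by (intro sum_mono) auto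
  also have "log 2 (c + 1) \<le> c"
  proof -
    have "c + 1 \<le> 2 ^ c" by (metis Suc_eq_plus1 Suc_leI less_exp)
    then have "real c + 1 \<le> 2 powr c" by (simp add: powr_realpow) (metis of_nat_Suc of_nat_le_iff of_nat_numeral of_nat_power add.commute Suc_eq_plus1)
    then show ?thesis by (subst log_le_iff) (auto simp: add.commute)
  qed
  finally show ?thesis by (simp add: add.commute)
qed

text \<open>With the empirical kernel on full contexts and the uniform law on the first
  \<open>k\<close> letters, the Markov weight of the word itself reproduces its empirical entropy
  without error.\<close>

lemma log_markov_weight_empirical:
  fixes ys :: "'b::finite list"
  assumes k: "k < length ys"
  defines "q \<equiv> \<lambda>s b. if length s = k then emp_kernel k ys s b else 1 / real CARD('b)"
  shows "0 < markov_weight k q [] ys"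
    and "- log 2 (markov_weight k q [] ys) = k * log 2 CARD('b) + (length ys - k) * emp_cond_entropy k ys"
proof -
  let ?f = "\<lambda>i. q (last_part k (take i ys)) (ys ! i)"
  have M: "markov_weight k q [] ys = (\<Prod>i<length ys. ?f i)"
    using markov_weight_eq_prod[of k q "[]" ys] by (simp add: last_part_def)
  have f1: "?f i = 1 / real CARD('b)" if "i < k" for i
    using that k by (simp add: q_def length_last_part)
  have f2: "?f i = emp_kernel k ys (context_of k ys i) (ys ! i)" if "k \<le> i" "i < length ys" for i
    using that k by (simp add: q_def length_last_part flip: last_part_take_eq_context_of)
  have pos: "?f i > 0" if "i < length ys" for i
    using f1[of i] f2[of i] emp_kernel_pos[of k i ys] that by (cases "i < k") auto
  then show "0 < markov_weight k q [] ys" unfolding M by (intro prod_pos) auto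
  have "- log 2 (markov_weight k q [] ys) = (\<Sum>i<length ys. - log 2 (?f i))"
    unfolding M log_def using pos by (subst ln_prod) (auto simp: sum_negf sum_divide_distrib less_le)
  also have "\<dots> = (\<Sum>i<k. - log 2 (?f i)) + (\<Sum>i\<in>{k..<length ys}. - log 2 (?f i))"
    using k by (simp add: lessThan_atLeast0 sum.atLeastLessThan_concat)
  also have "(\<Sum>i<k. - log 2 (?f i)) = k * log 2 CARD('b)"
    by (simp add: f1 log_divide)
  also have "(\<Sum>i\<in>{k..<length ys}. - log 2 (?f i)) = (length ys - k) * emp_cond_entropy k ys"
    using k by (simp add: emp_cond_entropy_eq f2)
  finally show "- log 2 (markov_weight k q [] ys) = k * log 2 CARD('b) + (length ys - k) * emp_cond_entropy k ys" .
qed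

lemma ln_one_add_le_sqrt:
  assumes "0 \<le> (x::real)"
  shows "ln (1 + x) \<le> 2 * sqrt x"
proof -
  have "ln (1 + x) \<le> ln ((1 + sqrt x)\<^sup>2)"
    using assms by (intro ln_mono) (auto simp: power2_eq_square algebra_simps)
  also have "\<dots> = 2 * ln (1 + sqrt x)" using assms by (simp add: ln_realpow add_pos_nonneg)
  also have "\<dots> \<le> 2 * sqrt x" using ln_add_one_self_le_self[of "sqrt x"] assms by simp
  finally show ?thesis .
qed

text \<open>Ziv's inequality for the completed phrases under the empirical kernel. The term
  \<open>k * L\<close> pays for the first \<open>k\<close> letters, \<open>c * k * (1 + L)\<close>
  for the states, and the root for the phrase lengths, by \<open>ln (1 + x) \<le> 2 * sqrt x\<close>
  and \<open>ln 2 \<ge> 1 / 2\<close>.\<close>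

lemma lz_length_le:
  fixes ys :: "'b::finite list"
  assumes k: "k < length ys"
  defines "c \<equiv> real (length (butlast (lz_phrases ys)))" and "n \<equiv> length ys" and "L \<equiv> log 2 CARD('b)"
  shows "lz_length ys \<le> (n - k) * emp_cond_entropy k ys
      + (k * L + c * k * (1 + L) + 8 * sqrt (n * c) + c + (c + 1) * (2 + L))"
proof -
  define q where "q = (\<lambda>s b. if length s = k then emp_kernel k ys s b else 1 / real CARD('b))"
  let ?ws = "butlast (lz_phrases ys)"
  note M = log_markov_weight_empirical[OF k, folded q_def]
  have q: "0 \<le> q s b" "(\<Sum>b\<in>UNIV. q s b) \<le> 1" for s b
    using emp_kernel_sum_le_1[of k ys s] by (cases "length s = k"; auto simp: q_def emp_kernel_nonneg)+
  have L0: "L \<ge> 0" by (simp add: L_def)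
  obtain v where v: "ys = concat ?ws @ v"
  proof (cases "lz_phrases ys = []")
    case True
    then show ?thesis using that[of ys] by simp
  next
    case False
    then have "concat (?ws @ [last (lz_phrases ys)]) = ys" using append_butlast_last_id concat_lz_phrases by metis
    then show ?thesis using that[of "last (lz_phrases ys)"] by (metis concat.simps concat_append append_Nil2)
  qed
  have "c * log 2 c \<le> k * L + (n - k) * emp_cond_entropy k ys + c * k * (1 + L) + 8 * sqrt (n * c)"
  proof (cases "c = 0")
    case True
    then show ?thesis using L0 emp_cond_entropy_nonneg[OF k] by simp
  next
    case False
    define C where "C = length ?ws"
    have C: "c = real C" "C > 0" using False by (auto simp: c_def C_def)
    \<comment> \<open>Dropping the unfinished last phrase can only raise the weight, since the
      weight of any tail is at most \<open>1\<close>.\<close>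
    have Mv: "markov_weight k q [] ys \<le> markov_weight k q [] (concat ?ws)"
    proof -
      have eq: "markov_weight k q [] ys = markov_weight k q [] (concat ?ws) * markov_weight k q (last_part k (concat ?ws)) v"
        using markov_weight_append[of k q "[]" "concat ?ws" v] v by (simp add: last_part_def)
      have "markov_weight k q (last_part k (concat ?ws)) v
          \<le> (\<Sum>w\<in>{w. length w = length v}. markov_weight k q (last_part k (concat ?ws)) w)"
        using q by (intro member_le_sum) (auto simp: finite_lists_length markov_weight_nonneg)
      also have "\<dots> \<le> 1" using markov_weight_sum_le_1 q by blast
      finally show ?thesis unfolding eq using q by (intro mult_left_le) (auto intro: markov_weight_nonneg)
    qed
    have nil: "[] \<notin> set ?ws"
      using prefix_parsing_nonempty[OF prefix_parsing_lz_phrases] by (meson in_set_butlastD)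
    have "length (concat ?ws) \<le> n" unfolding n_def by (subst (2) v) simp
    from ziv_inequality[OF q distinct_butlast_lz_phrases nil less_le_trans[OF M(1) Mv] this C_def C(2)]
    have "C * ln C \<le> - ln (markov_weight k q [] (concat ?ws)) + C * ln ((k + 1) * CARD('b) ^ k) + 2 * real C * ln (n / C + 1)" .
    also have "\<dots> \<le> - ln (markov_weight k q [] ys) + C * ln ((k + 1) * CARD('b) ^ k) + 4 * sqrt (n * C)"
    proof -
      have "C * ln (n / C + 1) \<le> C * (2 * sqrt (n / C))"
        using ln_one_add_le_sqrt[of "n / C"] by (intro mult_left_mono) (auto simp: add.commute)
      also have "C * (2 * sqrt (n / C)) = 2 * (sqrt (C * C) * sqrt (n / C))" by simp
      also have "\<dots> = 2 * sqrt (real C * C * (n / C))" by (simp only: real_sqrt_mult of_nat_mult)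
      also have "real C * C * (n / C) = n * C" using C(2) by simp
      finally have "2 * real C * ln (n / C + 1) \<le> 4 * sqrt (n * C)" by simp
      moreover have "ln (markov_weight k q [] ys) \<le> ln (markov_weight k q [] (concat ?ws))"
        using M(1) Mv by simp
      ultimately show ?thesis by linarith
    qed
    finally have "C * ln C / ln 2 \<le> (- ln (markov_weight k q [] ys) + C * ln ((k + 1) * CARD('b) ^ k) + 4 * sqrt (n * C)) / ln 2"
      by (rule divide_right_mono) simp
    then have "c * log 2 c \<le> - log 2 (markov_weight k q [] ys) + C * log 2 ((k + 1) * CARD('b) ^ k) + 4 * sqrt (n * C) / ln 2"
      by (simp add: log_def C(1) add_divide_distrib diff_divide_distrib)
    also have "\<dots> \<le> (k * L + (n - k) * emp_cond_entropy k ys) + C * (k * (1 + L)) + 8 * sqrt (n * C)"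
    proof (intro add_mono)
      show "- log 2 (markov_weight k q [] ys) \<le> k * L + (n - k) * emp_cond_entropy k ys"
        using M(2) by (simp add: n_def L_def)
      show "C * log 2 ((k + 1) * CARD('b) ^ k) \<le> C * (k * (1 + L))"
        unfolding L_def by (intro mult_left_mono log2_card_contexts_le) auto
      have "ln (2::real) \<ge> 1 / 2" using ln2_ge_two_thirds by simp
      then have "4 * sqrt (n * C) \<le> ln 2 * (8 * sqrt (n * C))"
        using mult_right_mono[of "1/2" "ln 2" "8 * sqrt (n * C)"] by simp
      then show "4 * sqrt (n * C) / ln 2 \<le> 8 * sqrt (n * C)" by (simp add: divide_le_eq mult.commute)
    qed
    finally show ?thesis by (simp add: C(1) mult.assoc)
  qed
  with lz_length_le_phrases[of ys] show ?thesis using k by (simp add: c_def L_def n_def of_nat_diff)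
qed

text \<open>Every error term is controlled by a bound of order \<open>n / ln n\<close> on the number
  of phrases. The critical one is the number of phrases times \<open>k n / n\<close>, which vanishes
  because \<open>k n\<close> is \<open>o(ln n)\<close>.\<close>

theorem lz_length_le_emp_cond_entropy:
  fixes k :: "nat \<Rightarrow> nat"
  assumes k: "(\<lambda>n. real (k n)) \<in> o(\<lambda>n. ln (real n))"
  obtains \<epsilon> :: "nat \<Rightarrow> real" where "\<epsilon> \<longlonglongrightarrow> 0"
    and "\<And>n ys :: 'b::finite list. 1 < n \<Longrightarrow> length ys = n \<Longrightarrow> k n < n
        \<Longrightarrow> lz_length ys / n \<le> emp_cond_entropy (k n) ys + \<epsilon> n"
proof -
  \<comment> \<open>The \<open>+ 1\<close> keeps \<open>a\<close> positive for an alphabet with one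
    letter.\<close>
  define a where "a = ln (real CARD('b) + 1)"
  have a0: "a > 0" by (simp add: a_def)
  define L where "L = log 2 CARD('b)"
  have L0: "L \<ge> 0" by (simp add: L_def)
  \<comment> \<open>The count of distinct words with threshold \<open>t\<close> the integer part of
    \<open>ln n / (2 * a)\<close>, chosen so that \<open>CARD('b) ^ t \<le> sqrt n\<close>.\<close>
  define cb where "cb = (\<lambda>n::nat. 2 * a * n / ln n + (ln n / (2 * a) + 1) * sqrt n)"
  define \<epsilon> where "\<epsilon> = (\<lambda>n::nat. (k n * L + cb n * k n * (1 + L) + 8 * sqrt (n * cb n) + cb n + (cb n + 1) * (2 + L)) / n)"
  have kl: "(\<lambda>n. k n / ln n) \<longlonglongrightarrow> 0" by (rule smalloD_tendsto[OF k])
  have cl: "(\<lambda>n. ln n * cb n / n) \<longlonglongrightarrow> 2 * a"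
    unfolding cb_def using a0 by real_asymp
  have c1: "(\<lambda>n. cb n / n) \<longlonglongrightarrow> 0" unfolding cb_def using a0 by real_asymp
  have "(\<lambda>n::nat. ln n / n) \<longlonglongrightarrow> 0" by real_asymp
  from tendsto_mult[OF kl this] have "(\<lambda>n. k n / ln n * (ln n / n)) \<longlonglongrightarrow> 0" by simp
  moreover have "\<forall>\<^sub>F n in sequentially. k n / ln n * (ln n / n) = k n / n"
    using eventually_gt_at_top[of "1::nat"] by eventually_elim simp
  ultimately have k1: "(\<lambda>n. k n / n) \<longlonglongrightarrow> 0" by (rule Lim_transform_eventually)
  from tendsto_mult[OF kl cl] have "(\<lambda>n. k n / ln n * (ln n * cb n / n)) \<longlonglongrightarrow> 0" by simp
  moreover have "\<forall>\<^sub>F n in sequentially. k n / ln n * (ln n * cb n / n) = cb n * k n / n"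
    using eventually_gt_at_top[of "1::nat"] by eventually_elim simp
  ultimately have ck: "(\<lambda>n. cb n * k n / n) \<longlonglongrightarrow> 0" by (rule Lim_transform_eventually)
  have s1: "(\<lambda>n. sqrt (n * cb n) / n) \<longlonglongrightarrow> 0"
  proof (rule Lim_transform_eventually[OF tendsto_real_sqrt[OF c1, simplified]])
    show "\<forall>\<^sub>F n in sequentially. sqrt (cb n / n) = sqrt (n * cb n) / n"
      using eventually_gt_at_top[of "1::nat"]
    proof eventually_elim
      case (elim n)
      have "sqrt (n * cb n) / n = sqrt (n * cb n) / sqrt (real n * real n)" by simp
      also have "\<dots> = sqrt ((n * cb n) / (real n * real n))" by (rule real_sqrt_divide[symmetric])
      also have "(n * cb n) / (real n * real n) = cb n / n" using elim by simp
      finally show ?case by simp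
    qed
  qed
  have i1: "(\<lambda>n::nat. 1 / real n) \<longlonglongrightarrow> 0" by real_asymp
  have "(\<lambda>n. k n / n * L + cb n * k n / n * (1 + L) + 8 * (sqrt (n * cb n) / n) + cb n / n
      + (cb n / n + 1 / n) * (2 + L)) \<longlonglongrightarrow> 0 * L + 0 * (1 + L) + 8 * 0 + 0 + (0 + 0) * (2 + L)"
    by (intro tendsto_intros k1 ck s1 c1 i1)
  moreover have "\<epsilon> = (\<lambda>n. k n / n * L + cb n * k n / n * (1 + L) + 8 * (sqrt (n * cb n) / n) + cb n / n
      + (cb n / n + 1 / n) * (2 + L))"
    by (simp add: \<epsilon>_def fun_eq_iff add_divide_distrib distrib_right)
  ultimately have "\<epsilon> \<longlonglongrightarrow> 0" by simp
  moreover have "lz_length ys / n \<le> emp_cond_entropy (k n) ys + \<epsilon> n"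
    if n: "1 < n" "length ys = n" "k n < n" for n and ys :: "'b list"
  proof -
    define c where "c = real (length (butlast (lz_phrases ys)))"
    have ln0: "ln n > 0" using n by simp
    have "c \<le> cb n"
    proof -
      define t where "t = nat \<lfloor>ln n / (2 * a)\<rfloor>"
      have t: "real t \<le> ln n / (2 * a)" "ln n / (2 * a) < real t + 1"
        using ln0 a0 by (auto simp: t_def of_nat_nat)
      have "length (concat (butlast (lz_phrases ys))) \<le> length (concat (lz_phrases ys))"
        by (cases "lz_phrases ys" rule: rev_cases) auto
      then have "length (concat (butlast (lz_phrases ys))) \<le> n" by (simp add: concat_lz_phrases n)
      then have "c \<le> n / (t + 1) + (t + 1) * CARD('b) ^ t"
        unfolding c_def by (rule length_distinct_words_le[OF distinct_butlast_lz_phrases])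
      also have "n / (t + 1) \<le> n / (ln n / (2 * a))"
        using t ln0 a0 by (intro divide_left_mono) auto
      also have "(t + 1) * CARD('b) ^ t \<le> (ln n / (2 * a) + 1) * sqrt n"
      proof -
        have "real CARD('b) ^ t \<le> (real CARD('b) + 1) ^ t" by (intro power_mono) auto
        also have "\<dots> = exp (t * a)" by (simp add: a_def exp_of_nat_mult)
        also have "\<dots> \<le> exp (ln n / 2)"
          using mult_right_mono[OF t(1), of a] a0 by simp
        also have "\<dots> = sqrt n"
          using n by (simp add: ln_sqrt[symmetric])
        finally have "real CARD('b) ^ t \<le> sqrt n" .
        then have "(real t + 1) * real CARD('b) ^ t \<le> (ln n / (2 * a) + 1) * sqrt n"
          using t(1) ln0 a0 by (intro mult_mono) auto
        then show ?thesis by (simp add: algebra_simps)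
      qed
      finally show ?thesis using a0 by (simp add: cb_def mult.commute)
    qed
    have c0: "c \<ge> 0" by (simp add: c_def)
    have "real (lz_length ys) \<le> (n - k n) * emp_cond_entropy (k n) ys
      + (k n * L + c * k n * (1 + L) + 8 * sqrt (n * c) + c + (c + 1) * (2 + L))"
      using lz_length_le[of "k n" ys] n unfolding L_def c_def by simp
    also have "\<dots> \<le> n * emp_cond_entropy (k n) ys
      + (k n * L + cb n * k n * (1 + L) + 8 * sqrt (n * cb n) + cb n + (cb n + 1) * (2 + L))"
      using \<open>c \<le> cb n\<close> c0 L0 emp_cond_entropy_nonneg[of "k n" ys] n
      by (intro add_mono mult_right_mono mult_left_mono real_sqrt_le_mono order_refl) auto
    finally have "real (lz_length ys) / n \<le> (n * emp_cond_entropy (k n) ys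
      + (k n * L + cb n * k n * (1 + L) + 8 * sqrt (n * cb n) + cb n + (cb n + 1) * (2 + L))) / n"
      by (rule divide_right_mono) simp
    also have "\<dots> = emp_cond_entropy (k n) ys + \<epsilon> n" using n by (simp add: \<epsilon>_def add_divide_distrib)
    finally show ?thesis .
  qed
  ultimately show ?thesis by (rule that)
qed

section \<open>Block laws and recurrence of an ergodic source\<close>

text \<open>Stationarity in the form of consistent marginals: every factor of length
  \<open>l\<close> has the law \<open>p l\<close>. The later arguments then take place on finite
  words, away from the probability space.\<close>

locale stationary_blocks =
  fixes p :: "nat \<Rightarrow> 'a::finite list pmf"
  assumes length_block: "\<And>n xs. xs \<in> set_pmf (p n) \<Longrightarrow> length xs = n"
    and marginal: "\<And>q l n. q + l \<le> n \<Longrightarrow> map_pmf (\<lambda>xs. take l (drop q xs)) (p n) = p l"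
begin

lemma finite_set_block: "finite (set_pmf (p n))"
  by (rule finite_subset[OF _ finite_lists_length[of n]]) (auto dest: length_block)

lemma expectation_marginal:
  fixes f :: "'a list \<Rightarrow> real"
  assumes "q + l \<le> n"
  shows "expect (p n) (\<lambda>xs. f (take l (drop q xs))) = expect (p l) f"
  unfolding marginal[OF assms, symmetric] by simp

end

section \<open>Block laws of a stationary ergodic source\<close>

lemma take_drop_map_upt: "q + l \<le> n \<Longrightarrow> take l (drop q (map f [0..<n])) = map f [q..<q + l]"
  by (simp add: drop_map take_map take_upt)

context
  fixes M :: "'w measure" and X :: "nat \<Rightarrow> 'w \<Rightarrow> 'a::finite"
  assumes src: "stationary_ergodic_source M X"
begin

interpretation M: prob_space M using src by (simp add: stationary_ergodic_source_def)

lemma X_measurable [measurable]: "X i \<in> measurable M (count_space UNIV)"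
  using src by (simp add: stationary_ergodic_source_def)

lemma path_measurable: "(\<lambda>\<omega> i. X i \<omega>) \<in> measurable M seq_space"
  by (rule measurable_abs_UNIV) (rule X_measurable)

lemma shift_measurable: "(shift :: (nat \<Rightarrow> 'a) \<Rightarrow> _) \<in> measurable seq_space seq_space"
  unfolding shift_def by (rule measurable_abs_UNIV) (rule measurable_component_singleton, simp)

lemma space_seq: "space (seq_space :: (nat \<Rightarrow> 'a) measure) = UNIV"
  by (simp add: space_PiM PiE_def)

lemma measure_path_law: "A \<in> sets seq_space \<Longrightarrow> measure (path_law M X) A = measure M {\<omega>\<in>space M. (\<lambda>i. X i \<omega>) \<in> A}"
  unfolding path_law_def by (subst measure_distr[OF path_measurable]) (simp_all add: vimage_def Int_def conj_commute)

lemma shift_preserves: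
  assumes "A \<in> sets seq_space"
  shows "measure (path_law M X) (shift -` A) = measure (path_law M X) A"
proof -
  have P: "shift \<in> measurable (path_law M X) seq_space" using shift_measurable by (simp add: path_law_def)
  have "measure (path_law M X) A = measure (distr (path_law M X) seq_space shift) A"
    using src by (simp add: stationary_ergodic_source_def stationary_def)
  also have "\<dots> = measure (path_law M X) (shift -` A \<inter> space (path_law M X))"
    by (rule measure_distr[OF P assms])
  finally show ?thesis by (simp add: path_law_def space_seq)
qed

definition cylinder :: "'a list \<Rightarrow> nat \<Rightarrow> (nat \<Rightarrow> 'a) set" where
  "cylinder u i = {x. map x [i..<i + length u] = u}"

lemma mem_cylinder: "x \<in> cylinder u i \<longleftrightarrow> (\<forall>j<length u. x (i + j) = u ! j)"
  unfolding cylinder_def mem_Collect_eq list_eq_iff_nth_eq by simp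

lemma cylinder_sets: "cylinder u i \<in> sets seq_space"
proof -
  have "{x. x (i + j) = u ! j} \<in> sets seq_space" for j
  proof -
    have "(\<lambda>x. x (i + j)) -` {u ! j} \<inter> space seq_space \<in> sets (seq_space :: (nat \<Rightarrow> 'a) measure)"
      by (rule measurable_sets[OF measurable_component_singleton]) simp_all
    then show ?thesis by (simp only: space_seq Int_UNIV_right vimage_def singleton_iff)
  qed
  then have "{x \<in> space (seq_space :: (nat \<Rightarrow> 'a) measure). \<forall>j\<in>{..<length u}. x (i + j) = u ! j} \<in> sets seq_space"
    by (intro sets.sets_Collect_finite_All) (simp_all only: space_seq UNIV_I simp_thms finite_lessThan)
  moreover have "{x \<in> space (seq_space :: (nat \<Rightarrow> 'a) measure). \<forall>j\<in>{..<length u}. x (i + j) = u ! j} = cylinder u i"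
    unfolding space_seq by (rule set_eqI) (simp add: mem_cylinder Ball_def)
  ultimately show ?thesis by (simp only:)
qed

lemma shift_cylinder: "shift -` cylinder u i = cylinder u (Suc i)"
  by (rule set_eqI) (simp add: mem_cylinder shift_def)

lemma measure_cylinder: "measure (path_law M X) (cylinder u i) = measure (path_law M X) (cylinder u 0)"
  by (induction i) (simp_all flip: shift_cylinder add: shift_preserves cylinder_sets)

lemma block_eq_cylinder: "length xs = n \<Longrightarrow> {\<omega>\<in>space M. block X n \<omega> = xs} = {\<omega>\<in>space M. (\<lambda>i. X i \<omega>) \<in> cylinder xs 0}"
  by (auto simp: block_def cylinder_def)

lemma block_sets: "{\<omega>\<in>space M. block X n \<omega> = xs} \<in> sets M"
proof (cases "length xs = n")
  case True
  then show ?thesis using measurable_sets[OF path_measurable cylinder_sets[of xs 0]]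
    by (simp add: block_eq_cylinder vimage_def Int_def conj_commute)
next
  case False
  then have "{\<omega>\<in>space M. block X n \<omega> = xs} = {}" by (auto simp: block_def)
  then show ?thesis by (simp only: sets.empty_sets)
qed

lemma integral_block:
  fixes g :: "'a list \<Rightarrow> real"
  shows "(\<integral>\<omega>. g (block X n \<omega>) \<partial>M) = (\<Sum>xs\<in>{xs. length xs = n}. g xs * measure M {\<omega>\<in>space M. block X n \<omega> = xs})"
proof -
  have "(\<integral>\<omega>. g (block X n \<omega>) \<partial>M)
    = (\<integral>\<omega>. (\<Sum>xs\<in>{xs. length xs = n}. g xs * indicator {\<omega>\<in>space M. block X n \<omega> = xs} \<omega>) \<partial>M)"
  proof (rule Bochner_Integration.integral_cong[OF refl])
    fix \<omega> assume "\<omega> \<in> space M"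
    then have "(\<Sum>xs\<in>{xs. length xs = n}. g xs * indicator {\<omega>\<in>space M. block X n \<omega> = xs} \<omega>)
      = (\<Sum>xs\<in>{xs. length xs = n}. if xs = block X n \<omega> then g xs else 0)"
      by (intro sum.cong) auto
    then show "g (block X n \<omega>) = (\<Sum>xs\<in>{xs. length xs = n}. g xs * indicator {\<omega>\<in>space M. block X n \<omega> = xs} \<omega>)"
      by (simp add: finite_lists_length block_def)
  qed
  also have "\<dots> = (\<Sum>xs\<in>{xs. length xs = n}. g xs * measure M {\<omega>\<in>space M. block X n \<omega> = xs})"
    using block_sets[of n]
    by (subst Bochner_Integration.integral_sum) (auto simp: M.emeasure_finite less_top[symmetric] Int_def conj_commute)
  finally show ?thesis .
qed

lemma pmf_block_pmf: "pmf (block_pmf M X n) xs = measure M {\<omega>\<in>space M. block X n \<omega> = xs}"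
  unfolding block_pmf_def
proof (rule pmf_embed_pmf)
  have "(\<integral>\<^sup>+xs. ennreal (measure M {\<omega>\<in>space M. block X n \<omega> = xs}) \<partial>count_space UNIV)
    = (\<Sum>xs\<in>{xs. length xs = n}. ennreal (measure M {\<omega>\<in>space M. block X n \<omega> = xs}))"
  proof (rule nn_integral_count_space'[OF finite_lists_length])
    fix xs :: "'a list" assume "xs \<in> UNIV" "xs \<notin> {xs. length xs = n}"
    then have "{\<omega>\<in>space M. block X n \<omega> = xs} = {}" by (auto simp: block_def)
    then show "ennreal (measure M {\<omega>\<in>space M. block X n \<omega> = xs}) = 0"
      by (simp only: measure_empty ennreal_0)
  qed auto
  also have "\<dots> = ennreal (\<Sum>xs\<in>{xs. length xs = n}. measure M {\<omega>\<in>space M. block X n \<omega> = xs})"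
    by (simp add: sum_ennreal)
  also have "(\<Sum>xs\<in>{xs. length xs = n}. measure M {\<omega>\<in>space M. block X n \<omega> = xs}) = 1"
    using integral_block[of "\<lambda>_. 1" n] by (simp add: M.prob_space)
  finally show "(\<integral>\<^sup>+xs. ennreal (measure M {\<omega>\<in>space M. block X n \<omega> = xs}) \<partial>count_space UNIV) = 1" by simp
qed simp

lemma set_block_pmf: "xs \<in> set_pmf (block_pmf M X n) \<Longrightarrow> length xs = n"
proof (rule ccontr)
  assume xs: "xs \<in> set_pmf (block_pmf M X n)" "length xs \<noteq> n"
  then have "{\<omega>\<in>space M. block X n \<omega> = xs} = {}" by (auto simp: block_def)
  with xs show False by (simp add: set_pmf_iff pmf_block_pmf)
qed

lemma expectation_block_pmf:
  fixes g :: "'a list \<Rightarrow> real"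
  shows "(\<integral>\<omega>. g (block X n \<omega>) \<partial>M) = expect (block_pmf M X n) g"
  unfolding integral_block
  by (subst expectation_finite[OF finite_lists_length[of n]]) (auto simp: pmf_block_pmf mult.commute dest: set_block_pmf)

lemma prob_block_pmf:
  "measure_pmf.prob (block_pmf M X n) A = measure M {\<omega>\<in>space M. block X n \<omega> \<in> A}"
proof -
  have "measure_pmf.prob (block_pmf M X n) A = expect (block_pmf M X n) (indicator A)"
    by simp
  also have "\<dots> = (\<integral>\<omega>. indicator {\<omega>\<in>space M. block X n \<omega> \<in> A} \<omega> \<partial>M)"
    unfolding expectation_block_pmf[symmetric] by (rule Bochner_Integration.integral_cong) (auto simp: indicator_def)
  also have "\<dots> = measure M ({\<omega>\<in>space M. block X n \<omega> \<in> A} \<inter> space M)" by (rule Bochner_Integration.integral_indicator)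
  also have "{\<omega>\<in>space M. block X n \<omega> \<in> A} \<inter> space M = {\<omega>\<in>space M. block X n \<omega> \<in> A}" by auto
  finally show ?thesis .
qed

lemma stationary_blocks_block_pmf: "stationary_blocks (block_pmf M X)"
proof
  fix n xs assume "xs \<in> set_pmf (block_pmf M X n)" then show "length xs = n" by (rule set_block_pmf)
next
  fix q l n :: nat assume le: "q + l \<le> n"
  show "map_pmf (\<lambda>xs. take l (drop q xs)) (block_pmf M X n) = block_pmf M X l"
  proof (rule pmf_eqI)
    fix ys :: "'a list"
    have "pmf (map_pmf (\<lambda>xs. take l (drop q xs)) (block_pmf M X n)) ys
       = measure M {\<omega>\<in>space M. map (\<lambda>i. X i \<omega>) [q..<q + l] = ys}"
      unfolding pmf_map prob_block_pmf using le by (simp add: block_def take_drop_map_upt)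
    also have "\<dots> = measure M {\<omega>\<in>space M. block X l \<omega> = ys}"
    proof (cases "length ys = l")
      case True
      then have "measure M {\<omega>\<in>space M. map (\<lambda>i. X i \<omega>) [q..<q + l] = ys} = measure (path_law M X) (cylinder ys q)"
        by (subst measure_path_law[OF cylinder_sets]) (simp add: cylinder_def)
      also have "\<dots> = measure (path_law M X) (cylinder ys 0)" by (rule measure_cylinder)
      also have "\<dots> = measure M {\<omega>\<in>space M. block X l \<omega> = ys}"
        using True by (subst measure_path_law[OF cylinder_sets]) (simp add: block_eq_cylinder)
      finally show ?thesis .
    next
      case False
      then have "{\<omega>\<in>space M. map (\<lambda>i. X i \<omega>) [q..<q + l] = ys} = {}" "{\<omega>\<in>space M. block X l \<omega> = ys} = {}"
        by (auto simp: block_def)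
      then show ?thesis by (simp only:)
    qed
    finally show "pmf (map_pmf (\<lambda>xs. take l (drop q xs)) (block_pmf M X n)) ys = pmf (block_pmf M X l) ys"
      by (simp add: pmf_block_pmf)
  qed
qed

text \<open>\<open>C n\<close> is the event of an occurrence at or after \<open>n\<close>; by
  stationarity its probability does not depend on \<open>n\<close>. The decreasing intersection,
  infinitely many occurrences, is shift invariant and as likely as \<open>C 0\<close>, which is
  positive, hence of probability one. Continuity from below then gives a finite horizon
  \<open>L\<close>.\<close>

lemma ergodic_recurrence:
  assumes u: "u \<in> set_pmf (block_pmf M X (length u))" and \<epsilon>: "0 < (\<epsilon>::real)"
  shows "\<exists>L. measure_pmf.prob (block_pmf M X (L + length u)) {xs. \<forall>i<L. take (length u) (drop i xs) \<noteq> u} < \<epsilon>"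
proof -
  let ?P = "path_law M X"
  interpret P: prob_space ?P unfolding path_law_def by (rule M.prob_space_distr[OF path_measurable])
  have sP: "sets ?P = sets seq_space" by (simp add: path_law_def)
  define C where "C = (\<lambda>n. \<Union>i\<in>{n..}. cylinder u i)"
  have C: "C n \<in> sets seq_space" for n unfolding C_def by (intro sets.countable_UN'' cylinder_sets) auto
  have shC: "shift -` C n = C (Suc n)" for n
  proof -
    have "m \<in> Suc ` {n..}" if "m \<in> {Suc n..}" for m
    proof -
      have "m = Suc (m - 1)" "m - 1 \<in> {n..}" using that by auto
      then show ?thesis by blast
    qed
    then have "{Suc n..} = Suc ` {n..}" by auto
    then show ?thesis by (simp add: C_def vimage_UN shift_cylinder)
  qed
  have PC: "measure ?P (C n) = measure ?P (C 0)" for n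
  proof (induction n)
    case (Suc n)
    have "measure ?P (C (Suc n)) = measure ?P (C n)" unfolding shC[symmetric] by (rule shift_preserves[OF C])
    with Suc show ?case by (simp only:)
  qed simp
  define A where "A = (\<Inter>n. C n)"
  have decC: "decseq C" unfolding decseq_def C_def by (intro allI impI UN_mono) auto
  have "(\<lambda>n. measure ?P (C n)) \<longlonglongrightarrow> measure ?P A"
    unfolding A_def using C decC by (intro P.finite_Lim_measure_decseq) (auto simp: sP)
  moreover have "(\<lambda>n. measure ?P (C n)) \<longlonglongrightarrow> measure ?P (C 0)"
    by (rule Lim_transform_eventually[OF tendsto_const]) (use PC in \<open>metis (mono_tags, lifting) always_eventually\<close>)
  ultimately have PA: "measure ?P A = measure ?P (C 0)" by (rule LIMSEQ_unique)
  have A: "A \<in> sets seq_space" unfolding A_def using C by (intro sets.countable_INT) auto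
  have "shift -` A = (\<Inter>n. C (Suc n))" by (simp add: A_def vimage_INT shC)
  also have "\<dots> = A" unfolding A_def using decC unfolding decseq_Suc_iff by blast
  finally have "measure ?P A \<in> {0, 1}"
    using src A by (simp add: stationary_ergodic_source_def ergodic_def)
  moreover have "measure ?P (C 0) > 0"
  proof -
    have "0 < pmf (block_pmf M X (length u)) u" using u by (rule pmf_positive)
    also have "\<dots> = measure ?P (cylinder u 0)"
      by (simp add: pmf_block_pmf measure_path_law[OF cylinder_sets] block_eq_cylinder)
    also have "\<dots> \<le> measure ?P (C 0)"
    proof (rule P.finite_measure_mono)
      show "cylinder u 0 \<subseteq> C 0" by (auto simp: C_def)
      show "C 0 \<in> P.events" unfolding sP by (rule C)
    qed
    finally show ?thesis .
  qed
  ultimately have one: "measure ?P (C 0) = 1" using PA by auto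
  define B where "B = (\<lambda>L. \<Union>i<L. cylinder u i)"
  have B: "B L \<in> sets seq_space" for L unfolding B_def by (intro sets.finite_UN cylinder_sets) auto
  have "(\<lambda>L. measure ?P (B L)) \<longlonglongrightarrow> measure ?P (\<Union>L. B L)"
  proof (rule P.finite_Lim_measure_incseq)
    show "range B \<subseteq> P.events" unfolding sP using B by blast
    show "incseq B" unfolding incseq_def B_def by (intro allI impI UN_mono) auto
  qed
  also have "(\<Union>L. B L) = C 0" by (auto simp: B_def C_def)
  finally have "\<forall>\<^sub>F L in sequentially. measure ?P (B L) > 1 - \<epsilon>"
    using \<epsilon> by (intro order_tendstoD(1)) (auto simp: one)
  then obtain L where L: "measure ?P (B L) > 1 - \<epsilon>" by (auto simp: eventually_sequentially)
  have "measure_pmf.prob (block_pmf M X (L + length u)) {xs. \<forall>i<L. take (length u) (drop i xs) \<noteq> u}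
     = measure M {\<omega>\<in>space M. (\<lambda>i. X i \<omega>) \<in> - B L}"
  proof -
    have "take (length u) (drop i (block X (L + length u) \<omega>)) = map (\<lambda>i. X i \<omega>) [i..<i + length u]"
      if "i < L" for i \<omega> using that by (simp add: block_def take_drop_map_upt)
    then have "{\<omega>\<in>space M. block X (L + length u) \<omega> \<in> {xs. \<forall>i<L. take (length u) (drop i xs) \<noteq> u}}
      = {\<omega>\<in>space M. (\<lambda>i. X i \<omega>) \<in> - B L}" by (auto simp: B_def cylinder_def)
    then show ?thesis unfolding prob_block_pmf by (rule arg_cong)
  qed
  also have "\<dots> = measure ?P (- B L)"
    using sets.compl_sets[OF B[of L]]
    by (intro measure_path_law[symmetric]) (simp only: space_seq Compl_eq_Diff_UNIV)
  also have "\<dots> = 1 - measure ?P (B L)"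
  proof -
    have "space ?P = UNIV" by (simp add: path_law_def space_seq)
    with P.prob_compl[of "B L"] B[of L] sP show ?thesis by (simp only: Compl_eq_Diff_UNIV)
  qed
  finally show ?thesis using L by (intro exI[of _ L]) simp
qed

end

section \<open>The rate-distortion function as a limit\<close>

lemma pmf_replicate_pmf:
  "pmf (replicate_pmf (length zs) r) zs = prod_list (map (pmf r) zs)"
proof (induction zs)
  case (Cons z zs)
  have "replicate_pmf (Suc n) r = map_pmf (\<lambda>(x, xs). x # xs) (pair_pmf r (replicate_pmf n r))" for n
    by (simp add: pair_pmf_def map_bind_pmf bind_assoc_pmf bind_return_pmf map_pmf_def)
  moreover have "pmf (map_pmf (\<lambda>(x, xs). x # xs) (pair_pmf r (replicate_pmf (length zs) r))) (z # zs)
      = pmf (pair_pmf r (replicate_pmf (length zs) r)) (z, zs)"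
    using pmf_map_inj'[of "\<lambda>(x, xs). x # xs" "pair_pmf r (replicate_pmf (length zs) r)" "(z, zs)"]
    by (auto simp: inj_def)
  ultimately show ?case using Cons by (simp add: pmf_pair del: replicate_pmf.simps)
qed simp

text \<open>Fekete's lemma: a nearly optimal length \<open>N\<close> is repeated, and the remainder
  contributes a bounded amount.\<close>

lemma subadditive_tendsto_Inf:
  fixes a :: "nat \<Rightarrow> real"
  assumes a0: "\<And>n. 1 \<le> n \<Longrightarrow> 0 \<le> a n"
    and sub: "\<And>m n. 1 \<le> m \<Longrightarrow> 1 \<le> n \<Longrightarrow> a (m + n) \<le> a m + a n"
  shows "(\<lambda>n. a n / n) \<longlonglongrightarrow> (INF n\<in>{1..}. a n / n)"
proof (rule tendstoI)
  fix e :: real assume e: "e > 0"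
  let ?I = "INF n\<in>{1..}. a n / real n"
  have bdd: "bdd_below ((\<lambda>n. a n / real n) ` {1..})"
    using a0 by (intro bdd_belowI[of _ 0]) auto
  have "\<exists>x\<in>(\<lambda>n. a n / real n) ` {1..}. x < ?I + e / 2"
    using e bdd by (intro cInf_lessD) auto
  then obtain N where N: "1 \<le> N" "a N / N < ?I + e / 2" by auto
  have mult: "a (q * N + s) \<le> q * a N + a s" if "1 \<le> s" for q s
  proof (induction q)
    case (Suc q)
    have "a (Suc q * N + s) = a (N + (q * N + s))" by (simp add: add_ac)
    also have "\<dots> \<le> a N + a (q * N + s)" using N that by (intro sub) auto
    finally show ?case using Suc by (simp add: algebra_simps)
  qed simp
  define B where "B = Max (a ` {1..N})"
  have B: "a s \<le> B" if "1 \<le> s" "s \<le> N" for s unfolding B_def using that by (intro Max_ge) auto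
  have B0: "0 \<le> B" using B[of 1] a0[of 1] N by simp
  have up: "a n / n \<le> a N / N + B / n" if n: "1 \<le> n" for n
  proof -
    define q where "q = (n - 1) div N"
    \<comment> \<open>Remainders are taken in \<open>1..N\<close> because nothing is assumed about
      \<open>a 0\<close>.\<close>
    define s where "s = (n - 1) mod N + 1"
    have ns: "n = q * N + s" "1 \<le> s" "s \<le> N"
      using n N div_mult_mod_eq[of "n - 1" N] mod_less_divisor[of N "n - 1"] by (auto simp: q_def s_def Suc_le_eq)
    have "a n \<le> q * a N + a s" using mult[OF ns(2), of q] ns(1) by simp
    also have "\<dots> \<le> q * a N + B" using B ns by simp
    also have "q * a N = (q * N) * (a N / N)" using N by simp
    also have "\<dots> \<le> n * (a N / N)" using ns a0[OF N(1)] by (intro mult_right_mono) (simp_all only: of_nat_mult[symmetric] of_nat_le_iff, auto)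
    finally have "a n \<le> n * (a N / N) + B" by simp
    then have "a n / n \<le> (n * (a N / N) + B) / n" by (intro divide_right_mono) auto
    also have "\<dots> = a N / N + B / n" using n by (simp add: add_divide_distrib)
    finally show ?thesis .
  qed
  have "(\<lambda>n. B / real n) \<longlonglongrightarrow> 0" by real_asymp
  then have "\<forall>\<^sub>F n in sequentially. B / real n < e / 2" using e by (intro order_tendstoD(2)) auto
  then show "\<forall>\<^sub>F n in sequentially. dist (a n / n) ?I < e"
    using eventually_ge_at_top[of "1::nat"]
  proof eventually_elim
    case (elim n)
    have "?I \<le> a n / n" using bdd elim by (intro cINF_lower) auto
    moreover have "a n / n < ?I + e" using up[of n] elim N(2) by linarith
    ultimately show ?case unfolding dist_real_def by linarith
  qed
qed

lemma expectation_affine: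
  fixes f :: "'x \<Rightarrow> real"
  assumes "finite (set_pmf P)"
  shows "expect P (\<lambda>x. a * f x + b) = a * expect P f + b"
  using assms by (simp add: integrable_measure_pmf_finite)

lemma log_pmf_replicate_pmf:
  assumes "\<And>i. i < length zs \<Longrightarrow> 0 < pmf r (zs ! i)"
  shows "0 < pmf (replicate_pmf (length zs) r) zs"
    and "- log 2 (pmf (replicate_pmf (length zs) r) zs) = (\<Sum>i<length zs. - log 2 (pmf r (zs ! i)))"
proof -
  have eq: "pmf (replicate_pmf (length zs) r) zs = (\<Prod>i<length zs. pmf r (zs ! i))"
    by (simp add: pmf_replicate_pmf prod.list_conv_set_nth atLeast0LessThan)
  show "0 < pmf (replicate_pmf (length zs) r) zs" unfolding eq using assms by (intro prod_pos) auto
  show "- log 2 (pmf (replicate_pmf (length zs) r) zs) = (\<Sum>i<length zs. - log 2 (pmf r (zs ! i)))"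
    unfolding eq log_def using assms by (subst ln_prod) (auto simp: sum_negf sum_divide_distrib less_le)
qed

text \<open>Appending a function \<open>z\<close> of the output to the output, with the product law
  as comparison, costs the mean ideal code length of \<open>z\<close> under \<open>R\<close>. It
  prices the corrections made to a channel output.\<close>

lemma kl_graph:
  assumes fin: "finite (set_pmf P)" and sub: "set_pmf P \<subseteq> set_pmf Q"
    and z: "\<And>y. y \<in> set_pmf P \<Longrightarrow> z y \<in> set_pmf R"
  shows "kl (map_pmf (\<lambda>y. (y, z y)) P) (pair_pmf Q R)
    = kl P Q + expect P (\<lambda>y. - log 2 (pmf R (z y)))"
proof -
  have inj: "pmf (map_pmf (\<lambda>y. (y, z y)) P) (y, z y) = pmf P y" for y
    using pmf_map_inj'[of "\<lambda>y. (y, z y)" P y] by (auto simp: inj_def)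
  have "kl (map_pmf (\<lambda>y. (y, z y)) P) (pair_pmf Q R)
     = expect P (\<lambda>y. log 2 (pmf P y / pmf Q y) + - log 2 (pmf R (z y)))"
    unfolding kl_def integral_map_pmf inj pmf_pair
  proof (rule expectation_cong)
    fix y assume "y \<in> set_pmf P"
    then have "pmf P y > 0" "pmf Q y > 0" "pmf R (z y) > 0" using sub z by (auto simp: pmf_positive_iff)
    then show "log 2 (pmf P y / (pmf Q y * pmf R (z y))) = log 2 (pmf P y / pmf Q y) + - log 2 (pmf R (z y))"
      by (simp add: log_divide log_mult)
  qed
  then show ?thesis using fin by (simp add: kl_def integrable_measure_pmf_finite)
qed

section \<open>Test channels and their combination\<close>

locale rate_distortion_problem = stationary_blocks p
  for p :: "nat \<Rightarrow> 'a::finite list pmf" +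
  fixes d :: "'a \<Rightarrow> 'b::finite \<Rightarrow> real"
  assumes d_nonneg: "\<And>x y. 0 \<le> d x y"
begin

definition information :: "nat \<Rightarrow> ('a list \<Rightarrow> 'b list pmf) \<Rightarrow> real" where
  "information n W = mutual_info (joint_pmf (p n) W)"

definition distortion :: "nat \<Rightarrow> ('a list \<Rightarrow> 'b list pmf) \<Rightarrow> real" where
  "distortion n W = expect (p n) (\<lambda>xs. expect (W xs) (dist_n d xs))"

lemma test_channel_length:
  "W \<in> test_channels n \<Longrightarrow> xs \<in> set_pmf (p n) \<Longrightarrow> ys \<in> set_pmf (W xs) \<Longrightarrow> length ys = n"
  using length_block by (auto simp: test_channels_def)

lemma finite_set_test_channel:
  fixes W :: "'a list \<Rightarrow> 'b list pmf"
  shows "W \<in> test_channels n \<Longrightarrow> xs \<in> set_pmf (p n) \<Longrightarrow> finite (set_pmf (W xs))"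
  by (rule finite_subset[OF _ finite_lists_length[of n]]) (auto dest: test_channel_length)

lemma joint_distortion:
  "W \<in> test_channels n \<Longrightarrow>
    expect (joint_pmf (p n) W) (\<lambda>(xs, ys). dist_n d xs ys) = distortion n W"
  unfolding distortion_def by (rule expectation_joint[OF finite_set_block finite_set_test_channel])

lemma information_eq:
  "W \<in> test_channels n \<Longrightarrow>
    information n W = expect (p n) (\<lambda>xs. kl (W xs) (bind_pmf (p n) W))"
  unfolding information_def by (rule mutual_info_joint[OF finite_set_block finite_set_test_channel])

lemma information_le:
  assumes "W \<in> test_channels n" "\<And>xs. xs \<in> set_pmf (p n) \<Longrightarrow> set_pmf (W xs) \<subseteq> set_pmf Q"
  shows "information n W \<le> expect (p n) (\<lambda>xs. kl (W xs) Q)"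
  unfolding information_def by (rule mutual_info_le[OF finite_set_block finite_set_test_channel[OF assms(1)] assms(2)])

lemma information_nonneg: "W \<in> test_channels n \<Longrightarrow> 0 \<le> information n W"
  unfolding information_def by (rule mutual_info_nonneg[OF finite_set_block finite_set_test_channel])

lemma sum_append_dist:
  assumes "length x1 = length y1"
  shows "(\<Sum>i<length (x1 @ x2). d ((x1 @ x2) ! i) ((y1 @ y2) ! i))
     = (\<Sum>i<length x1. d (x1 ! i) (y1 ! i)) + (\<Sum>i<length x2. d (x2 ! i) (y2 ! i))"
proof -
  have "(\<Sum>i<length (x1 @ x2). d ((x1 @ x2) ! i) ((y1 @ y2) ! i))
    = (\<Sum>i\<in>{..<length x1} \<union> {length x1..<length x1 + length x2}. d ((x1 @ x2) ! i) ((y1 @ y2) ! i))"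
    by (intro sum.cong) auto
  also have "\<dots> = (\<Sum>i<length x1. d ((x1 @ x2) ! i) ((y1 @ y2) ! i))
     + (\<Sum>i=length x1..<length x1 + length x2. d ((x1 @ x2) ! i) ((y1 @ y2) ! i))"
    by (rule sum.union_disjoint) auto
  also have "(\<Sum>i<length x1. d ((x1 @ x2) ! i) ((y1 @ y2) ! i)) = (\<Sum>i<length x1. d (x1 ! i) (y1 ! i))"
    using assms by (intro sum.cong) (auto simp: nth_append)
  also have "(\<Sum>i=length x1..<length x1 + length x2. d ((x1 @ x2) ! i) ((y1 @ y2) ! i))
      = (\<Sum>i<length x2. d (x2 ! i) (y2 ! i))"
    using sum.shift_bounds_nat_ivl[of "\<lambda>i. d ((x1 @ x2) ! i) ((y1 @ y2) ! i)" 0 "length x1" "length x2"] assms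
    by (simp add: nth_append lessThan_atLeast0 add.commute)
  finally show ?thesis .
qed

text \<open>The two channels act separately on the two parts of the block. The product of their
  output laws is the comparison law, so dependence between the parts of the source does no harm, and
  stationarity gives each part the correct law.\<close>

lemma concat_channel:
  assumes n: "1 \<le> n" "1 \<le> m" and W1: "W1 \<in> test_channels n" and W2: "W2 \<in> test_channels m"
  obtains W where "W \<in> test_channels (n + m)"
    "information (n + m) W \<le> information n W1 + information m W2"
    "(real n + real m) * distortion (n + m) W = n * distortion n W1 + m * distortion m W2"
proof -
  define W where "W = (\<lambda>xs. map_pmf (\<lambda>(a, b). a @ b) (pair_pmf (W1 (take n xs)) (W2 (drop n xs))))"
  let ?Q1 = "bind_pmf (p n) W1" and ?Q2 = "bind_pmf (p m) W2"
  define Q where "Q = map_pmf (\<lambda>(a, b). a @ b) (pair_pmf ?Q1 ?Q2)"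
  have W: "W \<in> test_channels (n + m)"
    unfolding test_channels_def mem_Collect_eq
  proof (intro allI impI subsetI)
    fix xs :: "'a list" and ys assume "length xs = n + m" "ys \<in> set_pmf (W xs)"
    then obtain a b where "a \<in> set_pmf (W1 (take n xs))" "b \<in> set_pmf (W2 (drop n xs))" "ys = a @ b"
      "length (take n xs) = n" "length (drop n xs) = m" by (auto simp: W_def)
    then show "ys \<in> {ys. length ys = n + m}" using W1 W2 unfolding test_channels_def by fastforce
  qed
  have marg1: "map_pmf (take n) (p (n + m)) = p n" using marginal[of 0 n "n + m"] by simp
  have "map_pmf (\<lambda>xs. take m (drop n xs)) (p (n + m)) = map_pmf (drop n) (p (n + m))"
    by (rule map_pmf_cong[OF refl]) (auto dest: length_block)
  with marginal[of n m "n + m"] have marg2: "map_pmf (drop n) (p (n + m)) = p m" by simp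
  have split: "take n xs \<in> set_pmf (p n)" "drop n xs \<in> set_pmf (p m)" if "xs \<in> set_pmf (p (n + m))" for xs
    using that unfolding marg1[symmetric] marg2[symmetric] by auto
  have fin: "finite (set_pmf (W1 (take n xs)))" "finite (set_pmf (W2 (drop n xs)))"
    if "xs \<in> set_pmf (p (n + m))" for xs
    using finite_set_test_channel[OF W1] finite_set_test_channel[OF W2] split[OF that] by auto
  have sub: "set_pmf (W1 (take n xs)) \<subseteq> set_pmf ?Q1" "set_pmf (W2 (drop n xs)) \<subseteq> set_pmf ?Q2"
    if "xs \<in> set_pmf (p (n + m))" for xs
    using split[OF that] by auto
  have "information (n + m) W \<le> expect (p (n + m)) (\<lambda>xs. kl (W xs) Q)"
  proof (rule information_le[OF W])
    fix xs assume "xs \<in> set_pmf (p (n + m))"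
    from sub[OF this] show "set_pmf (W xs) \<subseteq> set_pmf Q"
      unfolding W_def Q_def set_map_pmf set_pair_pmf by (intro image_mono) auto
  qed
  also have "\<dots> \<le> expect (p (n + m)) (\<lambda>xs. kl (W1 (take n xs)) ?Q1 + kl (W2 (drop n xs)) ?Q2)"
  proof (rule expectation_mono_finite[OF finite_set_block])
    fix xs assume xs: "xs \<in> set_pmf (p (n + m))"
    have "kl (W xs) Q \<le> kl (pair_pmf (W1 (take n xs)) (W2 (drop n xs))) (pair_pmf ?Q1 ?Q2)"
      unfolding W_def Q_def using fin[OF xs] sub[OF xs] by (intro kl_map_le) auto
    also have "\<dots> = kl (W1 (take n xs)) ?Q1 + kl (W2 (drop n xs)) ?Q2"
      using fin[OF xs] sub[OF xs] by (intro kl_pair) auto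
    finally show "kl (W xs) Q \<le> kl (W1 (take n xs)) ?Q1 + kl (W2 (drop n xs)) ?Q2" .
  qed
  also have "\<dots> = expect (map_pmf (take n) (p (n + m))) (\<lambda>xs. kl (W1 xs) ?Q1)
     + expect (map_pmf (drop n) (p (n + m))) (\<lambda>xs. kl (W2 xs) ?Q2)"
    by (simp add: expectation_finite[OF finite_set_block order_refl] sum.distrib distrib_left)
  also have "\<dots> = information n W1 + information m W2"
    unfolding marg1 marg2 by (simp add: information_eq W1 W2)
  finally have I: "information (n + m) W \<le> information n W1 + information m W2" .
  have "(real n + real m) * expect (W xs) (dist_n d xs)
      = n * expect (W1 (take n xs)) (dist_n d (take n xs))
       + m * expect (W2 (drop n xs)) (dist_n d (drop n xs))"
    if xs: "xs \<in> set_pmf (p (n + m))" for xs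
  proof -
    let ?x1 = "take n xs" and ?x2 = "drop n xs"
    have len: "length xs = n + m" "length ?x1 = n" "length ?x2 = m" using length_block[OF xs] by auto
    have "expect (W xs) (dist_n d xs)
        = expect (pair_pmf (W1 ?x1) (W2 ?x2)) (\<lambda>(a, b). dist_n d xs (a @ b))"
      by (simp add: W_def case_prod_unfold)
    also have "\<dots> = expect (W1 ?x1) (\<lambda>a. expect (W2 ?x2) (\<lambda>b. dist_n d xs (a @ b)))"
      using fin[OF xs] by (simp add: pair_pmf_def expectation_bind_finite)
    also have "\<dots> = expect (W1 ?x1) (\<lambda>a. expect (W2 ?x2)
        (\<lambda>b. n / (n + m) * dist_n d ?x1 a + m / (n + m) * dist_n d ?x2 b))"
    proof (intro expectation_cong)
      fix a b assume "a \<in> set_pmf (W1 ?x1)"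
      then have "length a = n" using test_channel_length[OF W1 split(1)[OF xs]] by simp
      then show "dist_n d xs (a @ b) = n / (n + m) * dist_n d ?x1 a + m / (n + m) * dist_n d ?x2 b"
        using sum_append_dist[of ?x1 a ?x2 b] len n by (simp add: dist_n_def add_divide_distrib)
    qed
    also have "\<dots> = expect (W1 ?x1) (\<lambda>a. n / (n + m) * dist_n d ?x1 a
        + m / (n + m) * expect (W2 ?x2) (dist_n d ?x2))"
      by (subst add.commute, subst expectation_affine[OF fin(2)[OF xs]], subst add.commute) (rule refl)
    also have "\<dots> = n / (n + m) * expect (W1 ?x1) (dist_n d ?x1)
        + m / (n + m) * expect (W2 ?x2) (dist_n d ?x2)"
      by (rule expectation_affine[OF fin(1)[OF xs]])
    finally have "expect (W xs) (dist_n d xs)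
        = n / (n + m) * expect (W1 ?x1) (dist_n d ?x1)
        + m / (n + m) * expect (W2 ?x2) (dist_n d ?x2)" .
    moreover have "(real n + real m) * (n / (n + m) * A + m / (n + m) * B) = n * A + m * B" for A B :: real
      using n by (simp add: distrib_left)
    ultimately show ?thesis by (simp only: of_nat_add)
  qed
  note split_dist = this
  have "(real n + real m) * distortion (n + m) W
      = expect (p (n + m)) (\<lambda>xs. (real n + real m) * expect (W xs) (dist_n d xs))"
    unfolding distortion_def by (rule integral_mult_right_zero[symmetric])
  also have "\<dots> = expect (p (n + m))
     (\<lambda>xs. n * expect (W1 (take n xs)) (dist_n d (take n xs))
       + m * expect (W2 (drop n xs)) (dist_n d (drop n xs)))"
    using split_dist by (intro expectation_cong) (simp only: of_nat_add)
  also have "\<dots> = n * expect (p (n + m)) (\<lambda>xs. expect (W1 (take n xs)) (dist_n d (take n xs)))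
     + m * expect (p (n + m)) (\<lambda>xs. expect (W2 (drop n xs)) (dist_n d (drop n xs)))"
    by (simp only: Bochner_Integration.integral_add integrable_measure_pmf_finite finite_set_block integral_mult_right_zero)
  also have "\<dots> = n * expect (map_pmf (take n) (p (n + m))) (\<lambda>xs. expect (W1 xs) (dist_n d xs))
     + m * expect (map_pmf (drop n) (p (n + m))) (\<lambda>xs. expect (W2 xs) (dist_n d xs))"
    unfolding integral_map_pmf ..
  finally have "(real n + real m) * distortion (n + m) W = n * distortion n W1 + m * distortion m W2"
    unfolding marg1 marg2 distortion_def .
  with W I show ?thesis by (rule that)
qed

text \<open>A coin independent of the source selects the channel. Not revealing the coin lowers the
  information, by joint convexity of \<open>kl\<close>.\<close>

lemma mix_channel:
  assumes t: "0 \<le> t" "t \<le> 1" and W1: "W1 \<in> test_channels n" and W2: "W2 \<in> test_channels n"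
  obtains W where "W \<in> test_channels n"
    "information n W \<le> (1 - t) * information n W1 + t * information n W2"
    "distortion n W = (1 - t) * distortion n W1 + t * distortion n W2"
proof -
  let ?b = "bernoulli_pmf t"
  define W where "W = (\<lambda>xs. bind_pmf ?b (\<lambda>c. if c then W2 xs else W1 xs))"
  let ?Q1 = "bind_pmf (p n) W1" and ?Q2 = "bind_pmf (p n) W2"
  define Q where "Q = bind_pmf ?b (\<lambda>c. if c then ?Q2 else ?Q1)"
  have W: "W \<in> test_channels n"
    using W1 W2 by (fastforce simp: test_channels_def W_def split: if_splits)
  have fb: "finite (set_pmf ?b)" by (rule finite_subset[of _ UNIV]) auto
  have eb: "expect ?b h = (1 - t) * h False + t * h True" for h :: "bool \<Rightarrow> real"
    using t by (subst expectation_finite[of UNIV]) (auto simp: UNIV_bool)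
  have "information n W \<le> expect (p n) (\<lambda>xs. kl (W xs) Q)"
  proof (rule information_le[OF W])
    fix xs assume xs: "xs \<in> set_pmf (p n)"
    show "set_pmf (W xs) \<subseteq> set_pmf Q"
    proof
      fix ys assume "ys \<in> set_pmf (W xs)"
      then obtain c where c: "c \<in> set_pmf ?b" "ys \<in> set_pmf (if c then W2 xs else W1 xs)"
        unfolding W_def set_bind_pmf by blast
      then have "ys \<in> set_pmf (if c then ?Q2 else ?Q1)" using xs by (cases c) auto
      with c(1) show "ys \<in> set_pmf Q" unfolding Q_def set_bind_pmf by blast
    qed
  qed
  also have "\<dots> \<le> expect (p n) (\<lambda>xs. (1 - t) * kl (W1 xs) ?Q1 + t * kl (W2 xs) ?Q2)"
  proof (rule expectation_mono_finite[OF finite_set_block])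
    fix xs assume xs: "xs \<in> set_pmf (p n)"
    have "kl (W xs) Q \<le> expect ?b (\<lambda>c. kl (if c then W2 xs else W1 xs) (if c then ?Q2 else ?Q1))"
      unfolding W_def Q_def
      using fb finite_set_test_channel[OF W1 xs] finite_set_test_channel[OF W2 xs] xs
      by (intro kl_bind_le) auto
    then show "kl (W xs) Q \<le> (1 - t) * kl (W1 xs) ?Q1 + t * kl (W2 xs) ?Q2" by (simp add: eb)
  qed
  also have "\<dots> = (1 - t) * information n W1 + t * information n W2"
    by (simp add: information_eq W1 W2 integrable_measure_pmf_finite finite_set_block)
  finally have I: "information n W \<le> (1 - t) * information n W1 + t * information n W2" .
  have "distortion n W = expect (p n) (\<lambda>xs. (1 - t) * expect (W1 xs) (dist_n d xs)
     + t * expect (W2 xs) (dist_n d xs))"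
    unfolding distortion_def
  proof (rule expectation_cong)
    fix xs assume xs: "xs \<in> set_pmf (p n)"
    show "expect (W xs) (dist_n d xs) = (1 - t) * expect (W1 xs) (dist_n d xs)
     + t * expect (W2 xs) (dist_n d xs)"
      unfolding W_def using fb finite_set_test_channel[OF W1 xs] finite_set_test_channel[OF W2 xs]
      by (subst expectation_bind_finite) (auto simp: eb)
  qed
  also have "\<dots> = (1 - t) * distortion n W1 + t * distortion n W2"
    by (simp add: distortion_def integrable_measure_pmf_finite finite_set_block)
  finally show ?thesis using W I that by blast
qed

section \<open>The smallest feasible distortion\<close>

definition min_dist :: "'a \<Rightarrow> real" where
  "min_dist x = Min (range (d x))"

definition best :: "'a \<Rightarrow> 'b" where
  "best x = (SOME y. d x y = min_dist x)"

lemma min_dist_le: "min_dist x \<le> d x y"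
  unfolding min_dist_def by (intro Min_le) auto

lemma d_best: "d x (best x) = min_dist x"
proof -
  have "min_dist x \<in> range (d x)" unfolding min_dist_def by (intro Min_in) auto
  then have "\<exists>y. d x y = min_dist x" by force
  then show ?thesis unfolding best_def by (rule someI_ex)
qed

lemma min_dist_nonneg: "0 \<le> min_dist x" using d_nonneg[of x "best x"] d_best by simp

definition D_min :: real where
  "D_min = expect (p 1) (\<lambda>xs. min_dist (xs ! 0))"

lemma D_min_nonneg: "0 \<le> D_min"
  unfolding D_min_def by (intro expectation_ge_const finite_set_block min_dist_nonneg)

lemma expectation_letter:
  fixes f :: "'a \<Rightarrow> real"
  assumes "i < n"
  shows "expect (p n) (\<lambda>xs. f (xs ! i)) = expect (p 1) (\<lambda>xs. f (xs ! 0))"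
proof -
  have "expect (p n) (\<lambda>xs. f (xs ! i))
      = expect (p n) (\<lambda>xs. f (take 1 (drop i xs) ! 0))"
    using assms by (intro expectation_cong) (auto dest: length_block)
  also have "\<dots> = expect (p 1) (\<lambda>xs. f (xs ! 0))"
    using assms by (intro expectation_marginal) auto
  finally show ?thesis .
qed

lemma expectation_average_letter:
  fixes f :: "'a \<Rightarrow> real"
  assumes "1 \<le> n"
  shows "expect (p n) (\<lambda>xs. (\<Sum>i<n. f (xs ! i)) / n) = expect (p 1) (\<lambda>xs. f (xs ! 0))"
proof -
  have "expect (p n) (\<lambda>xs. (\<Sum>i<n. f (xs ! i)) / n)
     = (\<Sum>i<n. expect (p n) (\<lambda>xs. f (xs ! i))) / n"
    by (simp add: integrable_measure_pmf_finite finite_set_block)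
  also have "(\<Sum>i<n. expect (p n) (\<lambda>xs. f (xs ! i)))
     = (\<Sum>i<n. expect (p 1) (\<lambda>xs. f (xs ! 0)))"
    by (intro sum.cong refl expectation_letter) auto
  finally show ?thesis using assms by simp
qed

lemma D_min_le:
  assumes "1 \<le> n" "W \<in> test_channels n"
  shows "D_min \<le> distortion n W"
proof -
  have "D_min = expect (p n) (\<lambda>xs. (\<Sum>i<n. min_dist (xs ! i)) / n)"
    using expectation_average_letter[OF assms(1), of min_dist] by (simp add: D_min_def)
  also have "\<dots> \<le> distortion n W"
    unfolding distortion_def
  proof (intro expectation_mono_finite finite_set_block expectation_ge_const)
    fix xs ys assume "xs \<in> set_pmf (p n)"
    then show "finite (set_pmf (W xs))" "(\<Sum>i<n. min_dist (xs ! i)) / n \<le> dist_n d xs ys"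
      using finite_set_test_channel[OF assms(2)] length_block
      by (auto simp: dist_n_def intro!: divide_right_mono sum_mono min_dist_le)
  qed
  finally show ?thesis .
qed


text \<open>Every letter of the output that is not optimal is replaced by \<open>best\<close>. The
  repaired word is a function of the old output and of the list of replacements, so the information
  grows by at most the description length of that list. By the gap, the mean fraction of
  replacements is at most the excess distortion divided by \<open>\<delta>\<close>.\<close>

lemma optimal_channel:
  assumes n: "1 \<le> n" and W: "W \<in> test_channels n" and \<eta>: "0 < \<eta>" "\<eta> < 1" and \<delta>: "0 < \<delta>"
    and gap: "\<And>x y. d x y \<noteq> min_dist x \<Longrightarrow> min_dist x + \<delta> \<le> d x y"
  obtains W' where "W' \<in> test_channels n" "distortion n W' = D_min"
    "information n W' \<le> information n W
       + n * ((distortion n W - D_min) / \<delta> * log 2 (CARD('b) / \<eta>) - log 2 (1 - \<eta>))"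
proof -
  define h where "h = (\<lambda>x y. if d x y = min_dist x then y else best x)"
  define g where "g = (\<lambda>x y. if d x y = min_dist x then None else Some (best x))"
  define z where "z = (\<lambda>xs ys. map2 g xs ys)"
  define u :: "'b \<times> 'b option \<Rightarrow> 'b" where "u = (\<lambda>(y, z). case z of None \<Rightarrow> y | Some b \<Rightarrow> b)"
  define comb where "comb = (\<lambda>(ys, zs). map u (zip ys zs))"
  define W' where "W' = (\<lambda>xs. map_pmf (\<lambda>ys. comb (ys, z xs ys)) (W xs))"
  \<comment> \<open>The law used to describe one correction: \<open>None\<close> keeps the letter
    and has probability about \<open>1 - \<eta>\<close>, each replacement gets at least
    \<open>\<eta> / CARD('b)\<close>.\<close>
  define r :: "'b option pmf" where
    "r = bind_pmf (bernoulli_pmf \<eta>) (\<lambda>c. if c then map_pmf Some (pmf_of_set UNIV) else return_pmf None)"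
  define Q where "Q = bind_pmf (p n) W"
  define Rn where "Rn = replicate_pmf n r"
  let ?LB = "log 2 (CARD('b) / \<eta>)"
  have LB: "?LB \<ge> 0"
  proof -
    have "1 \<le> real CARD('b)" by (simp add: Suc_le_eq)
    then have "\<eta> \<le> real CARD('b)" using \<eta> by linarith
    then show ?thesis using \<eta> by (simp add: le_divide_eq)
  qed
  have rN: "1 - \<eta> \<le> pmf r None"
    using pmf_bind_ge[of "bernoulli_pmf \<eta>" False "\<lambda>c. if c then map_pmf Some (pmf_of_set UNIV) else return_pmf None" None] \<eta>
    by (simp add: r_def)
  have rS: "\<eta> / CARD('b) \<le> pmf r (Some b)" for b
    using pmf_bind_ge[of "bernoulli_pmf \<eta>" True "\<lambda>c. if c then map_pmf Some (pmf_of_set UNIV) else return_pmf None" "Some b"] \<eta>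
      pmf_map_inj'[of Some "pmf_of_set (UNIV :: 'b set)" b]
    by (simp add: r_def)
  have rpos: "pmf r w > 0" for w
    using rN rS \<eta> by (cases w) (auto intro: less_le_trans[of 0 "\<eta> / CARD('b)"])
  \<comment> \<open>A replacement costs at most \<open>?LB\<close> and occurs only where the excess
    is at least \<open>\<delta>\<close>, so the excess itself pays for it; a kept letter costs
    \<open>- log 2 (1 - \<eta>)\<close>.\<close>
  have rlog: "- log 2 (pmf r (g x y)) \<le> (d x y - min_dist x) / \<delta> * ?LB - log 2 (1 - \<eta>)" for x y
  proof (cases "d x y = min_dist x")
    case True
    then show ?thesis using rN \<eta> by (simp add: g_def)
  next
    case False
    have "log 2 (\<eta> / CARD('b)) \<le> log 2 (pmf r (g x y))" using rS \<eta> rpos by (simp add: g_def False)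
    then have "- log 2 (pmf r (g x y)) \<le> ?LB" using \<eta> by (simp add: log_divide)
    also have "\<dots> \<le> (d x y - min_dist x) / \<delta> * ?LB"
      using gap[OF False] \<delta> LB mult_right_mono[of 1 "(d x y - min_dist x) / \<delta>" ?LB] by (simp add: le_divide_eq)
    also have "\<dots> \<le> (d x y - min_dist x) / \<delta> * ?LB - log 2 (1 - \<eta>)" using \<eta> by simp
    finally show ?thesis .
  qed
  have len: "length (z xs ys) = n" "length (comb (ys, z xs ys)) = n"
    if "length xs = n" "length ys = n" for xs ys
    using that by (auto simp: z_def comb_def)
  have nth_comb: "comb (ys, z xs ys) ! i = h (xs ! i) (ys ! i)"
    if "length xs = n" "length ys = n" "i < n" for xs ys i
    using that by (simp add: z_def comb_def u_def g_def h_def)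
  have W': "W' \<in> test_channels n"
    using W len(2) by (auto simp: test_channels_def W'_def)
  have "distortion n W' = expect (p n) (\<lambda>xs. (\<Sum>i<n. min_dist (xs ! i)) / n)"
    unfolding distortion_def
  proof (rule expectation_cong)
    fix xs assume xs: "xs \<in> set_pmf (p n)"
    have "expect (W' xs) (dist_n d xs) = expect (W xs) (\<lambda>ys. dist_n d xs (comb (ys, z xs ys)))"
      by (simp add: W'_def)
    also have "\<dots> = expect (W xs) (\<lambda>ys. (\<Sum>i<n. min_dist (xs ! i)) / n)"
    proof (rule expectation_cong)
      fix ys assume "ys \<in> set_pmf (W xs)"
      then have "length ys = n" by (rule test_channel_length[OF W xs])
      then show "dist_n d xs (comb (ys, z xs ys)) = (\<Sum>i<n. min_dist (xs ! i)) / n"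
        using length_block[OF xs] by (auto simp: dist_n_def nth_comb h_def d_best intro!: sum.cong)
    qed
    finally show "expect (W' xs) (dist_n d xs) = (\<Sum>i<n. min_dist (xs ! i)) / n" by simp
  qed
  also have "\<dots> = D_min" using expectation_average_letter[OF n, of min_dist] by (simp add: D_min_def)
  finally have dist: "distortion n W' = D_min" .
  have zR: "0 < pmf Rn (z xs ys)"
    "- log 2 (pmf Rn (z xs ys)) \<le> n * ((dist_n d xs ys - (\<Sum>i<n. min_dist (xs ! i)) / n) / \<delta> * ?LB - log 2 (1 - \<eta>))"
    if l: "length xs = n" "length ys = n" for xs ys
  proof -
    note lr = log_pmf_replicate_pmf[of "z xs ys" r, OF rpos, unfolded len(1)[OF l], folded Rn_def]
    show "0 < pmf Rn (z xs ys)" by (rule lr(1))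
    have "- log 2 (pmf Rn (z xs ys)) = (\<Sum>i<n. - log 2 (pmf r (g (xs ! i) (ys ! i))))"
      unfolding lr(2) using l by (intro sum.cong) (auto simp: z_def)
    also have "\<dots> \<le> (\<Sum>i<n. (d (xs ! i) (ys ! i) - min_dist (xs ! i)) / \<delta> * ?LB - log 2 (1 - \<eta>))"
      by (intro sum_mono rlog)
    also have "\<dots> = ((\<Sum>i<n. d (xs ! i) (ys ! i)) - (\<Sum>i<n. min_dist (xs ! i))) / \<delta> * ?LB - n * log 2 (1 - \<eta>)"
      by (simp add: sum_subtractf sum_divide_distrib[symmetric] sum_distrib_right[symmetric])
    also have "\<dots> = n * ((dist_n d xs ys - (\<Sum>i<n. min_dist (xs ! i)) / n) / \<delta> * ?LB - log 2 (1 - \<eta>))"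
    proof -
      have "n * ((A / n - B / n) / \<delta> * L - c) = (A - B) / \<delta> * L - n * c" for A B L c :: real
        using n unfolding diff_divide_distrib[symmetric] right_diff_distrib by simp
      then show ?thesis using l by (simp only: dist_n_def)
    qed
    finally show "- log 2 (pmf Rn (z xs ys)) \<le> n * ((dist_n d xs ys - (\<Sum>i<n. min_dist (xs ! i)) / n) / \<delta> * ?LB - log 2 (1 - \<eta>))" .
  qed
  have sub: "set_pmf (W xs) \<subseteq> set_pmf Q" if "xs \<in> set_pmf (p n)" for xs
    using that by (auto simp: Q_def)
  have zset: "z xs ys \<in> set_pmf Rn" if "xs \<in> set_pmf (p n)" "ys \<in> set_pmf (W xs)" for xs ys
    using zR(1)[OF length_block[OF that(1)] test_channel_length[OF W that]] by (simp add: pmf_positive_iff)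
  let ?Q' = "map_pmf comb (pair_pmf Q Rn)"
  have W'_eq: "W' xs = map_pmf comb (map_pmf (\<lambda>ys. (ys, z xs ys)) (W xs))" for xs
    by (simp add: W'_def map_pmf_comp)
  have "information n W' \<le> expect (p n) (\<lambda>xs. kl (W' xs) ?Q')"
  proof (rule information_le[OF W'])
    fix xs assume xs: "xs \<in> set_pmf (p n)"
    show "set_pmf (W' xs) \<subseteq> set_pmf ?Q'"
      unfolding W'_eq set_map_pmf[of comb] set_pair_pmf using sub[OF xs] zset[OF xs] by (intro image_mono) auto
  qed
  also have "\<dots> \<le> expect (p n) (\<lambda>xs. kl (W xs) Q
      + n * ((expect (W xs) (dist_n d xs) - (\<Sum>i<n. min_dist (xs ! i)) / n) / \<delta> * ?LB - log 2 (1 - \<eta>)))"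
  proof (rule expectation_mono_finite[OF finite_set_block])
    fix xs assume xs: "xs \<in> set_pmf (p n)"
    note fin = finite_set_test_channel[OF W xs]
    have "kl (W' xs) ?Q' \<le> kl (map_pmf (\<lambda>ys. (ys, z xs ys)) (W xs)) (pair_pmf Q Rn)"
      unfolding W'_eq using fin sub[OF xs] zset[OF xs] by (intro kl_map_le) auto
    also have "\<dots> = kl (W xs) Q + expect (W xs) (\<lambda>ys. - log 2 (pmf Rn (z xs ys)))"
      using fin sub[OF xs] zset[OF xs] by (intro kl_graph) auto
    also have "expect (W xs) (\<lambda>ys. - log 2 (pmf Rn (z xs ys)))
       \<le> expect (W xs) (\<lambda>ys. n * ((dist_n d xs ys - (\<Sum>i<n. min_dist (xs ! i)) / n) / \<delta> * ?LB - log 2 (1 - \<eta>)))"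
      using length_block[OF xs] test_channel_length[OF W xs] by (intro expectation_mono_finite fin zR) auto
    also have "\<dots> = n * ((expect (W xs) (dist_n d xs) - (\<Sum>i<n. min_dist (xs ! i)) / n) / \<delta> * ?LB - log 2 (1 - \<eta>))"
      using fin by (simp add: integrable_measure_pmf_finite)
    finally show "kl (W' xs) ?Q' \<le> kl (W xs) Q
      + n * ((expect (W xs) (dist_n d xs) - (\<Sum>i<n. min_dist (xs ! i)) / n) / \<delta> * ?LB - log 2 (1 - \<eta>))"
      by simp
  qed
  also have "\<dots> = information n W + n * ((distortion n W
      - expect (p n) (\<lambda>xs. (\<Sum>i<n. min_dist (xs ! i)) / n)) / \<delta> * ?LB - log 2 (1 - \<eta>))"
  proof -
    have "expect (p n) (\<lambda>xs. k xs + n * ((a xs - b xs) / \<delta> * ?LB - log 2 (1 - \<eta>)))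
      = expect (p n) k
        + n * ((expect (p n) a - expect (p n) b) / \<delta> * ?LB - log 2 (1 - \<eta>))"
      for k a b :: "'a list \<Rightarrow> real"
      by (simp add: integrable_measure_pmf_finite finite_set_block)
    then show ?thesis unfolding distortion_def information_eq[OF W] Q_def .
  qed
  also have "expect (p n) (\<lambda>xs. (\<Sum>i<n. min_dist (xs ! i)) / n) = D_min"
    using expectation_average_letter[OF n, of min_dist] by (simp add: D_min_def)
  finally show ?thesis using W' dist that by blast
qed

text \<open>Finitely many pairs of letters have a least positive excess; the inserted
  \<open>1\<close> serves when there is none.\<close>

lemma gap_exists:
  obtains \<delta> where "0 < \<delta>" "\<And>x y. d x y \<noteq> min_dist x \<Longrightarrow> min_dist x + \<delta> \<le> d x y"
proof -
  let ?S = "insert 1 ((\<lambda>(x, y). d x y - min_dist x) ` {(x, y). d x y \<noteq> min_dist x})"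
  have fin: "finite ?S" by (intro finite.insertI finite_imageI finite)
  have "0 < Min ?S"
  proof (subst Min_gr_iff[OF fin])
    have "0 < d x y - min_dist x" if "d x y \<noteq> min_dist x" for x y
      using min_dist_le[of x y] that by simp
    then show "\<forall>a\<in>?S. 0 < a" by auto
  qed blast
  moreover have "min_dist x + Min ?S \<le> d x y" if "d x y \<noteq> min_dist x" for x y
  proof -
    have "d x y - min_dist x \<in> ?S" using that by (intro insertI2 image_eqI[of _ _ "(x, y)"]) simp_all
    from Min_le[OF fin this] show ?thesis by linarith
  qed
  ultimately show ?thesis by (rule that)
qed

section \<open>The rate function: limit, convexity and minimum of the Lagrangian\<close>

definition feasible :: "nat \<Rightarrow> real \<Rightarrow> ('a list \<Rightarrow> 'b list pmf) set" where
  "feasible n D = {W \<in> test_channels n. distortion n W \<le> D}"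

text \<open>Real valued, hence meaningful from \<open>D_min\<close> on; below it no channel is
  feasible and the extended real version is infinite.\<close>

definition rate_n :: "nat \<Rightarrow> real \<Rightarrow> real" where
  "rate_n n D = (INF W\<in>feasible n D. information n W / n)"

text \<open>An infimum over the block lengths, equal to the limit by subadditivity, which also
  bounds it by each \<open>rate_n\<close>.\<close>

definition rate :: "real \<Rightarrow> real" where
  "rate D = (INF n\<in>{1..}. rate_n n D)"

lemma feasible_nonempty: "1 \<le> n \<Longrightarrow> D_min \<le> D \<Longrightarrow> feasible n D \<noteq> {}"
proof -
  assume n: "1 \<le> n" and D: "D_min \<le> D"
  define W :: "'a list \<Rightarrow> 'b list pmf" where "W = (\<lambda>xs. return_pmf (replicate (length xs) undefined))"
  have W: "W \<in> test_channels n" by (auto simp: test_channels_def W_def)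
  obtain \<delta> where \<delta>: "0 < \<delta>" "\<And>x y. d x y \<noteq> min_dist x \<Longrightarrow> min_dist x + \<delta> \<le> d x y" by (rule gap_exists) blast
  obtain W' where "W' \<in> test_channels n" "distortion n W' = D_min"
    by (rule optimal_channel[OF n W, of "1/2" \<delta>]) (use \<delta> in auto)
  then show ?thesis using D by (auto simp: feasible_def)
qed

lemma bdd_below_information: "bdd_below ((\<lambda>W. information n W / n) ` feasible n D)"
  by (intro bdd_belowI[of _ 0]) (auto simp: feasible_def information_nonneg)

lemma rate_n_le: "W \<in> test_channels n \<Longrightarrow> distortion n W \<le> D \<Longrightarrow> rate_n n D \<le> information n W / n"
  unfolding rate_n_def by (intro cINF_lower bdd_below_information) (simp add: feasible_def)

lemma rate_n_nonneg: "1 \<le> n \<Longrightarrow> D_min \<le> D \<Longrightarrow> 0 \<le> rate_n n D"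
  unfolding rate_n_def by (intro cINF_greatest feasible_nonempty) (auto simp: feasible_def information_nonneg)

lemma rate_n_approx:
  assumes "1 \<le> n" "D_min \<le> D" "0 < e"
  obtains W where "W \<in> test_channels n" "distortion n W \<le> D" "information n W / n < rate_n n D + e"
proof -
  have "\<exists>x\<in>(\<lambda>W. information n W / n) ` feasible n D. x < rate_n n D + e"
    unfolding rate_n_def using assms feasible_nonempty bdd_below_information by (intro cInf_lessD) auto
  then show ?thesis using that by (auto simp: feasible_def)
qed

lemma rate_n_subadditive:
  assumes n: "1 \<le> n" "1 \<le> m" and D: "D_min \<le> D"
  shows "real (n + m) * rate_n (n + m) D \<le> n * rate_n n D + m * rate_n m D"
proof (rule field_le_epsilon)
  fix e :: real assume e: "0 < e"
  define e' where "e' = e / (n + m)"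
  have e': "0 < e'" using e n by (simp add: e'_def)
  obtain W1 where W1: "W1 \<in> test_channels n" "distortion n W1 \<le> D" "information n W1 / n < rate_n n D + e'"
    using rate_n_approx[OF n(1) D e'] .
  obtain W2 where W2: "W2 \<in> test_channels m" "distortion m W2 \<le> D" "information m W2 / m < rate_n m D + e'"
    using rate_n_approx[OF n(2) D e'] .
  obtain W where W: "W \<in> test_channels (n + m)" "information (n + m) W \<le> information n W1 + information m W2"
    "(real n + real m) * distortion (n + m) W = n * distortion n W1 + m * distortion m W2"
    using concat_channel[OF n W1(1) W2(1)] .
  have "(real n + real m) * distortion (n + m) W \<le> n * D + m * D"
    unfolding W(3) using W1(2) W2(2) by (intro add_mono mult_left_mono) auto
  also have "\<dots> = (real n + real m) * D" by (simp add: algebra_simps)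
  finally have "distortion (n + m) W \<le> D" using n by (subst (asm) mult_le_cancel_left_pos) auto
  then have "rate_n (n + m) D \<le> information (n + m) W / real (n + m)" by (rule rate_n_le[OF W(1)])
  then have "real (n + m) * rate_n (n + m) D \<le> information (n + m) W" using n by (simp add: field_simps)
  also have "\<dots> \<le> information n W1 + information m W2" by (rule W(2))
  also have "\<dots> \<le> n * (rate_n n D + e') + m * (rate_n m D + e')"
    using W1(3) W2(3) n by (intro add_mono) (simp_all add: field_simps)
  also have "\<dots> = n * rate_n n D + m * rate_n m D + (n + m) * e'" by (simp add: algebra_simps)
  also have "(n + m) * e' = e" using n by (simp add: e'_def)
  finally show "real (n + m) * rate_n (n + m) D \<le> n * rate_n n D + m * rate_n m D + e" .
qed

lemma rate_n_tendsto:
  assumes D: "D_min \<le> D"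
  shows "(\<lambda>n. rate_n n D) \<longlonglongrightarrow> rate D"
proof -
  have "(\<lambda>n. real n * rate_n n D / n) \<longlonglongrightarrow> (INF n\<in>{1..}. real n * rate_n n D / n)"
    using rate_n_nonneg[OF _ D] rate_n_subadditive[OF _ _ D]
    by (intro subadditive_tendsto_Inf) (auto simp del: of_nat_add)
  moreover have "(INF n\<in>{1..}. real n * rate_n n D / n) = rate D"
    unfolding rate_def by (intro INF_cong) auto
  moreover have "\<forall>\<^sub>F n in sequentially. real n * rate_n n D / n = rate_n n D"
    using eventually_ge_at_top[of "1::nat"] by eventually_elim simp
  ultimately show ?thesis using Lim_transform_eventually by fastforce
qed

lemma rate_le_rate_n: "1 \<le> n \<Longrightarrow> D_min \<le> D \<Longrightarrow> rate D \<le> rate_n n D"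
  unfolding rate_def by (intro cINF_lower bdd_belowI[of _ 0]) (auto simp: rate_n_nonneg)

lemma rate_nonneg: "D_min \<le> D \<Longrightarrow> 0 \<le> rate D"
  unfolding rate_def by (intro cINF_greatest) (auto simp: rate_n_nonneg)

lemma rate_n_antimono: "1 \<le> n \<Longrightarrow> D_min \<le> D \<Longrightarrow> D \<le> D' \<Longrightarrow> rate_n n D' \<le> rate_n n D"
  unfolding rate_n_def
  by (intro cINF_superset_mono feasible_nonempty bdd_below_information) (auto simp: feasible_def)

lemma rate_antimono: "D_min \<le> D \<Longrightarrow> D \<le> D' \<Longrightarrow> rate D' \<le> rate D"
  by (rule LIMSEQ_le[OF rate_n_tendsto rate_n_tendsto]) (auto intro!: exI[of _ 1] rate_n_antimono)

lemma rate_n_convex: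
  assumes n: "1 \<le> n" and D: "D_min \<le> D1" "D_min \<le> D2" and t: "0 \<le> t" "t \<le> 1"
  shows "rate_n n ((1 - t) * D1 + t * D2) \<le> (1 - t) * rate_n n D1 + t * rate_n n D2"
proof (rule field_le_epsilon)
  fix e :: real assume e: "0 < e"
  obtain W1 where W1: "W1 \<in> test_channels n" "distortion n W1 \<le> D1" "information n W1 / n < rate_n n D1 + e"
    using rate_n_approx[OF n D(1) e] .
  obtain W2 where W2: "W2 \<in> test_channels n" "distortion n W2 \<le> D2" "information n W2 / n < rate_n n D2 + e"
    using rate_n_approx[OF n D(2) e] .
  obtain W where W: "W \<in> test_channels n" "information n W \<le> (1 - t) * information n W1 + t * information n W2"
    "distortion n W = (1 - t) * distortion n W1 + t * distortion n W2"
    using mix_channel[OF t W1(1) W2(1)] .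
  have "distortion n W \<le> (1 - t) * D1 + t * D2"
    unfolding W(3) using W1(2) W2(2) t by (intro add_mono mult_left_mono) auto
  then have "rate_n n ((1 - t) * D1 + t * D2) \<le> information n W / n" by (rule rate_n_le[OF W(1)])
  also have "\<dots> \<le> ((1 - t) * information n W1 + t * information n W2) / n"
    using W(2) by (rule divide_right_mono) simp
  also have "\<dots> = (1 - t) * (information n W1 / n) + t * (information n W2 / n)" by (simp add: add_divide_distrib)
  also have "\<dots> \<le> (1 - t) * (rate_n n D1 + e) + t * (rate_n n D2 + e)"
    using W1(3) W2(3) t by (intro add_mono mult_left_mono) auto
  finally show "rate_n n ((1 - t) * D1 + t * D2) \<le> (1 - t) * rate_n n D1 + t * rate_n n D2 + e"
    by (simp add: algebra_simps)
qed

lemma rate_convex: "convex_on {D_min..} rate"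
proof (rule convex_onI)
  fix t x y :: real assume t: "0 < t" "t < 1" and xy: "x \<in> {D_min..}" "y \<in> {D_min..}"
  have "D_min \<le> (1 - t) * x + t * y"
    using xy t convexD[of "{D_min..}" x y "1 - t" t] by (simp add: convex_real_interval)
  then have "rate ((1 - t) * x + t * y) \<le> (1 - t) * rate x + t * rate y"
    using xy t by (intro LIMSEQ_le[OF rate_n_tendsto tendsto_add[OF tendsto_mult_left[OF rate_n_tendsto] tendsto_mult_left[OF rate_n_tendsto]]])
      (auto intro!: exI[of _ 1] rate_n_convex)
  then show "rate ((1 - t) *\<^sub>R x + t *\<^sub>R y) \<le> (1 - t) * rate x + t * rate y" by simp
qed (simp add: convex_real_interval)

text \<open>Convexity gives continuity only in the interior of the domain. At the left end, nearly
  optimal channels for \<open>D\<close> are repaired to distortion \<open>D_min\<close>; for fixed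
  \<eta> the cost tends to \<open>- log 2 (1 - \<eta>)\<close> as \<open>D\<close> falls to
  \<open>D_min\<close>.\<close>

lemma rate_D_min_le:
  assumes \<delta>: "0 < \<delta>" "\<And>x y. d x y \<noteq> min_dist x \<Longrightarrow> min_dist x + \<delta> \<le> d x y"
    and \<eta>: "0 < \<eta>" "\<eta> < 1" and D: "D_min \<le> D"
  shows "rate D_min \<le> rate D + ((D - D_min) / \<delta> * log 2 (CARD('b) / \<eta>) - log 2 (1 - \<eta>))"
proof -
  have LB: "log 2 (CARD('b) / \<eta>) \<ge> 0"
  proof -
    have "1 \<le> real CARD('b)" by (simp add: Suc_le_eq)
    then have "\<eta> \<le> real CARD('b)" using \<eta> by linarith
    then show ?thesis using \<eta> by (simp add: le_divide_eq)
  qed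
  let ?c = "(D - D_min) / \<delta> * log 2 (CARD('b) / \<eta>) - log 2 (1 - \<eta>)"
  have "rate D_min - ?c \<le> rate_n n D" if n: "1 \<le> n" for n
    unfolding rate_n_def
  proof (rule cINF_greatest[OF feasible_nonempty[OF n D]])
    fix W assume "W \<in> feasible n D"
    then have W: "W \<in> test_channels n" "distortion n W \<le> D" by (auto simp: feasible_def)
    obtain W' where W': "W' \<in> test_channels n" "distortion n W' = D_min" "information n W' \<le> information n W
       + n * ((distortion n W - D_min) / \<delta> * log 2 (CARD('b) / \<eta>) - log 2 (1 - \<eta>))"
      using optimal_channel[OF n W(1) \<eta> \<delta>(1) \<delta>(2)] by blast
    have "(distortion n W - D_min) / \<delta> * log 2 (CARD('b) / \<eta>) - log 2 (1 - \<eta>) \<le> ?c"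
      using W(2) \<delta>(1) LB by (intro diff_mono mult_right_mono divide_right_mono) auto
    then have "n * ((distortion n W - D_min) / \<delta> * log 2 (CARD('b) / \<eta>) - log 2 (1 - \<eta>)) \<le> n * ?c"
      by (rule mult_left_mono) simp
    with W'(3) have "information n W' \<le> information n W + n * ?c" by linarith
    then have "information n W' / n \<le> (information n W + n * ?c) / n" by (rule divide_right_mono) simp
    also have "\<dots> = information n W / n + ?c" using n by (simp add: add_divide_distrib)
    finally have *: "information n W' / n \<le> information n W / n + ?c" .
    have "rate D_min \<le> rate_n n D_min" by (rule rate_le_rate_n[OF n order_refl])
    also have "\<dots> \<le> information n W' / n" using W' by (intro rate_n_le) auto
    also note *
    finally show "rate D_min - ?c \<le> information n W / n" by simp
  qed
  then have "rate D_min - ?c \<le> rate D" unfolding rate_def[of D] by (intro cINF_greatest) auto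
  then show ?thesis by simp
qed

lemma continuous_on_rate: "continuous_on {D_min..B} rate"
  unfolding continuous_on_eq_continuous_within
proof
  fix x assume x: "x \<in> {D_min..B}"
  show "continuous (at x within {D_min..B}) rate"
  proof (cases "x = D_min")
    case False
    have "continuous_on {D_min<..} rate"
      by (rule convex_on_continuous[OF open_greaterThan convex_on_subset[OF rate_convex]]) auto
    then have "isCont rate x" using x False by (subst (asm) continuous_on_eq_continuous_at) auto
    then show ?thesis by (rule continuous_at_imp_continuous_within)
  next
    case True
    obtain \<delta> where \<delta>: "0 < \<delta>" "\<And>x y. d x y \<noteq> min_dist x \<Longrightarrow> min_dist x + \<delta> \<le> d x y" by (rule gap_exists) blast
    show ?thesis unfolding continuous_within True
    proof (rule tendstoI)
      fix e :: real assume e: "e > 0"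
      \<comment> \<open>Makes \<open>- log 2 (1 - \<eta>)\<close> equal to \<open>e / 2\<close>; the
        distance of \<open>D\<close> from \<open>D_min\<close> accounts for the other half.\<close>
      define \<eta> where "\<eta> = 1 - 2 powr (- e / 2)"
      have \<eta>: "0 < \<eta>" "\<eta> < 1" "log 2 (1 - \<eta>) = - e / 2"
        using e by (auto simp: \<eta>_def powr_less_one)
      define K where "K = \<bar>log 2 (CARD('b) / \<eta>) / \<delta>\<bar> + 1"
      have K: "K > 0" unfolding K_def by (rule add_nonneg_pos) auto
      show "\<forall>\<^sub>F D in at D_min within {D_min..B}. dist (rate D) (rate D_min) < e"
        unfolding eventually_at
      proof (intro exI[of _ "e / 2 / K"] conjI ballI impI)
        show "0 < e / 2 / K" using e K by simp
        fix D assume D: "D \<in> {D_min..B}" and "D \<noteq> D_min \<and> dist D D_min < e / 2 / K"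
        then have small: "(D - D_min) * K < e / 2" using K by (simp add: dist_real_def field_simps)
        have "(D - D_min) / \<delta> * log 2 (CARD('b) / \<eta>) = (D - D_min) * (log 2 (CARD('b) / \<eta>) / \<delta>)" by simp
        also have "\<dots> \<le> (D - D_min) * K"
        proof (rule mult_left_mono)
          show "log 2 (CARD('b) / \<eta>) / \<delta> \<le> K"
            unfolding K_def using abs_ge_self[of "log 2 (CARD('b) / \<eta>) / \<delta>"] by linarith
        qed (use D in simp)
        finally have "rate D_min < rate D + e"
          using rate_D_min_le[OF \<delta> \<eta>(1,2), of D] D small \<eta>(3) by simp
        moreover have "rate D \<le> rate D_min" using D by (intro rate_antimono) auto
        ultimately show "dist (rate D) (rate D_min) < e" by (simp add: dist_real_def)
      qed
    qed
  qed
qed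

text \<open>\<open>B\<close> is the point where \<open>\<alpha> * B\<close> equals the Lagrangian at
  \<open>D_min\<close>. Beyond it the distortion term alone is at least that large, so a minimum
  over a compact interval is a global one.\<close>

lemma lagrangian_minimum:
  assumes \<alpha>: "0 < \<alpha>"
  obtains D0 where "D_min \<le> D0" "\<And>D. D_min \<le> D \<Longrightarrow> rate D0 + \<alpha> * D0 \<le> rate D + \<alpha> * D"
proof -
  define B where "B = D_min + rate D_min / \<alpha>"
  have B: "D_min \<le> B" using rate_nonneg[of D_min] \<alpha> by (simp add: B_def)
  have "\<exists>x\<in>{D_min..B}. \<forall>y\<in>{D_min..B}. rate x + \<alpha> * x \<le> rate y + \<alpha> * y"
    using B by (intro continuous_attains_inf continuous_intros continuous_on_rate) auto
  then obtain D0 where D0: "D0 \<in> {D_min..B}" "\<And>y. y \<in> {D_min..B} \<Longrightarrow> rate D0 + \<alpha> * D0 \<le> rate y + \<alpha> * y" by blast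
  have "rate D0 + \<alpha> * D0 \<le> rate D + \<alpha> * D" if D: "D_min \<le> D" for D
  proof (cases "D \<le> B")
    case False
    have "rate D0 + \<alpha> * D0 \<le> rate D_min + \<alpha> * D_min" using B by (intro D0(2)) auto
    also have "\<dots> = \<alpha> * B" using \<alpha> by (simp add: B_def field_simps)
    also have "\<dots> \<le> \<alpha> * D" using False \<alpha> by simp
    also have "\<dots> \<le> rate D + \<alpha> * D" using rate_nonneg[OF D] by simp
    finally show ?thesis .
  qed (use D D0(2) in auto)
  then show ?thesis using D0(1) that by auto
qed

lemma rate_distortion_infimum:
  assumes n: "1 \<le> n"
  shows "Inf {ereal (mutual_info (joint_pmf (p n) W) / real n) | W. W \<in> test_channels n \<and>
            expect (joint_pmf (p n) W) (\<lambda>(xs, ys). dist_n d xs ys) \<le> D}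
      = (if D_min \<le> D then ereal (rate_n n D) else \<infinity>)"
proof -
  have eq: "{ereal (mutual_info (joint_pmf (p n) W) / real n) | W. W \<in> test_channels n \<and>
            expect (joint_pmf (p n) W) (\<lambda>(xs, ys). dist_n d xs ys) \<le> D}
      = (\<lambda>W. ereal (information n W / n)) ` feasible n D"
    by (auto simp: feasible_def information_def joint_distortion image_iff)
  show ?thesis
  proof (cases "D_min \<le> D")
    case True
    have "ereal (rate_n n D) = (INF W\<in>feasible n D. ereal (information n W / n))"
      unfolding rate_n_def using ereal_Inf'[OF bdd_below_information, of n D] feasible_nonempty[OF n True]
      by (simp add: image_image)
    with True eq show ?thesis by simp
  next
    case False
    then have "feasible n D = {}" using D_min_le[OF n] by (force simp: feasible_def)
    then show ?thesis unfolding eq using False by (simp add: top_ereal_def)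
  qed
qed

end

section \<open>One-shot variable-length lossy coding\<close>

lemma expectation_le_some:
  fixes f :: "'y \<Rightarrow> real"
  assumes "finite (set_pmf q)"
  obtains y where "y \<in> set_pmf q" "expect q f \<le> f y"
proof -
  have "Max (f ` set_pmf q) \<in> f ` set_pmf q" using assms set_pmf_not_empty by (intro Max_in) auto
  then obtain y where y: "y \<in> set_pmf q" "f y = Max (f ` set_pmf q)" by force
  have "expect q f \<le> f y" unfolding y(2) using assms by (intro expectation_le_const) auto
  with y(1) show ?thesis by (rule that)
qed

text \<open>Some \<open>y\<close> covers at least the average weight
  \<open>\<Sum>x\<in>S. w x * measure_pmf.prob q (A x)\<close>. The points it covers get rank
  \<open>1\<close>, and the construction continues on the rest with ranks raised by one. Each round
  adds to the weighted rank sum at most the weight it removes, so the total stays below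
  \<open>sum w S\<close>. On average the rank of \<open>x\<close> is thus at most the reciprocal of
  the probability of \<open>A x\<close>.\<close>

lemma greedy_cover:
  fixes q :: "'y pmf" and A :: "'x \<Rightarrow> 'y set"
  assumes fq: "finite (set_pmf q)" and "finite S"
    and "\<And>x. x \<in> S \<Longrightarrow> 0 < w x" and "\<And>x. x \<in> S \<Longrightarrow> 0 < measure_pmf.prob q (A x)"
  shows "\<exists>(\<kappa> :: 'x \<Rightarrow> nat) (c :: nat \<Rightarrow> 'y). (\<forall>x\<in>S. 1 \<le> \<kappa> x \<and> \<kappa> x \<le> card S \<and> c (\<kappa> x) \<in> A x)
    \<and> (\<Sum>x\<in>S. w x * measure_pmf.prob q (A x) * \<kappa> x) \<le> sum w S"
  using assms(2-)
proof (induction "card S" arbitrary: S rule: less_induct)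
  case less
  show ?case
  proof (cases "S = {}")
    case True then show ?thesis by simp
  next
    case False
    let ?Q = "\<lambda>x. measure_pmf.prob q (A x)"
    obtain y where y: "expect q (\<lambda>y. \<Sum>x\<in>S. w x * indicator (A x) y) \<le> (\<Sum>x\<in>S. w x * indicator (A x) y)"
      by (rule expectation_le_some[OF fq])
    define S1 where "S1 = {x\<in>S. y \<in> A x}"
    have S1: "S1 \<subseteq> S" "finite S1" using less.prems by (auto simp: S1_def)
    have "expect q (\<lambda>y. \<Sum>x\<in>S. w x * indicator (A x) y) = (\<Sum>x\<in>S. w x * ?Q x)"
      using fq by (subst Bochner_Integration.integral_sum) (auto simp: integrable_measure_pmf_finite)
    moreover have "(\<Sum>x\<in>S. w x * indicator (A x) y) = sum w S1"
      using less.prems by (simp add: S1_def indicator_def sum.inter_filter of_bool_def if_distrib cong: if_cong)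
    ultimately have cov: "(\<Sum>x\<in>S. w x * ?Q x) \<le> sum w S1" using y by simp
    moreover have "(\<Sum>x\<in>S. w x * ?Q x) > 0" using less.prems False by (intro sum_pos) auto
    ultimately have "S1 \<noteq> {}" by auto
    define S2 where "S2 = S - S1"
    have S2: "finite S2" "S = S1 \<union> S2" "S1 \<inter> S2 = {}" using less.prems S1 by (auto simp: S2_def)
    have split: "sum h S = sum h S1 + sum h S2" for h :: "'x \<Rightarrow> real"
    proof -
      have "sum h (S1 \<union> S2) = sum h S1 + sum h S2" using S1 S2 by (intro sum.union_disjoint) auto
      then show ?thesis using S2(2) by simp
    qed
    have card: "card S2 < card S" using S1 \<open>S1 \<noteq> {}\<close> less.prems S2 by (intro psubset_card_mono) auto
    obtain \<kappa> :: "'x \<Rightarrow> nat" and c where IH: "\<forall>x\<in>S2. 1 \<le> \<kappa> x \<and> \<kappa> x \<le> card S2 \<and> c (\<kappa> x) \<in> A x"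
      "(\<Sum>x\<in>S2. w x * ?Q x * \<kappa> x) \<le> sum w S2"
      using less.hyps[OF card S2(1)] less.prems S2 by blast
    define \<kappa>' where "\<kappa>' = (\<lambda>x. if x \<in> S1 then 1 else Suc (\<kappa> x))"
    define c' where "c' = (\<lambda>j. if j = 1 then y else c (j - 1))"
    have 1: "1 \<le> \<kappa>' x \<and> \<kappa>' x \<le> card S \<and> c' (\<kappa>' x) \<in> A x" if x: "x \<in> S" for x
    proof (cases "x \<in> S1")
      case True
      have "1 \<le> card S" using False less.prems by (simp add: Suc_le_eq card_gt_0_iff)
      with True show ?thesis by (simp add: \<kappa>'_def c'_def S1_def)
    next
      case False
      then have "x \<in> S2" using x by (simp add: S2_def)
      then have "1 \<le> \<kappa> x" "\<kappa> x \<le> card S2" "c (\<kappa> x) \<in> A x" using IH by auto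
      then show ?thesis using False card by (auto simp: \<kappa>'_def c'_def)
    qed
    have "(\<Sum>x\<in>S. w x * ?Q x * \<kappa>' x) = (\<Sum>x\<in>S1. w x * ?Q x * \<kappa>' x) + (\<Sum>x\<in>S2. w x * ?Q x * \<kappa>' x)"
      by (rule split)
    also have "(\<Sum>x\<in>S1. w x * ?Q x * \<kappa>' x) = (\<Sum>x\<in>S1. w x * ?Q x)"
      by (intro sum.cong) (auto simp: \<kappa>'_def)
    also have "(\<Sum>x\<in>S2. w x * ?Q x * \<kappa>' x) = (\<Sum>x\<in>S2. w x * ?Q x + w x * ?Q x * \<kappa> x)"
      using S2(3) by (intro sum.cong) (auto simp: \<kappa>'_def algebra_simps)
    also have "\<dots> = (\<Sum>x\<in>S2. w x * ?Q x) + (\<Sum>x\<in>S2. w x * ?Q x * \<kappa> x)" by (rule sum.distrib)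
    also have "(\<Sum>x\<in>S1. w x * ?Q x) + ((\<Sum>x\<in>S2. w x * ?Q x) + (\<Sum>x\<in>S2. w x * ?Q x * \<kappa> x))
       \<le> sum w S1 + sum w S2"
      using IH(2) cov split[of "\<lambda>x. w x * ?Q x"] by linarith
    also have "\<dots> = sum w S" by (rule split[symmetric])
    finally have 2: "(\<Sum>x\<in>S. w x * ?Q x * \<kappa>' x) \<le> sum w S" .
    show ?thesis using 1 2 by blast
  qed
qed

section \<open>Distortion levels and the coding bound for a single block\<close>

lemma harmonic_sum_le: "1 \<le> M \<Longrightarrow> (\<Sum>k=1..M. 1 / real k) \<le> 1 + ln (real M)"
proof (induction M rule: dec_induct)
  case (step M)
  have "ln (real M / real (Suc M)) \<le> real M / real (Suc M) - 1" using step by (intro ln_le_minus_one) auto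
  also have "\<dots> = - 1 / real (Suc M)" by (simp add: field_simps)
  finally have "1 / real (Suc M) \<le> ln (real (Suc M)) - ln (real M)" using step by (simp add: ln_div)
  moreover have "(\<Sum>k=1..Suc M. 1 / real k) = (\<Sum>k=1..M. 1 / real k) + 1 / real (Suc M)" by simp
  ultimately show ?case using step.IH by linarith
qed simp

lemma pmf_embed_finite:
  fixes f :: "'x \<Rightarrow> real"
  assumes "finite A" "\<And>x. x \<in> A \<Longrightarrow> 0 \<le> f x" "sum f A = 1"
  shows "pmf (embed_pmf (\<lambda>x. if x \<in> A then f x else 0)) x = (if x \<in> A then f x else 0)"
proof (rule pmf_embed_pmf)
  have "(\<integral>\<^sup>+x. ennreal (if x \<in> A then f x else 0) \<partial>count_space UNIV) = (\<Sum>x\<in>A. ennreal (if x \<in> A then f x else 0))"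
    using assms by (intro nn_integral_count_space') auto
  also have "\<dots> = ennreal (\<Sum>x\<in>A. if x \<in> A then f x else 0)" using assms by (intro sum_ennreal) auto
  also have "(\<Sum>x\<in>A. if x \<in> A then f x else 0) = 1" using assms by simp
  finally show "(\<integral>\<^sup>+x. ennreal (if x \<in> A then f x else 0) \<partial>count_space UNIV) = 1" by simp
qed (use assms in auto)

text \<open>The support is divided by the integer part of \<open>c\<close> into at most
  \<open>S + 1\<close> levels. One level carries at least that share of the mean of
  \<open>2 powr (- c)\<close>, and on it \<open>c\<close> is known up to the final
  \<open>1\<close>.\<close>

lemma distortion_level:
  fixes Q :: "'y pmf" and c :: "'y \<Rightarrow> real"
  assumes fin: "finite (set_pmf Q)" and c: "\<And>y. y \<in> set_pmf Q \<Longrightarrow> 0 \<le> c y \<and> c y \<le> S"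
  shows "\<exists>A. A \<subseteq> set_pmf Q \<and> 0 < measure_pmf.prob Q A \<and>
    (\<forall>y\<in>A. c y \<le> log 2 (measure_pmf.prob Q A)
       - log 2 (expect Q (\<lambda>y. 2 powr (- c y))) + log 2 (S + 1) + 1)"
proof -
  let ?e = "expect Q (\<lambda>y. 2 powr (- c y))"
  define J where "J = nat \<lfloor>S\<rfloor>"
  define A where "A = (\<lambda>j::nat. {y \<in> set_pmf Q. nat \<lfloor>c y\<rfloor> = j})"
  have S0: "0 \<le> S" using c set_pmf_not_empty[of Q] by force
  have J: "real (J + 1) \<le> S + 1" using S0 by (simp add: J_def of_nat_nat)
  have fA: "finite (A j)" for j using fin by (simp add: A_def)
  have epos: "?e > 0"
  proof -
    have "0 < (\<Sum>y\<in>set_pmf Q. pmf Q y * 2 powr (- c y))"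
      using fin set_pmf_not_empty[of Q] by (intro sum_pos) (auto simp: pmf_positive)
    then show ?thesis by (simp add: expectation_finite[OF fin order_refl])
  qed
  have "?e \<le> (\<Sum>j\<le>J. measure_pmf.prob Q (A j) * 2 powr (- real j))"
  proof -
    have "?e = (\<Sum>y\<in>set_pmf Q. pmf Q y * 2 powr (- c y))" by (simp add: expectation_finite[OF fin order_refl])
    also have "\<dots> \<le> (\<Sum>y\<in>set_pmf Q. pmf Q y * 2 powr (- real (nat \<lfloor>c y\<rfloor>)))"
    proof (intro sum_mono mult_left_mono)
      fix y assume "y \<in> set_pmf Q"
      then have "real (nat \<lfloor>c y\<rfloor>) \<le> c y" using c by (simp add: of_nat_nat)
      then show "2 powr (- c y) \<le> (2::real) powr (- real (nat \<lfloor>c y\<rfloor>))" by simp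
    qed simp
    also have "\<dots> = (\<Sum>j\<le>J. \<Sum>y\<in>{y \<in> set_pmf Q. nat \<lfloor>c y\<rfloor> = j}. pmf Q y * 2 powr (- real (nat \<lfloor>c y\<rfloor>)))"
    proof (rule sum.group[symmetric])
      show "(\<lambda>y. nat \<lfloor>c y\<rfloor>) ` set_pmf Q \<subseteq> {..J}" using c by (auto simp: J_def intro!: nat_mono floor_mono)
    qed (use fin in auto)
    also have "\<dots> = (\<Sum>j\<le>J. measure_pmf.prob Q (A j) * 2 powr (- real j))"
      using fA by (intro sum.cong refl) (simp add: A_def[symmetric] measure_measure_pmf_finite sum_distrib_right, simp add: A_def)
    finally show ?thesis .
  qed
  have "\<exists>j\<le>J. ?e / (J + 1) \<le> measure_pmf.prob Q (A j) * 2 powr (- real j)"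
  proof (rule ccontr)
    assume neg: "\<not> ?thesis"
    have "measure_pmf.prob Q (A j) * 2 powr (- real j) < ?e / (J + 1)" if "j \<le> J" for j
      using neg that by (meson not_le)
    then have "(\<Sum>j\<le>J. measure_pmf.prob Q (A j) * 2 powr (- real j)) < (\<Sum>j\<le>J. ?e / (J + 1))"
      by (intro sum_strict_mono) auto
    also have "\<dots> = ?e" by simp
    finally show False using \<open>?e \<le> _\<close> by simp
  qed
  then obtain j where j: "?e / (J + 1) \<le> measure_pmf.prob Q (A j) * 2 powr (- real j)" by blast
  have "0 < ?e / (J + 1)" using epos by simp
  with j have "0 < measure_pmf.prob Q (A j) * 2 powr (- real j)" by linarith
  then have Apos: "0 < measure_pmf.prob Q (A j)" by (simp add: zero_less_mult_iff)
  have "log 2 (?e / (J + 1)) \<le> log 2 (measure_pmf.prob Q (A j) * 2 powr (- real j))"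
    using j \<open>0 < ?e / (J + 1)\<close> by simp
  then have "log 2 ?e - log 2 (J + 1) \<le> log 2 (measure_pmf.prob Q (A j)) - j"
    using Apos epos by (simp add: log_divide log_mult)
  moreover have "log 2 (J + 1) \<le> log 2 (S + 1)" using J S0 by simp
  ultimately have j_le: "real j \<le> log 2 (measure_pmf.prob Q (A j)) - log 2 ?e + log 2 (S + 1)" by linarith
  have "c y \<le> real j + 1" if "y \<in> A j" for y
    using that by (auto simp: A_def) linarith
  with j_le have "c y \<le> log 2 (measure_pmf.prob Q (A j)) - log 2 ?e + log 2 (S + 1) + 1" if "y \<in> A j" for y
    using that by fastforce
  then have "\<forall>y\<in>A j. c y \<le> log 2 (measure_pmf.prob Q (A j)) - log 2 ?e + log 2 (S + 1) + 1" by blast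
  moreover have "A j \<subseteq> set_pmf Q" by (auto simp: A_def)
  ultimately show ?thesis using Apos by blast
qed

text \<open>One half of the Donsker-Varadhan principle: the log sum inequality against the
  unnormalised weights \<open>pmf Q y * 2 powr (- c y)\<close>.\<close>

lemma gibbs_variational:
  assumes fin: "finite (set_pmf P)" "finite (set_pmf Q)" and sub: "set_pmf P \<subseteq> set_pmf Q"
  shows "- log 2 (expect Q (\<lambda>y. 2 powr (- c y))) \<le> kl P Q + expect P c"
proof -
  let ?e = "expect Q (\<lambda>y. 2 powr (- c y))"
  have "(\<Sum>y\<in>set_pmf P. pmf Q y * 2 powr (- c y)) \<le> (\<Sum>y\<in>set_pmf Q. pmf Q y * 2 powr (- c y))"
    using fin sub by (intro sum_mono2) auto
  also have "\<dots> = ?e" by (simp add: expectation_finite[OF fin(2) order_refl])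
  finally have "sum (pmf P) (set_pmf P) * log 2 (sum (pmf P) (set_pmf P) / ?e)
      \<le> (\<Sum>y\<in>set_pmf P. pmf P y * log 2 (pmf P y / (pmf Q y * 2 powr (- c y))))"
    using sub by (intro log_sum_inequality fin) (auto simp: subset_iff set_pmf_iff)
  moreover have "sum (pmf P) (set_pmf P) = 1" using fin by (intro sum_pmf_eq_1) auto
  ultimately have "log 2 (1 / ?e) \<le> (\<Sum>y\<in>set_pmf P. pmf P y * log 2 (pmf P y / (pmf Q y * 2 powr (- c y))))" by simp
  also have "\<dots> = (\<Sum>y\<in>set_pmf P. pmf P y * log 2 (pmf P y / pmf Q y) + pmf P y * c y)"
  proof (intro sum.cong refl)
    fix y assume "y \<in> set_pmf P"
    then have "pmf P y > 0" "pmf Q y > 0" using sub by (auto simp: pmf_positive_iff)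
    then show "pmf P y * log 2 (pmf P y / (pmf Q y * 2 powr (- c y))) = pmf P y * log 2 (pmf P y / pmf Q y) + pmf P y * c y"
      by (simp add: log_divide log_mult algebra_simps)
  qed
  also have "\<dots> = kl P Q + expect P c"
    by (simp add: sum.distrib kl_sum[OF fin(1) order_refl] expectation_finite[OF fin(1) order_refl])
  finally have "log 2 (1 / ?e) \<le> kl P Q + expect P c" .
  moreover have "log 2 (1 / ?e) = - log 2 ?e"
  proof (cases "?e = 0")
    case False
    moreover have "0 \<le> ?e" by (intro Bochner_Integration.integral_nonneg) simp
    ultimately show ?thesis by (simp add: log_def ln_div)
  qed (simp add: log_def)
  ultimately show ?thesis by simp
qed

text \<open>Each \<open>x\<close> gets a target set \<open>A x\<close> of nearly constant cost, and
  the targets are covered greedily. The logarithm of the rank costs on average no more than minus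
  the logarithm of the probability of \<open>A x\<close>, which cancels the same term in the bound
  on \<open>c\<close>. What remains is the logarithm of the mean of \<open>2 powr (- c)\<close>,
  bounded by divergence plus cost under \<open>W x\<close>. The final terms pay for the levels and
  for coding the rank.\<close>

theorem one_shot_code:
  fixes p :: "'x::countable pmf" and W :: "'x \<Rightarrow> 'y::countable pmf" and c :: "'x \<Rightarrow> 'y \<Rightarrow> real"
  assumes fp: "finite (set_pmf p)" and fW: "\<And>x. x \<in> set_pmf p \<Longrightarrow> finite (set_pmf (W x))"
    and c: "\<And>x y. x \<in> set_pmf p \<Longrightarrow> y \<in> set_pmf (bind_pmf p W) \<Longrightarrow> 0 \<le> c x y \<and> c x y \<le> S"
  obtains g :: "'x \<Rightarrow> 'y" and \<rho> :: "'y pmf" where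
    "\<And>x. x \<in> set_pmf p \<Longrightarrow> g x \<in> set_pmf \<rho> \<and> g x \<in> set_pmf (bind_pmf p W)"
    "expect p (\<lambda>x. - log 2 (pmf \<rho> (g x)) + c x (g x))
      \<le> mutual_info (joint_pmf p W) + expect p (\<lambda>x. expect (W x) (c x))
         + log 2 (S + 1) + 1 + log 2 (1 + ln (card (set_pmf p)))"
proof -
  let ?Q = "bind_pmf p W"
  have fQ: "finite (set_pmf ?Q)" using fp fW by auto
  define v where "v = (\<lambda>x. log 2 (expect ?Q (\<lambda>y. 2 powr (- c x y))))"
  have "\<forall>x\<in>set_pmf p. \<exists>A. A \<subseteq> set_pmf ?Q \<and> 0 < measure_pmf.prob ?Q A \<and>
    (\<forall>y\<in>A. c x y \<le> log 2 (measure_pmf.prob ?Q A) - v x + log 2 (S + 1) + 1)"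
  proof
    fix x assume x: "x \<in> set_pmf p"
    show "\<exists>A. A \<subseteq> set_pmf ?Q \<and> 0 < measure_pmf.prob ?Q A \<and>
      (\<forall>y\<in>A. c x y \<le> log 2 (measure_pmf.prob ?Q A) - v x + log 2 (S + 1) + 1)"
      unfolding v_def by (rule distortion_level[OF fQ c[OF x]])
  qed
  from bchoice[OF this] obtain A where A': "\<forall>x\<in>set_pmf p. A x \<subseteq> set_pmf ?Q \<and> 0 < measure_pmf.prob ?Q (A x) \<and>
    (\<forall>y\<in>A x. c x y \<le> log 2 (measure_pmf.prob ?Q (A x)) - v x + log 2 (S + 1) + 1)" ..
  then have A: "\<And>x. x \<in> set_pmf p \<Longrightarrow> A x \<subseteq> set_pmf ?Q"
    "\<And>x. x \<in> set_pmf p \<Longrightarrow> 0 < measure_pmf.prob ?Q (A x)"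
    "\<And>x y. x \<in> set_pmf p \<Longrightarrow> y \<in> A x \<Longrightarrow> c x y \<le> log 2 (measure_pmf.prob ?Q (A x)) - v x + log 2 (S + 1) + 1"
    by simp_all
  define M where "M = card (set_pmf p)"
  have M: "1 \<le> M" using fp set_pmf_not_empty[of p] by (simp add: M_def Suc_le_eq card_gt_0_iff)
  obtain \<kappa> :: "'x \<Rightarrow> nat" and code where
    \<kappa>: "\<And>x. x \<in> set_pmf p \<Longrightarrow> 1 \<le> \<kappa> x \<and> \<kappa> x \<le> M \<and> code (\<kappa> x) \<in> A x"
    and sum\<kappa>: "(\<Sum>x\<in>set_pmf p. pmf p x * measure_pmf.prob ?Q (A x) * \<kappa> x) \<le> sum (pmf p) (set_pmf p)"
  proof -
    have "\<exists>(\<kappa> :: 'x \<Rightarrow> nat) code. (\<forall>x\<in>set_pmf p. 1 \<le> \<kappa> x \<and> \<kappa> x \<le> card (set_pmf p) \<and> code (\<kappa> x) \<in> A x)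
      \<and> (\<Sum>x\<in>set_pmf p. pmf p x * measure_pmf.prob ?Q (A x) * \<kappa> x) \<le> sum (pmf p) (set_pmf p)"
      by (rule greedy_cover[OF fQ fp]) (simp_all add: A(2) pmf_positive)
    then show ?thesis using that unfolding M_def by blast
  qed
  define H where "H = (\<Sum>k=1..M. 1 / real k)"
  have H1: "1 \<le> H" using member_le_sum[of 1 "{1..M}" "\<lambda>k. 1 / real k"] M by (simp add: H_def)
  \<comment> \<open>Weights proportional to \<open>1 / k\<close>, so that rank \<open>k\<close>
    costs \<open>log 2 k + log 2 H\<close>, with \<open>H\<close> only logarithmic in the number of
    ranks.\<close>
  define R where "R = embed_pmf (\<lambda>k. if k \<in> {1..M} then 1 / real k / H else 0)"
  have R: "pmf R k = (if k \<in> {1..M} then 1 / real k / H else 0)" for k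
    unfolding R_def
  proof (rule pmf_embed_finite)
    have "(\<Sum>k\<in>{1..M}. 1 / real k / H) = H / H" unfolding sum_divide_distrib[symmetric] H_def[symmetric] ..
    then show "(\<Sum>k\<in>{1..M}. 1 / real k / H) = 1" using H1 by simp
  qed (use H1 in auto)
  define \<rho> where "\<rho> = map_pmf code R"
  define g where "g = (\<lambda>x. code (\<kappa> x))"
  have \<rho>: "1 / (\<kappa> x * H) \<le> pmf \<rho> (g x)" if "x \<in> set_pmf p" for x
    using pmf_map_ge_sum[of "{\<kappa> x}" code "g x" R] \<kappa>[OF that] by (simp add: \<rho>_def g_def R)
  have pos: "0 < 1 / (\<kappa> x * H)" if "x \<in> set_pmf p" for x using \<kappa>[OF that] H1 by simp
  have g: "g x \<in> set_pmf \<rho> \<and> g x \<in> set_pmf ?Q" if "x \<in> set_pmf p" for x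
  proof
    have "pmf \<rho> (g x) > 0" using \<rho>[OF that] pos[OF that] by linarith
    then show "g x \<in> set_pmf \<rho>" by (simp add: pmf_positive_iff)
    show "g x \<in> set_pmf ?Q" using \<kappa>[OF that] A(1)[OF that] unfolding g_def by blast
  qed
  have "expect p (\<lambda>x. - log 2 (pmf \<rho> (g x)) + c x (g x))
     \<le> expect p (\<lambda>x. log 2 (\<kappa> x * measure_pmf.prob ?Q (A x)) - v x + (log 2 (S + 1) + 1 + log 2 H))"
  proof (rule expectation_mono_finite[OF fp])
    fix x assume x: "x \<in> set_pmf p"
    have "log 2 (1 / (\<kappa> x * H)) \<le> log 2 (pmf \<rho> (g x))" using \<rho>[OF x] pos[OF x] less_le_trans[OF pos[OF x] \<rho>[OF x]]
      by (subst log_le_cancel_iff) simp_all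
    then have "- log 2 (pmf \<rho> (g x)) \<le> log 2 (\<kappa> x) + log 2 H" using \<kappa>[OF x] H1 by (simp add: log_divide log_mult)
    moreover have "c x (g x) \<le> log 2 (measure_pmf.prob ?Q (A x)) - v x + log 2 (S + 1) + 1"
      using A(3)[OF x] \<kappa>[OF x] by (simp add: g_def)
    moreover have "log 2 (\<kappa> x * measure_pmf.prob ?Q (A x)) = log 2 (\<kappa> x) + log 2 (measure_pmf.prob ?Q (A x))"
      using \<kappa>[OF x] A(2)[OF x] by (intro log_mult_pos) auto
    ultimately show "- log 2 (pmf \<rho> (g x)) + c x (g x)
        \<le> log 2 (\<kappa> x * measure_pmf.prob ?Q (A x)) - v x + (log 2 (S + 1) + 1 + log 2 H)" by linarith
  qed
  also have "\<dots> = expect p (\<lambda>x. log 2 (\<kappa> x * measure_pmf.prob ?Q (A x)))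
      + expect p (\<lambda>x. - v x) + (log 2 (S + 1) + 1 + log 2 H)"
    using fp by (simp add: integrable_measure_pmf_finite)
  \<comment> \<open>Here the greedy bound enters, through \<open>ln t \<le> t - 1\<close>.\<close>
  also have "expect p (\<lambda>x. log 2 (\<kappa> x * measure_pmf.prob ?Q (A x))) \<le> 0"
  proof -
    have "expect p (\<lambda>x. log 2 (\<kappa> x * measure_pmf.prob ?Q (A x)))
        \<le> expect p (\<lambda>x. (\<kappa> x * measure_pmf.prob ?Q (A x) - 1) / ln 2)"
    proof (rule expectation_mono_finite[OF fp])
      fix x assume x: "x \<in> set_pmf p"
      have "ln (\<kappa> x * measure_pmf.prob ?Q (A x)) \<le> \<kappa> x * measure_pmf.prob ?Q (A x) - 1"
        using \<kappa>[OF x] A(2)[OF x] by (intro ln_le_minus_one mult_pos_pos) auto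
      then show "log 2 (\<kappa> x * measure_pmf.prob ?Q (A x)) \<le> (\<kappa> x * measure_pmf.prob ?Q (A x) - 1) / ln 2"
        unfolding log_def by (rule divide_right_mono) simp
    qed
    also have "\<dots> = ((\<Sum>x\<in>set_pmf p. pmf p x * measure_pmf.prob ?Q (A x) * \<kappa> x) - sum (pmf p) (set_pmf p)) / ln 2"
      by (simp add: expectation_finite[OF fp order_refl] sum_subtractf[symmetric] sum_divide_distrib algebra_simps)
    also have "\<dots> \<le> 0" using sum\<kappa> by (simp add: divide_le_0_iff)
    finally show ?thesis .
  qed
  also have "expect p (\<lambda>x. - v x)
      \<le> expect p (\<lambda>x. kl (W x) ?Q + expect (W x) (c x))"
    unfolding v_def using fp fW fQ by (intro expectation_mono_finite gibbs_variational) auto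
  also have "\<dots> = mutual_info (joint_pmf p W) + expect p (\<lambda>x. expect (W x) (c x))"
    using fp fW by (simp add: mutual_info_joint integrable_measure_pmf_finite)
  also have "log 2 H \<le> log 2 (1 + ln (card (set_pmf p)))"
    using harmonic_sum_le[OF M] H1 unfolding M_def[symmetric] H_def[symmetric] by simp
  finally have "expect p (\<lambda>x. - log 2 (pmf \<rho> (g x)) + c x (g x))
      \<le> mutual_info (joint_pmf p W) + expect p (\<lambda>x. expect (W x) (c x))
         + log 2 (S + 1) + 1 + log 2 (1 + ln (card (set_pmf p)))" by simp
  with g show ?thesis by (rule that)
qed

section \<open>Kernels from block laws\<close>

context stationary_blocks
begin

text \<open>Output \<open>i\<close> belongs to the window centred at \<open>i + m\<close>, so an
  input of length \<open>2 * m + L\<close> provides \<open>L\<close> complete windows without cyclic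
  reading.\<close>

definition code_outputs :: "nat \<Rightarrow> ('a list \<Rightarrow> 'b) \<Rightarrow> nat \<Rightarrow> 'a list \<Rightarrow> 'b list" where
  "code_outputs m F L xs = map (\<lambda>i. F (take (2 * m + 1) (drop i xs))) [0..<L]"

lemma code_outputs_take:
  assumes "2 * m + L \<le> n" "length xs = n"
  shows "code_outputs m F L (take (2 * m + L) xs) = code_outputs m F L xs"
  unfolding code_outputs_def
proof (rule map_cong[OF refl])
  fix i assume "i \<in> set [0..<L]"
  then have "2 * m + 1 \<le> 2 * m + L - i" by auto
  then show "F (take (2 * m + 1) (drop i (take (2 * m + L) xs))) = F (take (2 * m + 1) (drop i xs))"
    by (simp only: drop_take take_take min_absorb1)
qed

text \<open>
  By the chain rule the cross entropy of a block law is the sum of those of its conditional laws, so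
  one of these is at most the average.
\<close>

lemma kernel_from_block_law:
  fixes F :: "'a list \<Rightarrow> 'b::finite" and R :: "'b list pmf"
  assumes L: "1 \<le> L" and R: "\<And>ys. ys \<in> set_pmf R \<Longrightarrow> length ys = L"
    and abs: "\<And>xs. xs \<in> set_pmf (p (2 * m + L)) \<Longrightarrow> code_outputs m F L xs \<in> set_pmf R"
    and cost: "expect (p (2 * m + L)) (\<lambda>xs. - log 2 (pmf R (code_outputs m F L xs))) \<le> A"
  obtains j and q :: "'b list \<Rightarrow> 'b \<Rightarrow> real" where
    "\<And>s b. 0 \<le> q s b" "\<And>s. (\<Sum>b\<in>UNIV. q s b) \<le> 1"
    "\<And>xs. xs \<in> set_pmf (p (2 * m + j + 1)) \<Longrightarrow> 0 < q (code_outputs m F j xs) (code_outputs m F (j + 1) xs ! j)"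
    "expect (p (2 * m + j + 1))
       (\<lambda>xs. - log 2 (q (code_outputs m F j xs) (code_outputs m F (j + 1) xs ! j))) \<le> A / L"
proof -
  define Rj where "Rj = (\<lambda>j. map_pmf (take j) R)"
  \<comment> \<open>The conditional law of letter \<open>j\<close> given the preceding letters under
    \<open>R\<close>; contexts of another length get the zero row.\<close>
  define q where "q = (\<lambda>j s b. if length s = j then pmf (Rj (Suc j)) (s @ [b]) / pmf (Rj j) s else 0)"
  let ?co = "code_outputs m F"
  have len_co: "length (?co j xs) = j" for j xs by (simp add: code_outputs_def)
  have take_co: "take j (?co i xs) = ?co j xs" if "j \<le> i" for i j xs
    using that by (simp add: code_outputs_def take_map)
  have snoc_co: "?co j xs @ [?co (Suc j) xs ! j] = ?co (Suc j) xs" for j xs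
    by (simp add: code_outputs_def nth_append)
  have Rj_Suc: "map_pmf (take j) (Rj (Suc j)) = Rj j" for j
    by (simp add: Rj_def map_pmf_comp min_absorb1)
  have q0: "0 \<le> q j s b" for j s b by (simp add: q_def)
  have q1: "(\<Sum>b\<in>UNIV. q j s b) \<le> 1" for j s
  proof (cases "length s = j")
    case True
    have "(\<Sum>b\<in>UNIV. pmf (Rj (Suc j)) (s @ [b])) = sum (pmf (Rj (Suc j))) ((\<lambda>b. s @ [b]) ` UNIV)"
      by (subst sum.reindex) (auto simp: inj_on_def)
    also have "\<dots> \<le> pmf (map_pmf (take j) (Rj (Suc j))) s"
      using True by (intro pmf_map_ge_sum) auto
    finally have "(\<Sum>b\<in>UNIV. pmf (Rj (Suc j)) (s @ [b])) \<le> pmf (Rj j) s" by (simp only: Rj_Suc)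
    then show ?thesis using True by (auto simp: q_def sum_divide_distrib[symmetric] divide_le_eq_1 less_le)
  qed (simp add: q_def)
  have Rpos: "0 < pmf (Rj j) (?co j xs)" if "j \<le> L" "xs \<in> set_pmf (p (2 * m + L))" for j xs
  proof -
    have "take j (?co L xs) \<in> set_pmf (Rj j)" unfolding Rj_def set_map_pmf using abs[OF that(2)] by (rule imageI)
    then show ?thesis using take_co[OF that(1)] by (simp add: pmf_positive)
  qed
  define h where "h = (\<lambda>j xs. - log 2 (q j (?co j xs) (?co (Suc j) xs ! j)))"
  have h: "h j xs = log 2 (pmf (Rj j) (?co j xs)) - log 2 (pmf (Rj (Suc j)) (?co (Suc j) xs))"
    and qpos: "0 < q j (?co j xs) (?co (Suc j) xs ! j)"
    if "j < L" "xs \<in> set_pmf (p (2 * m + L))" for j xs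
    using Rpos[of j xs] Rpos[of "Suc j" xs] that
    by (auto simp: h_def q_def len_co snoc_co log_divide)
  have tele: "(\<Sum>j<L. h j xs) = - log 2 (pmf R (?co L xs))" if "xs \<in> set_pmf (p (2 * m + L))" for xs
  proof -
    have "(\<Sum>j<L. h j xs) = (\<Sum>j<L. log 2 (pmf (Rj j) (?co j xs)) - log 2 (pmf (Rj (Suc j)) (?co (Suc j) xs)))"
      using that by (intro sum.cong h) auto
    also have "\<dots> = log 2 (pmf (Rj 0) (?co 0 xs)) - log 2 (pmf (Rj L) (?co L xs))"
      by (rule sum_lessThan_telescope')
    also have "Rj 0 = return_pmf []" by (simp add: Rj_def)
    also have "Rj L = R" unfolding Rj_def using R by (intro map_pmf_idI) simp
    finally show ?thesis by (simp add: code_outputs_def)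
  qed
  have marg: "expect (p (2 * m + L)) (\<lambda>xs. h j xs) = expect (p (2 * m + j + 1)) (h j)"
    if "j < L" for j
  proof -
    have "expect (p (2 * m + L)) (\<lambda>xs. h j xs)
       = expect (p (2 * m + L)) (\<lambda>xs. h j (take (2 * m + j + 1) (drop 0 xs)))"
    proof (rule expectation_cong)
      fix xs assume "xs \<in> set_pmf (p (2 * m + L))"
      then have len: "length xs = 2 * m + L" by (rule length_block)
      have 1: "?co (Suc j) (take (2 * m + j + 1) xs) = ?co (Suc j) xs"
        using code_outputs_take[OF _ len, of m "Suc j" F] that by simp
      then have "?co j (take (2 * m + j + 1) xs) = ?co j xs"
        using take_co[of j "Suc j"] by (metis le_add2 plus_1_eq_Suc)
      with 1 show "h j xs = h j (take (2 * m + j + 1) (drop 0 xs))" by (simp add: h_def)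
    qed
    also have "\<dots> = expect (p (2 * m + j + 1)) (h j)"
      using that by (intro expectation_marginal) simp
    finally show ?thesis .
  qed
  have "(\<Sum>j<L. expect (p (2 * m + j + 1)) (h j))
      = expect (p (2 * m + L)) (\<lambda>xs. \<Sum>j<L. h j xs)"
    by (subst Bochner_Integration.integral_sum) (auto simp: integrable_measure_pmf_finite finite_set_block marg)
  also have "\<dots> = expect (p (2 * m + L)) (\<lambda>xs. - log 2 (pmf R (?co L xs)))"
    by (rule expectation_cong) (rule tele)
  finally have sum_le: "(\<Sum>j<L. expect (p (2 * m + j + 1)) (h j)) \<le> A" using cost by simp
  have "\<exists>j<L. expect (p (2 * m + j + 1)) (h j) \<le> A / L"
  proof (rule ccontr)
    assume "\<not> ?thesis"
    then have "(\<Sum>j<L. A / L) < (\<Sum>j<L. expect (p (2 * m + j + 1)) (h j))"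
      using L by (intro sum_strict_mono) (auto simp: not_le lessThan_empty_iff)
    with sum_le L show False by simp
  qed
  then obtain j where j: "j < L" "expect (p (2 * m + j + 1)) (h j) \<le> A / L" by blast
  show ?thesis
  proof (rule that[of "q j" j])
    fix xs assume "xs \<in> set_pmf (p (2 * m + j + 1))"
    also have "p (2 * m + j + 1) = map_pmf (\<lambda>xs. take (2 * m + j + 1) (drop 0 xs)) (p (2 * m + L))"
      using j(1) by (intro marginal[symmetric]) simp
    finally obtain xs' where xs': "xs' \<in> set_pmf (p (2 * m + L))" "xs = take (2 * m + j + 1) xs'" by auto
    then have len: "length xs' = 2 * m + L" by (intro length_block)
    have 1: "?co (Suc j) xs = ?co (Suc j) xs'"
      using code_outputs_take[OF _ len, of m "Suc j" F] j(1) xs'(2) by simp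
    then have "?co j xs = ?co j xs'"
      using take_co[of j "Suc j"] by (metis le_add2 plus_1_eq_Suc)
    with 1 show "0 < q j (?co j xs) (?co (j + 1) xs ! j)" using qpos[OF j(1) xs'(1)] by simp
  qed (use q0 q1 j(2) in \<open>auto simp: h_def\<close>)
qed

end

locale recurrent_problem = rate_distortion_problem p d
  for p :: "nat \<Rightarrow> 'a::finite list pmf" and d :: "'a \<Rightarrow> 'b::finite \<Rightarrow> real" +
  assumes recurrence: "\<And>u \<epsilon>. u \<in> set_pmf (p (length u)) \<Longrightarrow> 0 < \<epsilon> \<Longrightarrow>
     \<exists>L. measure_pmf.prob (p (L + length u)) {xs. \<forall>i<L. take (length u) (drop i xs) \<noteq> u} < (\<epsilon>::real)"
begin

text \<open>A window function \<open>F\<close> with a certificate \<open>q\<close> for its rate: the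
  cross entropy of the next output letter given \<open>j\<close> earlier ones. Positivity is
  demanded because \<open>log 2 0 = 0\<close> would make impossible letters free.\<close>

definition good_code :: "real \<Rightarrow> real \<Rightarrow> nat \<Rightarrow> ('a list \<Rightarrow> 'b) \<Rightarrow> nat \<Rightarrow> ('b list \<Rightarrow> 'b \<Rightarrow> real) \<Rightarrow> bool" where
  "good_code \<alpha> c m F j q \<longleftrightarrow> (\<forall>s b. 0 \<le> q s b) \<and> (\<forall>s. (\<Sum>b\<in>UNIV. q s b) \<le> 1) \<and>
     (\<forall>xs\<in>set_pmf (p (2 * m + j + 1)). 0 < q (code_outputs m F j xs) (code_outputs m F (j + 1) xs ! j)) \<and>
     expect (p (2 * m + j + 1))
       (\<lambda>xs. - log 2 (q (code_outputs m F j xs) (code_outputs m F (j + 1) xs ! j)))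
     + \<alpha> * expect (p (2 * m + 1)) (\<lambda>xs. d (xs ! m) (F xs)) \<le> c"

text \<open>\<open>best\<close> applied letterwise attains \<open>D_min\<close>. Its output blocks
  have probability at least \<open>\<delta>\<close>, so their cost \<open>- log 2 \<delta>\<close>
  does not grow with \<open>L\<close> and falls below \<open>\<epsilon>\<close> per letter.\<close>

lemma good_code_few_words:
  assumes \<delta>: "0 < \<delta>" "\<And>l u. u \<in> set_pmf (p l) \<Longrightarrow> \<delta> \<le> pmf (p l) u"
    and \<alpha>: "0 < \<alpha>" and D: "D_min \<le> D" and \<epsilon>: "0 < \<epsilon>"
  shows "\<exists>m F j q. good_code \<alpha> (rate D + \<alpha> * D + \<epsilon>) m F j q"
proof -
  define F where "F = (\<lambda>w :: 'a list. best (w ! 0))"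
  define L where "L = nat \<lceil>- log 2 \<delta> / \<epsilon>\<rceil> + 1"
  have L: "1 \<le> L" "- log 2 \<delta> \<le> L * \<epsilon>"
  proof -
    have "- log 2 \<delta> / \<epsilon> \<le> L" unfolding L_def by linarith
    from mult_right_mono[OF this, of \<epsilon>] show "- log 2 \<delta> \<le> L * \<epsilon>" using \<epsilon> by simp
  qed (simp add: L_def)
  define R where "R = map_pmf (map best) (p L)"
  have co: "code_outputs 0 F L xs = map best xs" if "xs \<in> set_pmf (p L)" for xs
  proof -
    have "length xs = L" using that by (rule length_block)
    then show ?thesis by (intro nth_equalityI) (auto simp: code_outputs_def F_def)
  qed
  obtain j and q :: "'b list \<Rightarrow> 'b \<Rightarrow> real" where q:
    "\<And>s b. 0 \<le> q s b" "\<And>s. (\<Sum>b\<in>UNIV. q s b) \<le> 1"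
    "\<And>xs. xs \<in> set_pmf (p (2 * 0 + j + 1)) \<Longrightarrow> 0 < q (code_outputs 0 F j xs) (code_outputs 0 F (j + 1) xs ! j)"
    "expect (p (2 * 0 + j + 1))
       (\<lambda>xs. - log 2 (q (code_outputs 0 F j xs) (code_outputs 0 F (j + 1) xs ! j))) \<le> - log 2 \<delta> / L"
  proof (rule kernel_from_block_law[OF L(1), of R 0 F "- log 2 \<delta>"])
    show "length ys = L" if "ys \<in> set_pmf R" for ys using that length_block by (auto simp: R_def)
    show "code_outputs 0 F L xs \<in> set_pmf R" if "xs \<in> set_pmf (p (2 * 0 + L))" for xs
      using that co[of xs] by (auto simp: R_def)
    show "expect (p (2 * 0 + L)) (\<lambda>xs. - log 2 (pmf R (code_outputs 0 F L xs))) \<le> - log 2 \<delta>"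
    proof (rule expectation_le_const[OF finite_set_block])
      fix xs assume "xs \<in> set_pmf (p (2 * 0 + L))"
      then have xs: "xs \<in> set_pmf (p L)" by simp
      have "\<delta> \<le> pmf (p L) xs" by (rule \<delta>(2)[OF xs])
      also have "\<dots> \<le> pmf R (map best xs)" unfolding R_def using pmf_map_ge_sum[of "{xs}" "map best" "map best xs" "p L"] by simp
      finally show "- log 2 (pmf R (code_outputs 0 F L xs)) \<le> - log 2 \<delta>" using \<delta>(1) by (simp add: co[OF xs])
    qed
  qed blast
  have "- log 2 \<delta> / L \<le> L * \<epsilon> / L" by (rule divide_right_mono[OF L(2)]) simp
  then have "- log 2 \<delta> / L \<le> \<epsilon>" using L(1) by simp
  moreover have "expect (p (2 * 0 + 1)) (\<lambda>xs. d (xs ! 0) (F xs)) = D_min"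
    by (simp add: F_def d_best D_min_def)
  moreover have "\<alpha> * D_min \<le> \<alpha> * D" using \<alpha> D by simp
  ultimately have "good_code \<alpha> (rate D + \<alpha> * D + \<epsilon>) 0 F j q"
    unfolding good_code_def using q rate_nonneg[OF D] by simp
  then show ?thesis by blast
qed

end

section \<open>Sliding-block codes from block codes\<close>

text \<open>
  The word \<open>u\<close> is a marker. A block of length \<open>N\<close> starts at position \<open>q\<close> in phase \<open>\<phi>\<close> if the distance
  from the last occurrence of the marker is congruent to \<open>\<phi>\<close>; each output letter is the one
  prescribed by the latest block start. Averaged over the phases, block starts are uniform, so no
  conditioning on the marker biases the law of the blocks.
\<close>

locale marker_code =
  fixes u :: "'a list" and N Lm :: nat and g :: "'a list \<Rightarrow> 'b list"
  assumes N: "2 \<le> N"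
begin

definition mark :: "(nat \<Rightarrow> 'a) \<Rightarrow> nat \<Rightarrow> bool" where
  "mark s q \<longleftrightarrow> map s [q..<q + length u] = u"

text \<open>\<open>\<tau>\<close> is the distance to the last marker. Limiting it by
  \<open>Lm\<close> lets the test depend on a bounded stretch of the input.\<close>

definition start :: "nat \<Rightarrow> (nat \<Rightarrow> 'a) \<Rightarrow> nat \<Rightarrow> bool" where
  "start \<phi> s q \<longleftrightarrow> (\<exists>\<tau>\<le>Lm. mark s (q - \<tau>) \<and> (\<forall>t<\<tau>. \<not> mark s (q - t)) \<and> \<tau> mod N = \<phi>)"

definition codeword :: "nat \<Rightarrow> (nat \<Rightarrow> 'a) \<Rightarrow> nat \<Rightarrow> 'b list option" where
  "codeword \<phi> s q = (if start \<phi> s q then Some (g (map s [q..<q + N])) else None)"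

text \<open>\<open>\<zeta> j\<close> is what started \<open>j\<close> positions ago. The most recent
  start within \<open>N\<close> positions supplies its letter number \<open>j\<close>; without one
  the output is arbitrary.\<close>

definition decode :: "(nat \<Rightarrow> 'b list option) \<Rightarrow> 'b" where
  "decode \<zeta> = (if \<exists>j<N. \<zeta> j \<noteq> None then the (\<zeta> (LEAST j. \<zeta> j \<noteq> None)) ! (LEAST j. \<zeta> j \<noteq> None) else undefined)"

definition out_letter :: "nat \<Rightarrow> (nat \<Rightarrow> 'a) \<Rightarrow> nat \<Rightarrow> 'b" where
  "out_letter \<phi> s q = decode (\<lambda>j. codeword \<phi> s (q - j))"

text \<open>The stretch read by \<open>codeword\<close> goes back \<open>Lm\<close> letters and
  forward by \<open>N\<close> for the block or \<open>length u\<close> for the marker; the sum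
  covers both.\<close>

definition margin :: nat where "margin = Lm + N + length u"

lemma decode_cong: "(\<And>j. j < N \<Longrightarrow> \<zeta> j = \<zeta>' j) \<Longrightarrow> decode \<zeta> = decode \<zeta>'"
proof -
  assume eq: "\<And>j. j < N \<Longrightarrow> \<zeta> j = \<zeta>' j"
  show ?thesis
  proof (cases "\<exists>j<N. \<zeta> j \<noteq> None")
    case True
    then obtain j where j: "j < N" "\<zeta> j \<noteq> None" by blast
    let ?l = "LEAST j. \<zeta> j \<noteq> None"
    have l: "\<zeta> ?l \<noteq> None" "?l \<le> j" using j by (auto intro: LeastI Least_le)
    have "(LEAST j. \<zeta>' j \<noteq> None) = ?l"
    proof (rule Least_equality)
      show "\<zeta>' ?l \<noteq> None" using l j eq[of ?l] by simp
      fix i assume "\<zeta>' i \<noteq> None"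
      show "?l \<le> i"
      proof (cases "i < N")
        case True
        with \<open>\<zeta>' i \<noteq> None\<close> eq[of i] show ?thesis by (intro Least_le) simp
      qed (use l j in simp)
    qed
    moreover have "\<exists>j<N. \<zeta>' j \<noteq> None" using j eq[OF j(1)] by auto
    moreover have "\<zeta> ?l = \<zeta>' ?l" using l j by (intro eq) simp
    ultimately show ?thesis using True by (simp add: decode_def)
  next
    case False
    with eq have "\<not> (\<exists>j<N. \<zeta>' j \<noteq> None)" by auto
    with False show ?thesis by (simp only: decode_def if_False)
  qed
qed

lemma mark_cong: "(\<And>i. i < length u \<Longrightarrow> s (q + i) = s' (q' + i)) \<Longrightarrow> mark s q = mark s' q'"
proof -
  assume "\<And>i. i < length u \<Longrightarrow> s (q + i) = s' (q' + i)"
  then have "map s [q..<q + length u] = map s' [q'..<q' + length u]" by (intro nth_equalityI) auto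
  then show ?thesis by (simp add: mark_def)
qed

lemma start_cong:
  assumes q: "Lm \<le> q" "Lm \<le> q'"
    and eq: "\<And>i. i < Lm + length u \<Longrightarrow> s (q - Lm + i) = s' (q' - Lm + i)"
  shows "start \<phi> s q = start \<phi> s' q'"
proof -
  have "mark s (q - \<tau>) = mark s' (q' - \<tau>)" if "\<tau> \<le> Lm" for \<tau>
  proof (rule mark_cong)
    fix i assume "i < length u"
    with eq[of "Lm - \<tau> + i"] that q show "s (q - \<tau> + i) = s' (q' - \<tau> + i)" by simp
  qed
  then have "(mark s (q - \<tau>) \<and> (\<forall>t<\<tau>. \<not> mark s (q - t))) = (mark s' (q' - \<tau>) \<and> (\<forall>t<\<tau>. \<not> mark s' (q' - t)))"
    if "\<tau> \<le> Lm" for \<tau> using that by auto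
  then show ?thesis unfolding start_def by blast
qed

lemma codeword_cong:
  assumes q: "Lm \<le> q" "Lm \<le> q'"
    and eq: "\<And>i. i < margin \<Longrightarrow> s (q - Lm + i) = s' (q' - Lm + i)"
  shows "codeword \<phi> s q = codeword \<phi> s' q'"
proof -
  have "start \<phi> s q = start \<phi> s' q'" using eq by (intro start_cong q) (auto simp: margin_def)
  moreover have "map s [q..<q + N] = map s' [q'..<q' + N]"
  proof (rule nth_equalityI)
    fix i assume "i < length (map s [q..<q + N])"
    with eq[of "Lm + i"] q show "map s [q..<q + N] ! i = map s' [q'..<q' + N] ! i" by (simp add: margin_def)
  qed simp
  ultimately show ?thesis by (simp add: codeword_def)
qed

lemma out_letter_cong:
  assumes q: "Lm + N \<le> q" "Lm + N \<le> q'"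
    and eq: "\<And>i. i < Lm + N + margin \<Longrightarrow> s (q - (Lm + N) + i) = s' (q' - (Lm + N) + i)"
  shows "out_letter \<phi> s q = out_letter \<phi> s' q'"
  unfolding out_letter_def
proof (rule decode_cong, rule codeword_cong)
  fix j i assume "j < N" "i < margin"
  then have "q - (Lm + N) + (N - j + i) = q - j - Lm + i" "q' - (Lm + N) + (N - j + i) = q' - j - Lm + i"
    "N - j + i < Lm + N + margin" using q by linarith+
  with eq[of "N - j + i"] show "s (q - j - Lm + i) = s' (q' - j - Lm + i)" by simp
qed (use q in auto)

lemma start_unique:
  assumes "start \<phi> s q" "start \<phi>' s q"
  shows "\<phi> = \<phi>'"
proof -
  obtain t where t: "mark s (q - t)" "\<And>i. i < t \<Longrightarrow> \<not> mark s (q - i)" "t mod N = \<phi>"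
    using assms(1) unfolding start_def by blast
  obtain t' where t': "mark s (q - t')" "\<And>i. i < t' \<Longrightarrow> \<not> mark s (q - i)" "t' mod N = \<phi>'"
    using assms(2) unfolding start_def by blast
  have "t = t'" using t(1,2) t'(1,2) by (cases t t' rule: linorder_cases) auto
  with t(3) t'(3) show ?thesis by simp
qed

text \<open>The distance to the last marker is unique, so a position starts a block in at most one
  phase. Hence the sum over the phases contains the block cost at most once, whatever the position
  of the marker, and the block keeps its unconditioned law.\<close>

lemma sum_codeword_le:
  fixes cost :: "'b list option \<Rightarrow> real"
  assumes cost: "\<And>z. 0 \<le> cost z"
  shows "(\<Sum>\<phi><N. cost (codeword \<phi> s q)) \<le> cost (Some (g (map s [q..<q + N]))) + N * cost None"
proof -
  have "(\<Sum>\<phi><N. cost (codeword \<phi> s q))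
     \<le> (\<Sum>\<phi><N. (if start \<phi> s q then cost (Some (g (map s [q..<q + N]))) else 0) + cost None)"
    using cost by (intro sum_mono) (auto simp: codeword_def)
  also have "\<dots> = (\<Sum>\<phi><N. if start \<phi> s q then cost (Some (g (map s [q..<q + N]))) else 0) + N * cost None"
    by (simp add: sum.distrib)
  also have "(\<Sum>\<phi><N. if start \<phi> s q then cost (Some (g (map s [q..<q + N]))) else 0)
     \<le> cost (Some (g (map s [q..<q + N])))"
  proof (cases "\<exists>\<phi>. start \<phi> s q")
    case True
    then obtain \<phi>0 where "start \<phi>0 s q" by blast
    then have "start \<phi> s q \<longleftrightarrow> \<phi> = \<phi>0" for \<phi> using start_unique by blast
    then show ?thesis using cost by simp
  qed (use cost in simp)
  finally show ?thesis by simp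
qed

text \<open>Positions where the phases need not be balanced: no marker within reach, or one so
  recent that it has restarted the count among the last \<open>N\<close> positions.\<close>

definition bad :: "(nat \<Rightarrow> 'a) \<Rightarrow> nat \<Rightarrow> bool" where
  "bad s q \<longleftrightarrow> (\<forall>\<tau>\<le>Lm. \<not> mark s (q - \<tau>)) \<or> (\<exists>\<tau><N. mark s (q - \<tau>))"

lemma start_iff:
  assumes "mark s (q - \<tau>)" "\<And>t. t < \<tau> \<Longrightarrow> \<not> mark s (q - t)" "\<tau> \<le> Lm" "j \<le> \<tau>"
  shows "start \<phi> s (q - j) \<longleftrightarrow> (\<tau> - j) mod N = \<phi>"
proof
  assume "(\<tau> - j) mod N = \<phi>"
  then show "start \<phi> s (q - j)"
    unfolding start_def using assms by (intro exI[of _ "\<tau> - j"]) (auto simp: diff_diff_eq)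
next
  assume "start \<phi> s (q - j)"
  then obtain t where t: "mark s (q - j - t)" "\<And>i. i < t \<Longrightarrow> \<not> mark s (q - j - i)" "t mod N = \<phi>"
    unfolding start_def by blast
  have "t = \<tau> - j"
  proof (rule linorder_cases[of t "\<tau> - j"])
    assume "t < \<tau> - j"
    then have "\<not> mark s (q - (j + t))" using assms(2)[of "j + t"] by simp
    with t(1) show ?thesis by (simp add: diff_diff_eq)
  next
    assume "\<tau> - j < t"
    then have "\<not> mark s (q - j - (\<tau> - j))" by (rule t(2))
    with assms(1,4) show ?thesis by (simp add: diff_diff_eq)
  qed
  with t(3) show "(\<tau> - j) mod N = \<phi>" by simp
qed

text \<open>With the last marker at distance \<tau>, where \<open>N \<le> \<tau> \<le> Lm\<close>,
  the distances seen from the last \<open>N\<close> positions run through all residues modulo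
  \<open>N\<close>. So for each \<open>j < N\<close> exactly one phase has its latest block start
  \<open>j\<close> positions back, and the sum over the phases becomes a sum over
  \<open>j\<close>.\<close>

lemma sum_output_le:
  fixes dd :: "'b \<Rightarrow> real" and B :: real
  assumes dd: "\<And>y. 0 \<le> dd y" "\<And>y. dd y \<le> B"
  shows "(\<Sum>\<phi><N. dd (out_letter \<phi> s q))
     \<le> (\<Sum>j<N. dd (g (map s [q - j..<q - j + N]) ! j)) + N * B * of_bool (bad s q)"
proof (cases "bad s q")
  case True
  have "(\<Sum>\<phi><N. dd (out_letter \<phi> s q)) \<le> (\<Sum>\<phi><N. B)" by (intro sum_mono) (rule dd(2))
  moreover have "0 \<le> (\<Sum>j<N. dd (g (map s [q - j..<q - j + N]) ! j))" by (intro sum_nonneg dd)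
  ultimately show ?thesis using True by simp
next
  case False
  then obtain \<tau>' where \<tau>': "\<tau>' \<le> Lm" "mark s (q - \<tau>')" by (auto simp: bad_def)
  define \<tau> where "\<tau> = (LEAST t. mark s (q - t))"
  have mark: "mark s (q - \<tau>)" unfolding \<tau>_def by (rule LeastI[of "\<lambda>t. mark s (q - t)", OF \<tau>'(2)])
  have before: "\<not> mark s (q - t)" if "t < \<tau>" for t
    using that not_less_Least unfolding \<tau>_def by blast
  have "\<tau> \<le> \<tau>'" unfolding \<tau>_def by (rule Least_le[of "\<lambda>t. mark s (q - t)", OF \<tau>'(2)])
  then have \<tau>Lm: "\<tau> \<le> Lm" using \<tau>'(1) by simp
  have N\<tau>: "N \<le> \<tau>" using False mark unfolding bad_def by (meson not_le)
  have st: "start \<phi> s (q - j) \<longleftrightarrow> (\<tau> - j) mod N = \<phi>" if "j < N" for j \<phi>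
    using that N\<tau> by (intro start_iff mark before \<tau>Lm) auto
  let ?h = "\<lambda>j. (\<tau> - j) mod N"
  have inj: "inj_on ?h {..<N}"
  proof (rule linorder_inj_onI)
    fix i j assume ij: "i < j" "i \<in> {..<N}" "j \<in> {..<N}"
    show "?h i \<noteq> ?h j"
    proof
      assume "?h i = ?h j"
      then have "N dvd (\<tau> - i) - (\<tau> - j)" using mod_eq_dvd_iff_nat[of "\<tau> - j" "\<tau> - i" N] ij N\<tau> by auto
      moreover have "(\<tau> - i) - (\<tau> - j) = j - i" using ij N\<tau> by auto
      ultimately show False using ij by (auto dest: dvd_imp_le)
    qed
  qed auto
  have sub: "?h ` {..<N} \<subseteq> {..<N}" using N by auto
  then have bij: "bij_betw ?h {..<N} {..<N}"
    using inj by (simp add: bij_betw_def endo_inj_surj)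
  have out: "out_letter (?h j) s q = g (map s [q - j..<q - j + N]) ! j" if j: "j < N" for j
  proof -
    have cw: "codeword (?h j) s (q - i) = None" if "i < j" for i
      using inj_onD[OF inj, of i j] that j by (auto simp: codeword_def st)
    have cwj: "codeword (?h j) s (q - j) = Some (g (map s [q - j..<q - j + N]))"
      using j by (simp add: codeword_def st)
    have "(LEAST i. codeword (?h j) s (q - i) \<noteq> None) = j"
    proof (rule Least_equality)
      fix i assume "codeword (?h j) s (q - i) \<noteq> None"
      then show "j \<le> i" using cw by (meson not_le)
    qed (simp add: cwj)
    then show ?thesis unfolding out_letter_def decode_def using j cwj by auto
  qed
  have "(\<Sum>\<phi><N. dd (out_letter \<phi> s q)) = (\<Sum>j<N. dd (out_letter (?h j) s q))"
    by (rule sum.reindex_bij_betw[OF bij, symmetric])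
  also have "\<dots> = (\<Sum>j<N. dd (g (map s [q - j..<q - j + N]) ! j))"
    by (intro sum.cong) (auto simp: out)
  finally show ?thesis using False by simp
qed

end

section \<open>Cost of marker codes averaged over the phases\<close>

context recurrent_problem
begin

definition d_max :: real where "d_max = Max (range (case_prod d))"

lemma d_le_max: "d x y \<le> d_max"
  unfolding d_max_def by (intro Max_ge) (auto intro!: image_eqI[of _ _ "(x, y)"])

lemma d_max_nonneg: "0 \<le> d_max"
  using d_nonneg[of undefined undefined] d_le_max[of undefined undefined] by linarith

lemma prob_marginal:
  assumes "q + l \<le> n"
  shows "measure_pmf.prob (p n) {xs. P (take l (drop q xs))} = measure_pmf.prob (p l) {xs. P xs}"
  unfolding marginal[OF assms, symmetric] by (simp add: vimage_def)

lemma in_set_block_marginal: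
  assumes "q + l \<le> n" "xs \<in> set_pmf (p n)"
  shows "take l (drop q xs) \<in> set_pmf (p l)"
  unfolding marginal[OF assms(1), symmetric] using assms(2) by auto

lemma nth_take_drop_upt:
  "q + l \<le> length xs \<Longrightarrow> take l (drop q xs) = map (nth xs) [q..<q + l]"
  by (intro nth_equalityI) auto

text \<open>The sequence of codewords, mostly \<open>None\<close>, is compared with independent
  symbols of law \<open>r\<close>. Per letter, announcing a start costs \<open>log 2 N / N\<close>
  and the absence of a start \<open>log 2 (N / (N - 1))\<close>; bad positions have probability at
  most \<open>2 * \<eta>\<close>, and \<open>\<epsilon>\<close> absorbs the boundary. These bounds
  hold for the average over the phases, hence for some phase.\<close>

lemma marker_good_code:
  fixes u :: "'a list" and g :: "'a list \<Rightarrow> 'b list" and \<rho> :: "'b list pmf"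
  assumes N: "2 \<le> N" and \<alpha>: "0 \<le> \<alpha>" and \<epsilon>: "0 < \<epsilon>"
    and g: "\<And>xs. xs \<in> set_pmf (p N) \<Longrightarrow> g xs \<in> set_pmf \<rho>"
    and rare: "pmf (p (length u)) u \<le> \<eta> / N"
    and recurs: "measure_pmf.prob (p (Lm + length u)) {xs. \<forall>i<Lm. take (length u) (drop i xs) \<noteq> u} \<le> \<eta>"
  shows "\<exists>m F j q. good_code \<alpha>
     (expect (p N) (\<lambda>xs. - log 2 (pmf \<rho> (g xs)) + \<alpha> * (N * dist_n d xs (g xs))) / N
       + log 2 N / N + log 2 (real N / (real N - 1)) + \<alpha> * (d_max * (2 * \<eta>)) + \<epsilon>) m F j q"
proof -
  interpret marker_code u N Lm g by standard (rule N)
  define m where "m = margin"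
  have mm: "Lm + N + length u = m" by (simp add: m_def margin_def)
  \<comment> \<open>A start is given probability \<open>1 / N\<close>, the frequency of block starts
    averaged over the phases.\<close>
  define r :: "'b list option pmf" where
    "r = bind_pmf (bernoulli_pmf (1 / N)) (\<lambda>c. if c then map_pmf Some \<rho> else return_pmf None)"
  have N1: "0 \<le> 1 / real N" "1 / real N \<le> 1" "0 < real N" "1 < real N" using N by auto
  have rN: "1 - 1 / N \<le> pmf r None"
    using pmf_bind_ge[of "bernoulli_pmf (1 / N)" False "\<lambda>c. if c then map_pmf Some \<rho> else return_pmf None" None] N1
    by (simp add: r_def)
  have rS: "1 / N * pmf \<rho> ys \<le> pmf r (Some ys)" for ys
    using pmf_bind_ge[of "bernoulli_pmf (1 / N)" True "\<lambda>c. if c then map_pmf Some \<rho> else return_pmf None" "Some ys"] N1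
      pmf_map_inj'[of Some \<rho> ys] by (simp add: r_def)
  define cost where "cost = (\<lambda>z. - log 2 (pmf r z))"
  have cost0: "0 \<le> cost z" for z
  proof (cases "pmf r z = 0")
    case False
    then show ?thesis using pmf_le_1[of r z] pmf_nonneg[of r z] by (simp add: cost_def)
  qed (simp add: cost_def log_def)
  have rNpos: "0 < 1 - 1 / real N" using N1 by simp
  have costN: "cost None \<le> log 2 (real N / (real N - 1))"
  proof -
    have "log 2 (1 - 1 / N) \<le> log 2 (pmf r None)" using rN rNpos by (subst log_le_cancel_iff) linarith+
    moreover have "1 - 1 / real N = (real N - 1) / N" using N1 by (simp add: diff_divide_distrib)
    ultimately show ?thesis using N N1 by (simp add: cost_def log_divide of_nat_diff)
  qed
  have costS: "cost (Some (g ys)) \<le> - log 2 (pmf \<rho> (g ys)) + log 2 N" and rSpos: "0 < pmf r (Some (g ys))"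
    if "ys \<in> set_pmf (p N)" for ys
  proof -
    have pos: "0 < 1 / real N * pmf \<rho> (g ys)" using g[OF that] N1 by (simp add: pmf_positive)
    with rS[of "g ys"] show "0 < pmf r (Some (g ys))" by linarith
    have "log 2 (1 / N * pmf \<rho> (g ys)) \<le> log 2 (pmf r (Some (g ys)))"
      using rS[of "g ys"] pos by (subst log_le_cancel_iff) linarith+
    moreover have "log 2 (1 / N * pmf \<rho> (g ys)) = log 2 (pmf \<rho> (g ys)) - log 2 N"
      using g[OF that] N1 by (simp add: log_divide pmf_eq_0_set_pmf)
    ultimately show "cost (Some (g ys)) \<le> - log 2 (pmf \<rho> (g ys)) + log 2 N" by (simp add: cost_def)
  qed
  define C where "C = (\<lambda>\<phi>. expect (p margin) (\<lambda>xs. cost (codeword \<phi> (nth xs) Lm)))"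
  define F where "F = (\<lambda>\<phi> w. out_letter \<phi> (nth w) m)"
  define Dst where "Dst = (\<lambda>\<phi>. expect (p (2 * m + 1)) (\<lambda>xs. d (xs ! m) (F \<phi> xs)))"
  have C_eq: "expect (p n) (\<lambda>xs. cost (codeword \<phi> (nth xs) q)) = C \<phi>"
    if "Lm \<le> q" "q + margin \<le> n + Lm" for n q \<phi>
  proof -
    have "expect (p n) (\<lambda>xs. cost (codeword \<phi> (nth xs) q))
      = expect (p n) (\<lambda>xs. cost (codeword \<phi> (nth (take margin (drop (q - Lm) xs))) Lm))"
    proof (rule expectation_cong)
      fix xs assume "xs \<in> set_pmf (p n)"
      then have "length xs = n" by (rule length_block)
      then have "codeword \<phi> (nth xs) q = codeword \<phi> (nth (take margin (drop (q - Lm) xs))) Lm"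
        using that by (intro codeword_cong) auto
      then show "cost (codeword \<phi> (nth xs) q) = cost (codeword \<phi> (nth (take margin (drop (q - Lm) xs))) Lm)" by simp
    qed
    also have "\<dots> = C \<phi>" unfolding C_def using that by (intro expectation_marginal) simp
    finally show ?thesis .
  qed
  define Ex where "Ex = expect (p N) (\<lambda>xs. - log 2 (pmf \<rho> (g xs)))"
  define Ed where "Ed = expect (p N) (\<lambda>xs. N * dist_n d xs (g xs))"
  have sumC: "(\<Sum>\<phi><N. C \<phi>) \<le> Ex + log 2 N + N * log 2 (real N / (real N - 1))"
  proof -
    have "(\<Sum>\<phi><N. C \<phi>) = expect (p margin) (\<lambda>xs. \<Sum>\<phi><N. cost (codeword \<phi> (nth xs) Lm))"
      unfolding C_def by (subst Bochner_Integration.integral_sum) (auto simp: integrable_measure_pmf_finite finite_set_block)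
    also have "\<dots> \<le> expect (p margin) (\<lambda>xs. cost (Some (g (take N (drop Lm xs)))) + N * cost None)"
    proof (rule expectation_mono_finite[OF finite_set_block])
      fix xs assume "xs \<in> set_pmf (p margin)"
      then have "length xs = margin" by (rule length_block)
      then have "take N (drop Lm xs) = map (nth xs) [Lm..<Lm + N]" by (intro nth_take_drop_upt) (simp add: margin_def)
      then show "(\<Sum>\<phi><N. cost (codeword \<phi> (nth xs) Lm)) \<le> cost (Some (g (take N (drop Lm xs)))) + N * cost None"
        using sum_codeword_le[OF cost0, where s = "nth xs" and q = Lm] by simp
    qed
    also have "\<dots> = expect (p N) (\<lambda>xs. cost (Some (g xs)) + N * cost None)"
      by (rule expectation_marginal) (simp add: margin_def)
    also have "\<dots> \<le> expect (p N) (\<lambda>xs. 1 * (- log 2 (pmf \<rho> (g xs))) + (log 2 N + N * log 2 (real N / (real N - 1))))"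
    proof (rule expectation_mono_finite[OF finite_set_block])
      fix xs assume xs: "xs \<in> set_pmf (p N)"
      have "N * cost None \<le> N * log 2 (real N / (real N - 1))" using costN by (rule mult_left_mono) simp
      with costS[OF xs] show "cost (Some (g xs)) + N * cost None
          \<le> 1 * (- log 2 (pmf \<rho> (g xs))) + (log 2 N + N * log 2 (real N / (real N - 1)))" by linarith
    qed
    also have "\<dots> = 1 * Ex + (log 2 N + N * log 2 (real N / (real N - 1)))"
      unfolding Ex_def by (rule expectation_affine[OF finite_set_block])
    finally show ?thesis by simp
  qed
  have mark_take: "mark (nth xs) q \<longleftrightarrow> take (length u) (drop q xs) = u" if "q + length u \<le> length xs" for xs q
    using nth_take_drop_upt[OF that] by (simp add: mark_def)
  \<comment> \<open>Recurrence bounds the event of no marker within reach; a union bound over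
    \<open>N\<close> positions with \<open>rare\<close> bounds the event of a recent one.\<close>
  have prob_bad: "measure_pmf.prob (p (2 * m + 1)) {xs. bad (nth xs) m} \<le> 2 * \<eta>"
  proof -
    let ?P = "measure_pmf.prob (p (2 * m + 1))"
    let ?A = "{xs. \<forall>i<Lm. take (length u) (drop i (take (Lm + length u) (drop (m - Lm) xs))) \<noteq> u}"
    let ?B = "\<lambda>\<tau>. {xs. take (length u) (drop (m - \<tau>) xs) = u}"
    have "?P {xs. bad (nth xs) m} \<le> ?P (?A \<union> (\<Union>\<tau><N. ?B \<tau>))"
    proof (rule measure_pmf.finite_measure_mono_AE)
      show "AE xs in p (2 * m + 1). xs \<in> {xs. bad (nth xs) m} \<longrightarrow> xs \<in> ?A \<union> (\<Union>\<tau><N. ?B \<tau>)"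
      proof (rule AE_pmfI, intro impI)
        fix xs assume "xs \<in> set_pmf (p (2 * m + 1))" and b: "xs \<in> {xs. bad (nth xs) m}"
        then have len: "length xs = 2 * m + 1" by (intro length_block)
        have mk: "mark (nth xs) (m - \<tau>) \<longleftrightarrow> take (length u) (drop (m - \<tau>) xs) = u" for \<tau>
          using len mm by (intro mark_take) auto
        show "xs \<in> ?A \<union> (\<Union>\<tau><N. ?B \<tau>)"
        proof (cases "\<exists>\<tau><N. mark (nth xs) (m - \<tau>)")
          case True
          then show ?thesis using mk by auto
        next
          case False
          then have no: "\<not> mark (nth xs) (m - \<tau>)" if "\<tau> \<le> Lm" for \<tau> using b that by (auto simp: bad_def)
          have "take (length u) (drop i (take (Lm + length u) (drop (m - Lm) xs))) \<noteq> u" if "i < Lm" for i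
          proof -
            have "m - (Lm - i) = i + (m - Lm)" using that mm by simp
            moreover have "take (length u) (drop i (take (Lm + length u) (drop (m - Lm) xs))) = take (length u) (drop (i + (m - Lm)) xs)"
              using that by (simp add: drop_take min_def)
            ultimately show ?thesis using no[of "Lm - i"] mk[of "Lm - i"] by simp
          qed
          then show ?thesis by simp
        qed
      qed
    qed simp
    also have "\<dots> \<le> ?P ?A + ?P (\<Union>\<tau><N. ?B \<tau>)" by (rule measure_Un_le) auto
    also have "?P (\<Union>\<tau><N. ?B \<tau>) \<le> (\<Sum>\<tau><N. ?P (?B \<tau>))" by (rule measure_UNION_le) auto
    also have "\<dots> = (\<Sum>\<tau><N. pmf (p (length u)) u)"
    proof (rule sum.cong[OF refl])
      fix \<tau>
      have "?P (?B \<tau>) = measure_pmf.prob (p (length u)) {xs. xs = u}"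
        using mm by (intro prob_marginal[of _ _ _ "\<lambda>ys. ys = u"]) auto
      then show "?P (?B \<tau>) = pmf (p (length u)) u" by (simp add: measure_pmf_single)
    qed
    also have "\<dots> = N * pmf (p (length u)) u" by simp
    also have "\<dots> \<le> N * (\<eta> / N)" using rare by (rule mult_left_mono) simp
    also have "\<dots> = \<eta>" using N1 by simp
    also have "?P ?A = measure_pmf.prob (p (Lm + length u)) {xs. \<forall>i<Lm. take (length u) (drop i xs) \<noteq> u}"
      using mm by (intro prob_marginal[of _ _ _ "\<lambda>ys. \<forall>i<Lm. take (length u) (drop i ys) \<noteq> u"]) auto
    also have "\<dots> + \<eta> \<le> 2 * \<eta>" using recurs by simp
    finally show ?thesis by simp
  qed
  have sumD: "(\<Sum>\<phi><N. Dst \<phi>) \<le> Ed + N * (d_max * (2 * \<eta>))"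
  proof -
    let ?P = "p (2 * m + 1)"
    let ?h = "\<lambda>j ys. d (ys ! j) (g ys ! j)"
    have "(\<Sum>\<phi><N. Dst \<phi>) = expect ?P (\<lambda>xs. \<Sum>\<phi><N. d (xs ! m) (F \<phi> xs))"
      unfolding Dst_def by (subst Bochner_Integration.integral_sum) (auto simp: integrable_measure_pmf_finite finite_set_block)
    also have "\<dots> \<le> expect ?P (\<lambda>xs. (\<Sum>j<N. ?h j (take N (drop (m - j) xs)))
        + N * d_max * indicator {xs. bad (nth xs) m} xs)"
    proof (rule expectation_mono_finite[OF finite_set_block])
      fix xs assume "xs \<in> set_pmf ?P"
      then have len: "length xs = 2 * m + 1" by (rule length_block)
      have "(\<Sum>\<phi><N. d (xs ! m) (F \<phi> xs)) \<le> (\<Sum>j<N. d (xs ! m) (g (map (nth xs) [m - j..<m - j + N]) ! j))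
         + N * d_max * of_bool (bad (nth xs) m)"
        unfolding F_def by (rule sum_output_le) (rule d_nonneg, rule d_le_max)
      also have "(\<Sum>j<N. d (xs ! m) (g (map (nth xs) [m - j..<m - j + N]) ! j)) = (\<Sum>j<N. ?h j (take N (drop (m - j) xs)))"
      proof (rule sum.cong[OF refl])
        fix j assume "j \<in> {..<N}"
        then have j: "j < N" "j \<le> m" using mm by auto
        have "take N (drop (m - j) xs) = map (nth xs) [m - j..<m - j + N]"
          using len j mm by (intro nth_take_drop_upt) auto
        moreover have "take N (drop (m - j) xs) ! j = xs ! m" using len j by simp
        ultimately show "d (xs ! m) (g (map (nth xs) [m - j..<m - j + N]) ! j) = ?h j (take N (drop (m - j) xs))" by simp
      qed
      finally show "(\<Sum>\<phi><N. d (xs ! m) (F \<phi> xs)) \<le> (\<Sum>j<N. ?h j (take N (drop (m - j) xs)))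
        + N * d_max * indicator {xs. bad (nth xs) m} xs" by (simp add: indicator_def)
    qed
    also have "\<dots> = (\<Sum>j<N. expect ?P (\<lambda>xs. ?h j (take N (drop (m - j) xs))))
        + N * d_max * measure_pmf.prob ?P {xs. bad (nth xs) m}"
      by (simp add: integrable_measure_pmf_finite finite_set_block)
    also have "(\<Sum>j<N. expect ?P (\<lambda>xs. ?h j (take N (drop (m - j) xs))))
        = (\<Sum>j<N. expect (p N) (?h j))"
    proof (rule sum.cong[OF refl])
      fix j assume "j \<in> {..<N}"
      show "expect ?P (\<lambda>xs. ?h j (take N (drop (m - j) xs))) = expect (p N) (?h j)"
        using mm by (intro expectation_marginal) auto
    qed
    also have "\<dots> = expect (p N) (\<lambda>xs. \<Sum>j<N. ?h j xs)"
      by (subst Bochner_Integration.integral_sum) (auto simp: integrable_measure_pmf_finite finite_set_block)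
    also have "\<dots> = Ed"
      unfolding Ed_def by (rule expectation_cong) (use N in \<open>auto simp: dist_n_def dest!: length_block\<close>)
    also have "N * d_max * measure_pmf.prob ?P {xs. bad (nth xs) m} \<le> N * d_max * (2 * \<eta>)"
      using prob_bad d_max_nonneg by (intro mult_left_mono) auto
    finally show ?thesis by (simp add: mult.assoc)
  qed
  define T where "T = Ex / N + log 2 N / N + log 2 (real N / (real N - 1)) + \<alpha> * (Ed / N + d_max * (2 * \<eta>))"
  have "\<exists>\<phi><N. C \<phi> + \<alpha> * Dst \<phi> \<le> T"
  proof (rule ccontr)
    assume neg: "\<not> ?thesis"
    have "T < C \<phi> + \<alpha> * Dst \<phi>" if "\<phi> < N" for \<phi> using neg that by (meson not_le)
    then have "(\<Sum>\<phi><N. T) < (\<Sum>\<phi><N. C \<phi> + \<alpha> * Dst \<phi>)" using N by (intro sum_strict_mono) (auto simp: lessThan_empty_iff)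
    also have "\<dots> = (\<Sum>\<phi><N. C \<phi>) + \<alpha> * (\<Sum>\<phi><N. Dst \<phi>)" by (simp add: sum.distrib sum_distrib_left)
    also have "\<dots> \<le> (Ex + log 2 N + N * log 2 (real N / (real N - 1))) + \<alpha> * (Ed + N * (d_max * (2 * \<eta>)))"
      using \<alpha> by (intro add_mono sumC mult_left_mono sumD)
    also have "\<dots> = N * T"
    proof -
      have "real N * (Ex / N) = Ex" "real N * (log 2 N / N) = log 2 N" "real N * (Ed / N) = Ed" using N1 by auto
      then show ?thesis unfolding T_def using N1 by (simp add: distrib_left mult.left_commute[of "real N" \<alpha>])
    qed
    finally show False by simp
  qed
  then obtain \<phi> where \<phi>: "C \<phi> + \<alpha> * Dst \<phi> \<le> T" by blast
  have C0: "0 \<le> C \<phi>" unfolding C_def by (intro expectation_ge_const finite_set_block cost0)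
  \<comment> \<open>A run of \<open>L\<close> outputs is a function of \<open>N - 1 + L\<close>
    codewords; this \<open>L\<close> makes the \<open>N - 1\<close> additional ones cost at most
    \<open>\<epsilon>\<close> per letter.\<close>
  define L where "L = nat \<lceil>(N - 1) * C \<phi> / \<epsilon>\<rceil> + 1"
  have L: "1 \<le> L" "(N - 1) * C \<phi> \<le> L * \<epsilon>"
  proof -
    have "(N - 1) * C \<phi> / \<epsilon> \<le> L" unfolding L_def by linarith
    from mult_right_mono[OF this, of \<epsilon>] show "(N - 1) * C \<phi> \<le> L * \<epsilon>" using \<epsilon> by simp
  qed (simp add: L_def)
  define K where "K = N - 1 + L"
  define outs where "outs = (\<lambda>zs. map (\<lambda>i. decode (\<lambda>j. zs ! (N - 1 + i - j))) [0..<L])"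
  \<comment> \<open>The image of the product law under decoding; an output word has at least the
    probability of any codeword list producing it.\<close>
  define R where "R = map_pmf outs (replicate_pmf K r)"
  define zs where "zs = (\<lambda>xs. map (\<lambda>i. codeword \<phi> (nth xs) (m - (N - 1) + i)) [0..<K])"
  have co: "code_outputs m (F \<phi>) L xs = outs (zs xs)" if "xs \<in> set_pmf (p (2 * m + L))" for xs
  proof -
    have len: "length xs = 2 * m + L" using that by (rule length_block)
    show ?thesis
    proof (rule nth_equalityI)
      fix i assume "i < length (code_outputs m (F \<phi>) L xs)"
      then have i: "i < L" by (simp add: code_outputs_def)
      have "code_outputs m (F \<phi>) L xs ! i = out_letter \<phi> (nth (take (2 * m + 1) (drop i xs))) m"
        using i by (simp add: code_outputs_def F_def)
      also have "\<dots> = out_letter \<phi> (nth xs) (m + i)"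
        using len i mm by (intro out_letter_cong) (auto simp: m_def margin_def algebra_simps)
      also have "\<dots> = decode (\<lambda>j. zs xs ! (N - 1 + i - j))"
        unfolding out_letter_def
      proof (rule decode_cong)
        fix j assume j: "j < N"
        have "m - (N - 1) + (N - 1 + i - j) = m + i - j" "N - 1 + i - j < K" using j i mm N by (auto simp: K_def)
        then show "codeword \<phi> (nth xs) (m + i - j) = zs xs ! (N - 1 + i - j)" by (simp add: zs_def)
      qed
      finally show "code_outputs m (F \<phi>) L xs ! i = outs (zs xs) ! i" using i by (simp add: outs_def)
    qed (simp add: code_outputs_def outs_def)
  qed
  have zs_pos: "0 < pmf r (zs xs ! i)" if "i < K" "xs \<in> set_pmf (p (2 * m + L))" for i xs
  proof -
    let ?q = "m - (N - 1) + i"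
    have len: "length xs = 2 * m + L" using that(2) by (rule length_block)
    have q: "?q + N \<le> 2 * m + L" using that(1) mm by (simp add: K_def)
    then have "map (nth xs) [?q..<?q + N] \<in> set_pmf (p N)"
      using in_set_block_marginal[OF q that(2)] nth_take_drop_upt[of ?q N xs] len by simp
    from rSpos[OF this] rN rNpos show ?thesis using that(1) by (auto simp: zs_def codeword_def)
  qed
  have lenzs: "length (zs xs) = K" for xs by (simp add: zs_def)
  have costR: "0 < pmf R (code_outputs m (F \<phi>) L xs)"
    "- log 2 (pmf R (code_outputs m (F \<phi>) L xs)) \<le> (\<Sum>i<K. cost (codeword \<phi> (nth xs) (m - (N - 1) + i)))"
    if xs: "xs \<in> set_pmf (p (2 * m + L))" for xs
  proof -
    note lr = log_pmf_replicate_pmf[of "zs xs" r, unfolded lenzs, OF zs_pos[OF _ xs]]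
    have le: "pmf (replicate_pmf K r) (zs xs) \<le> pmf R (code_outputs m (F \<phi>) L xs)"
      unfolding R_def co[OF xs] using pmf_map_ge_sum[of "{zs xs}" outs "outs (zs xs)" "replicate_pmf K r"] by simp
    with lr(1) show pos: "0 < pmf R (code_outputs m (F \<phi>) L xs)" by linarith
    have "log 2 (pmf (replicate_pmf K r) (zs xs)) \<le> log 2 (pmf R (code_outputs m (F \<phi>) L xs))"
      using le lr(1) pos by (subst log_le_cancel_iff) linarith+
    with lr(2) show "- log 2 (pmf R (code_outputs m (F \<phi>) L xs)) \<le> (\<Sum>i<K. cost (codeword \<phi> (nth xs) (m - (N - 1) + i)))"
      by (simp add: zs_def cost_def)
  qed
  obtain j and q :: "'b list \<Rightarrow> 'b \<Rightarrow> real" where q: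
    "\<And>s b. 0 \<le> q s b" "\<And>s. (\<Sum>b\<in>UNIV. q s b) \<le> 1"
    "\<And>xs. xs \<in> set_pmf (p (2 * m + j + 1)) \<Longrightarrow> 0 < q (code_outputs m (F \<phi>) j xs) (code_outputs m (F \<phi>) (j + 1) xs ! j)"
    "expect (p (2 * m + j + 1))
       (\<lambda>xs. - log 2 (q (code_outputs m (F \<phi>) j xs) (code_outputs m (F \<phi>) (j + 1) xs ! j))) \<le> K * C \<phi> / L"
  proof (rule kernel_from_block_law[OF L(1), of R m "F \<phi>" "K * C \<phi>"])
    show "length ys = L" if "ys \<in> set_pmf R" for ys using that by (auto simp: R_def outs_def)
    show "code_outputs m (F \<phi>) L xs \<in> set_pmf R" if "xs \<in> set_pmf (p (2 * m + L))" for xs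
      using costR(1)[OF that] by (simp add: pmf_positive_iff)
    have "expect (p (2 * m + L)) (\<lambda>xs. - log 2 (pmf R (code_outputs m (F \<phi>) L xs)))
        \<le> expect (p (2 * m + L)) (\<lambda>xs. \<Sum>i<K. cost (codeword \<phi> (nth xs) (m - (N - 1) + i)))"
      by (intro expectation_mono_finite finite_set_block costR)
    also have "\<dots> = (\<Sum>i<K. expect (p (2 * m + L)) (\<lambda>xs. cost (codeword \<phi> (nth xs) (m - (N - 1) + i))))"
      by (subst Bochner_Integration.integral_sum) (auto simp: integrable_measure_pmf_finite finite_set_block)
    also have "\<dots> = (\<Sum>i<K. C \<phi>)"
      using mm by (intro sum.cong refl C_eq) (auto simp: K_def m_def)
    finally show "expect (p (2 * m + L)) (\<lambda>xs. - log 2 (pmf R (code_outputs m (F \<phi>) L xs))) \<le> K * C \<phi>"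
      by simp
  qed blast
  have "K * C \<phi> / L = C \<phi> + (N - 1) * C \<phi> / L"
  proof -
    have "real K = real L + (real N - 1)" using N by (simp add: K_def of_nat_diff)
    then have "K * C \<phi> / L = (L * C \<phi> + (real N - 1) * C \<phi>) / L" by (simp add: distrib_right)
    also have "\<dots> = C \<phi> + (real N - 1) * C \<phi> / L" using L(1) by (simp add: add_divide_distrib)
    finally show ?thesis using N by (simp add: of_nat_diff)
  qed
  also have "(N - 1) * C \<phi> / L \<le> L * \<epsilon> / L" by (rule divide_right_mono[OF L(2)]) simp
  also have "L * \<epsilon> / L = \<epsilon>" using L(1) by simp
  finally have "K * C \<phi> / L \<le> C \<phi> + \<epsilon>" by simp
  with q(4) \<phi> have "expect (p (2 * m + j + 1))
       (\<lambda>xs. - log 2 (q (code_outputs m (F \<phi>) j xs) (code_outputs m (F \<phi>) (j + 1) xs ! j))) + \<alpha> * Dst \<phi> \<le> T + \<epsilon>"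
    by linarith
  moreover have "T = expect (p N) (\<lambda>xs. - log 2 (pmf \<rho> (g xs)) + \<alpha> * (N * dist_n d xs (g xs))) / N
       + log 2 N / N + log 2 (real N / (real N - 1)) + \<alpha> * (d_max * (2 * \<eta>))"
    unfolding T_def Ex_def Ed_def
    by (simp add: integrable_measure_pmf_finite finite_set_block add_divide_distrib diff_divide_distrib distrib_left)
  ultimately have "good_code \<alpha> (expect (p N) (\<lambda>xs. - log 2 (pmf \<rho> (g xs)) + \<alpha> * (N * dist_n d xs (g xs))) / N
       + log 2 N / N + log 2 (real N / (real N - 1)) + \<alpha> * (d_max * (2 * \<eta>)) + \<epsilon>) m (F \<phi>) j q"
    unfolding good_code_def Dst_def using q(1-3) by simp
  then show ?thesis by blast
qed

lemma good_code_mono: "good_code \<alpha> c m F j q \<Longrightarrow> c \<le> c' \<Longrightarrow> good_code \<alpha> c' m F j q"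
  unfolding good_code_def by (meson order_trans)

theorem good_code_exists:
  assumes \<alpha>: "0 < \<alpha>" and D: "D_min \<le> D" and \<epsilon>: "0 < \<epsilon>"
  shows "\<exists>m F j q. good_code \<alpha> (rate D + \<alpha> * D + \<epsilon>) m F j q"
proof (cases "\<exists>\<delta>>0. \<forall>l u. u \<in> set_pmf (p l) \<longrightarrow> \<delta> \<le> pmf (p l) u")
  case True
  then show ?thesis using good_code_few_words[OF _ _ \<alpha> D \<epsilon>] by blast
next
  case False
  \<comment> \<open>Five shares are spent: on the overhead \<open>e N\<close>, on the distance of
    \<open>rate_n\<close> from \<open>rate\<close>, on the choice of \<open>W\<close>, on bad
    positions and on the boundary.\<close>
  define \<epsilon>' where "\<epsilon>' = \<epsilon> / 6"
  have \<epsilon>': "0 < \<epsilon>'" using \<epsilon> by (simp add: \<epsilon>'_def)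
  define a where "a = ln (real CARD('a))"
  have a0: "0 \<le> a" by (simp add: a_def)
  define \<kappa> where "\<kappa> = \<alpha> * d_max"
  have \<kappa>0: "0 \<le> \<kappa>" using \<alpha> d_max_nonneg by (simp add: \<kappa>_def)
  \<comment> \<open>The overhead per letter of the one-shot code and of the markers, with
    \<open>\<kappa> * n\<close> as bound on the block cost and \<open>n * a\<close> on the logarithm
    of the number of blocks.\<close>
  define e where "e = (\<lambda>n::nat. (log 2 (\<kappa> * n + 1) + 1 + log 2 (1 + n * a)) / n + log 2 n / n + log 2 (real n / (real n - 1)))"
  have "e \<longlonglongrightarrow> 0"
  proof -
    have "(\<lambda>n::nat. log 2 (x * n + 1) / n) \<longlonglongrightarrow> 0" if "x \<ge> 0" for x :: real
    proof (cases "x = 0")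
      case False
      with that have "x > 0" by simp
      then show ?thesis by real_asymp
    qed simp
    note l = this
    have l3: "(\<lambda>n::nat. 1 / real n) \<longlonglongrightarrow> 0" "(\<lambda>n::nat. log 2 n / n) \<longlonglongrightarrow> 0" by real_asymp+
    have l4: "(\<lambda>n::nat. log 2 (real n / (real n - 1))) \<longlonglongrightarrow> 0" by real_asymp
    have "(\<lambda>n::nat. (log 2 (\<kappa> * n + 1) / n + 1 / n + log 2 (a * n + 1) / n) + log 2 n / n + log 2 (real n / (real n - 1)))
        \<longlonglongrightarrow> (0 + 0 + 0) + 0 + 0"
      by (intro tendsto_add l l3 l4 \<kappa>0 a0)
    then show ?thesis by (simp add: e_def add_divide_distrib add.commute mult.commute)
  qed
  then have ev: "\<forall>\<^sub>F n in sequentially. e n < \<epsilon>'" using \<epsilon>' by (intro order_tendstoD(2))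
  have "\<forall>\<^sub>F n in sequentially. rate_n n D < rate D + \<epsilon>'"
    using \<epsilon>' by (intro order_tendstoD(2)[OF rate_n_tendsto[OF D]]) simp
  then have "\<forall>\<^sub>F n in sequentially. e n < \<epsilon>' \<and> rate_n n D < rate D + \<epsilon>' \<and> 2 \<le> n"
    using ev eventually_ge_at_top[of 2] by eventually_elim simp
  then obtain N where N: "e N < \<epsilon>'" "rate_n N D < rate D + \<epsilon>'" "2 \<le> N" by (auto simp: eventually_sequentially)
  have N1: "1 \<le> N" using N(3) by simp
  obtain W where W: "W \<in> test_channels N" "distortion N W \<le> D" "information N W / N < rate_n N D + \<epsilon>'"
    using rate_n_approx[OF N1 D \<epsilon>'] .
  define c where "c = (\<lambda>xs ys. \<alpha> * (N * dist_n d xs ys))"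
  have c: "0 \<le> c xs ys \<and> c xs ys \<le> \<kappa> * N" if "xs \<in> set_pmf (p N)" for xs ys
  proof -
    have len: "length xs = N" using that by (rule length_block)
    then have dN: "N * dist_n d xs ys = (\<Sum>i<N. d (xs ! i) (ys ! i))" using N1 by (simp add: dist_n_def)
    have "(\<Sum>i<N. d (xs ! i) (ys ! i)) \<le> (\<Sum>i<N. d_max)" by (intro sum_mono d_le_max)
    moreover have "0 \<le> (\<Sum>i<N. d (xs ! i) (ys ! i))" by (intro sum_nonneg d_nonneg)
    ultimately show ?thesis using \<alpha> unfolding c_def dN by (simp add: \<kappa>_def mult.commute mult.left_commute)
  qed
  obtain g :: "'a list \<Rightarrow> 'b list" and \<rho> where
    g: "\<And>xs. xs \<in> set_pmf (p N) \<Longrightarrow> g xs \<in> set_pmf \<rho> \<and> g xs \<in> set_pmf (bind_pmf (p N) W)"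
    and cost: "expect (p N) (\<lambda>xs. - log 2 (pmf \<rho> (g xs)) + c xs (g xs))
      \<le> mutual_info (joint_pmf (p N) W) + expect (p N) (\<lambda>xs. expect (W xs) (c xs))
         + log 2 (\<kappa> * N + 1) + 1 + log 2 (1 + ln (card (set_pmf (p N))))"
    by (rule one_shot_code[OF finite_set_block finite_set_test_channel[OF W(1)], where c = c and S = "\<kappa> * N"]) (use c in auto)
  have "expect (p N) (\<lambda>xs. expect (W xs) (c xs)) = \<alpha> * (N * distortion N W)"
    by (simp add: c_def distortion_def)
  also have "\<dots> \<le> \<alpha> * (N * D)" using W(2) \<alpha> by (intro mult_left_mono) auto
  finally have Ec: "expect (p N) (\<lambda>xs. expect (W xs) (c xs)) \<le> \<alpha> * (N * D)" .
  have lncard: "0 \<le> ln (card (set_pmf (p N)))" "ln (card (set_pmf (p N))) \<le> N * a"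
  proof -
    have "card (set_pmf (p N)) \<le> card {xs :: 'a list. length xs = N}"
      by (intro card_mono finite_lists_length) (auto dest: length_block)
    also have "\<dots> = CARD('a) ^ N" using card_lists_length_eq[of "UNIV :: 'a set" N] by simp
    finally have "real (card (set_pmf (p N))) \<le> real CARD('a) ^ N" by (metis of_nat_le_iff of_nat_power)
    moreover have 1: "1 \<le> card (set_pmf (p N))"
      using finite_set_block[of N] set_pmf_not_empty[of "p N"] by (simp add: Suc_le_eq card_gt_0_iff)
    ultimately have "ln (card (set_pmf (p N))) \<le> ln (real CARD('a) ^ N)" by (intro ln_mono) auto
    then show "ln (card (set_pmf (p N))) \<le> N * a" by (simp add: a_def ln_realpow)
    show "0 \<le> ln (card (set_pmf (p N)))" using 1 by simp
  qed
  then have "log 2 (1 + ln (card (set_pmf (p N)))) \<le> log 2 (1 + N * a)" by simp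
  with cost Ec have "expect (p N) (\<lambda>xs. - log 2 (pmf \<rho> (g xs)) + c xs (g xs))
     \<le> information N W + \<alpha> * (N * D) + (log 2 (\<kappa> * N + 1) + 1 + log 2 (1 + N * a))"
    by (simp add: information_def)
  then have "expect (p N) (\<lambda>xs. - log 2 (pmf \<rho> (g xs)) + c xs (g xs)) / N
     \<le> (information N W + \<alpha> * (N * D) + (log 2 (\<kappa> * N + 1) + 1 + log 2 (1 + N * a))) / N"
    by (rule divide_right_mono) simp
  also have "\<dots> = information N W / N + \<alpha> * D + (log 2 (\<kappa> * N + 1) + 1 + log 2 (1 + N * a)) / N"
    using N1 by (simp add: add_divide_distrib)
  finally have main: "expect (p N) (\<lambda>xs. - log 2 (pmf \<rho> (g xs)) + c xs (g xs)) / N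
      + log 2 N / N + log 2 (real N / (real N - 1)) \<le> rate D + \<alpha> * D + 3 * \<epsilon>'"
    using W(3) N(1,2) unfolding e_def by linarith
  \<comment> \<open>The \<open>+ 1\<close> avoids division by zero when the distortion vanishes
    identically.\<close>
  define \<eta> where "\<eta> = \<epsilon>' / (2 * \<kappa> + 1)"
  have \<eta>: "0 < \<eta>" "\<alpha> * (d_max * (2 * \<eta>)) \<le> \<epsilon>'"
  proof -
    show "0 < \<eta>" using \<epsilon>' \<kappa>0 by (simp add: \<eta>_def)
    then have "2 * \<kappa> * \<eta> \<le> (2 * \<kappa> + 1) * \<eta>" by (intro mult_right_mono) auto
    also have "\<dots> = \<epsilon>'" using \<kappa>0 by (simp add: \<eta>_def)
    finally show "\<alpha> * (d_max * (2 * \<eta>)) \<le> \<epsilon>'" by (simp add: \<kappa>_def mult_ac)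
  qed
  have "0 < \<eta> / N" using \<eta> N1 by simp
  \<comment> \<open>The marker is chosen after \<open>N\<close>, as its probability must be below
    \<open>\<eta> / N\<close>, and the reach \<open>Lm\<close> after the marker.\<close>
  with False obtain l u where u: "u \<in> set_pmf (p l)" "pmf (p l) u < \<eta> / N" by (meson not_le)
  then have l: "l = length u" using length_block by blast
  obtain Lm where Lm: "measure_pmf.prob (p (Lm + length u)) {xs. \<forall>i<Lm. take (length u) (drop i xs) \<noteq> u} < \<eta>"
    using recurrence[OF u(1)[unfolded l] \<eta>(1)] by blast
  have "\<exists>m F j q. good_code \<alpha> (expect (p N) (\<lambda>xs. - log 2 (pmf \<rho> (g xs)) + \<alpha> * (N * dist_n d xs (g xs))) / N
       + log 2 N / N + log 2 (real N / (real N - 1)) + \<alpha> * (d_max * (2 * \<eta>)) + \<epsilon>') m F j q"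
    using \<alpha> g u(2) Lm by (intro marker_good_code[OF N(3) _ \<epsilon>', where u = u and Lm = Lm]) (auto simp: l)
  then obtain m F j q where "good_code \<alpha> (expect (p N) (\<lambda>xs. - log 2 (pmf \<rho> (g xs)) + \<alpha> * (N * dist_n d xs (g xs))) / N
       + log 2 N / N + log 2 (real N / (real N - 1)) + \<alpha> * (d_max * (2 * \<eta>)) + \<epsilon>') m F j q" by blast
  then have "good_code \<alpha> (rate D + \<alpha> * D + \<epsilon>) m F j q"
  proof (rule good_code_mono)
    show "expect (p N) (\<lambda>xs. - log 2 (pmf \<rho> (g xs)) + \<alpha> * (N * dist_n d xs (g xs))) / N
       + log 2 N / N + log 2 (real N / (real N - 1)) + \<alpha> * (d_max * (2 * \<eta>)) + \<epsilon>' \<le> rate D + \<alpha> * D + \<epsilon>"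
      using main \<eta>(2) \<epsilon> unfolding c_def \<epsilon>'_def by linarith
  qed
  then show ?thesis by blast
qed

end

section \<open>Energy of a fixed code and the main theorem\<close>

context rate_distortion_problem
begin

text \<open>The weights \<open>(1/2) ^ lz_length ys\<close>, normalised by their Kraft sum, form the
  comparison law; the sum is at most \<open>n + 1\<close>, whence the logarithm.\<close>

lemma information_le_lz:
  assumes n: "1 \<le> n" and W: "W \<in> test_channels n"
  shows "information n W \<le> expect (p n) (\<lambda>xs. expect (W xs) (\<lambda>ys. real (lz_length ys)))
      + log 2 (n + 1)"
proof -
  let ?A = "{ys :: 'b list. length ys = n}"
  define Z where "Z = (\<Sum>ys\<in>?A. (1/2 :: real) ^ lz_length ys)"
  have "replicate n undefined \<in> ?A" by simp
  then have "?A \<noteq> {}" by blast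
  then have Z0: "0 < Z" unfolding Z_def by (intro sum_pos finite_lists_length) auto
  have Zn: "Z \<le> n + 1" using lz_kraft[where 'b='b, of n] by (simp add: Z_def)
  define Q where "Q = embed_pmf (\<lambda>ys. if ys \<in> ?A then (1/2) ^ lz_length ys / Z else 0)"
  have Q: "pmf Q ys = (if ys \<in> ?A then (1/2) ^ lz_length ys / Z else 0)" for ys
    unfolding Q_def
  proof (rule pmf_embed_finite[OF finite_lists_length])
    have "(\<Sum>ys\<in>?A. (1/2 :: real) ^ lz_length ys / Z) = Z / Z" unfolding sum_divide_distrib[symmetric] Z_def ..
    then show "(\<Sum>ys\<in>?A. (1/2 :: real) ^ lz_length ys / Z) = 1" using Z0 by simp
  qed (use Z0 in simp)
  have "information n W \<le> expect (p n) (\<lambda>xs. kl (W xs) Q)"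
  proof (rule information_le[OF W], rule subsetI)
    fix xs ys assume "xs \<in> set_pmf (p n)" "ys \<in> set_pmf (W xs)"
    then have "length ys = n" by (rule test_channel_length[OF W])
    then show "ys \<in> set_pmf Q" using Z0 by (simp add: set_pmf_iff Q)
  qed
  also have "\<dots> \<le> expect (p n)
     (\<lambda>xs. 1 * expect (W xs) (\<lambda>ys. real (lz_length ys)) + log 2 (n + 1))"
  proof (rule expectation_mono_finite[OF finite_set_block])
    fix xs assume xs: "xs \<in> set_pmf (p n)"
    have "kl (W xs) Q \<le> expect (W xs) (\<lambda>ys. 1 * real (lz_length ys) + log 2 (n + 1))"
      unfolding kl_def
    proof (rule expectation_mono_finite[OF finite_set_test_channel[OF W xs]])
      fix ys assume ys: "ys \<in> set_pmf (W xs)"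
      then have len: "length ys = n" by (rule test_channel_length[OF W xs])
      have pos: "0 < pmf (W xs) ys" "pmf (W xs) ys \<le> 1" using ys by (auto simp: pmf_positive pmf_le_1)
      have "log 2 (pmf (W xs) ys / pmf Q ys) = log 2 (pmf (W xs) ys) + (real (lz_length ys) + log 2 Z)"
        using pos Z0 len by (simp add: Q log_divide log_mult log_nat_power)
      also have "\<dots> \<le> 0 + (real (lz_length ys) + log 2 (n + 1))"
        using pos Z0 Zn by (intro add_mono) auto
      finally show "log 2 (pmf (W xs) ys / pmf Q ys) \<le> 1 * real (lz_length ys) + log 2 (n + 1)" by simp
    qed
    also have "\<dots> = 1 * expect (W xs) (\<lambda>ys. real (lz_length ys)) + log 2 (n + 1)"
      by (rule expectation_affine[OF finite_set_test_channel[OF W xs]])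
    finally show "kl (W xs) Q \<le> 1 * expect (W xs) (\<lambda>ys. real (lz_length ys)) + log 2 (n + 1)" .
  qed
  also have "\<dots> = 1 * expect (p n) (\<lambda>xs. expect (W xs) (\<lambda>ys. real (lz_length ys))) + log 2 (n + 1)"
    by (rule expectation_affine[OF finite_set_block])
  finally show ?thesis by simp
qed

text \<open>The distortion actually achieved is inserted for \<open>D\<close>. The channel may
  depend on the whole block in any way, so the bound covers codes selected by annealing.\<close>

lemma lagrangian_le_lz_cost:
  assumes n: "1 \<le> n" and W: "W \<in> test_channels n" and D0: "\<And>D. D_min \<le> D \<Longrightarrow> J \<le> rate D + \<alpha> * D"
  shows "J \<le> expect (p n) (\<lambda>xs. expect (W xs)
       (\<lambda>ys. real (lz_length ys) / n + \<alpha> * dist_n d xs ys)) + log 2 (n + 1) / n"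
proof -
  let ?D = "distortion n W"
  let ?E = "expect (p n) (\<lambda>xs. expect (W xs) (\<lambda>ys. real (lz_length ys)))"
  have D: "D_min \<le> ?D" by (rule D_min_le[OF n W])
  have "J \<le> rate ?D + \<alpha> * ?D" by (rule D0[OF D])
  also have "rate ?D \<le> rate_n n ?D" by (rule rate_le_rate_n[OF n D])
  also have "\<dots> \<le> information n W / n" by (rule rate_n_le[OF W order_refl])
  also have "\<dots> \<le> (?E + log 2 (n + 1)) / n" by (intro divide_right_mono information_le_lz n W) simp
  also have "\<dots> + \<alpha> * ?D = (?E / n + \<alpha> * ?D) + log 2 (n + 1) / n" by (simp add: add_divide_distrib)
  also have "?E / n + \<alpha> * ?D = expect (p n) (\<lambda>xs. expect (W xs)
       (\<lambda>ys. real (lz_length ys) / n + \<alpha> * dist_n d xs ys))"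
  proof -
    have "expect (p n) (\<lambda>xs. expect (W xs)
       (\<lambda>ys. real (lz_length ys) / n + \<alpha> * dist_n d xs ys))
      = expect (p n) (\<lambda>xs. expect (W xs) (\<lambda>ys. real (lz_length ys)) / n
         + \<alpha> * expect (W xs) (dist_n d xs))"
      by (rule expectation_cong) (simp add: integrable_measure_pmf_finite finite_set_test_channel[OF W])
    also have "\<dots> = ?E / n + \<alpha> * ?D"
      by (simp add: distortion_def integrable_measure_pmf_finite finite_set_block)
    finally show ?thesis by simp
  qed
  finally show ?thesis by simp
qed

end

section \<open>A code of fixed window inside larger windows, and its expected energy\<close>

lemma upto_nth_symmetric: "t < 2 * kf + 1 \<Longrightarrow> [- int kf..int kf] ! t = int t - int kf"
  by (subst nth_upto) auto

text \<open>The central part of a cyclic window does not wrap at distance at least \<open>m\<close>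
  from both ends, even where the full window does.\<close>

lemma cyclic_window_inner:
  assumes "m \<le> kf" "m \<le> i" "i + m < length xs"
  shows "take (2 * m + 1) (drop (kf - m) (cyclic_window kf xs i)) = take (2 * m + 1) (drop (i - m) xs)"
proof (rule nth_equalityI)
  have len: "length (cyclic_window kf xs i) = 2 * kf + 1" by (simp add: cyclic_window_def)
  show "length (take (2 * m + 1) (drop (kf - m) (cyclic_window kf xs i))) = length (take (2 * m + 1) (drop (i - m) xs))"
    using assms len by simp
  fix t assume "t < length (take (2 * m + 1) (drop (kf - m) (cyclic_window kf xs i)))"
  then have t: "t < 2 * m + 1" "kf - m + t < 2 * kf + 1" using assms len by auto
  have "(int i + (int (kf - m + t) - int kf)) mod int (length xs) = int (i - m + t)"
    using assms t by (subst mod_pos_pos_trivial) auto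
  moreover have "nat (int (i - m) + int t) = i - m + t" by linarith
  ultimately have "cyclic_window kf xs i ! (kf - m + t) = xs ! (i - m + t)"
    using t len by (simp add: cyclic_window_def upto_nth_symmetric)
  then show "take (2 * m + 1) (drop (kf - m) (cyclic_window kf xs i)) ! t = take (2 * m + 1) (drop (i - m) xs) ! t"
    using t assms len by simp
qed

text \<open>A function of \<open>2 * m + 1\<close> letters becomes a code of half-width
  \<open>kf\<close> by ignoring the outer letters of the window.\<close>

lemma sb_apply_inner:
  assumes "m \<le> kf" "m \<le> i" "i + m < length xs"
  shows "sb_apply kf (\<lambda>w\<in>windows kf. F (take (2 * m + 1) (drop (kf - m) w))) xs ! i
    = F (take (2 * m + 1) (drop (i - m) xs))"
proof -
  have "cyclic_window kf xs i \<in> windows kf" by (simp add: windows_def cyclic_window_def)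
  then show ?thesis using assms by (simp add: sb_apply_def cyclic_window_inner[OF assms, simplified])
qed

lemma length_sb_apply [simp]: "length (sb_apply kf f xs) = length xs"
  by (simp add: sb_apply_def)

context recurrent_problem
begin

text \<open>
  The empirical conditional entropy is bounded by the cross entropy relative to the kernel of a good
  code, mixed with the uniform distribution so that the boundary positions, about which nothing is
  known, cost a bounded amount each.
\<close>

lemma good_code_expected_energy:
  assumes good: "good_code \<alpha> c m F j q" and \<alpha>: "0 \<le> \<alpha>" and \<eta>: "0 < \<eta>" "\<eta> < 1"
    and n: "m \<le> kf" "j \<le> k" "k < n"
  defines "f \<equiv> (\<lambda>w\<in>windows kf. F (take (2 * m + 1) (drop (kf - m) w)))"
  shows "expect (p n) (\<lambda>xs. emp_cond_entropy k (sb_apply kf f xs) + \<alpha> * dist_n d xs (sb_apply kf f xs))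
    \<le> c - log 2 (1 - \<eta>) + (2 * m + j) * log 2 (CARD('b) / \<eta>) / real (n - k) + \<alpha> * (2 * m * d_max / n)"
proof -
  have q: "0 \<le> q s b" "(\<Sum>b\<in>UNIV. q s b) \<le> 1" for s b using good by (auto simp: good_code_def)
  have q1: "q s b \<le> 1" for s b
    using member_le_sum[of b UNIV "q s"] q[of s] by (meson UNIV_I finite order_trans q(1))
  define h where "h = (\<lambda>xs. - log 2 (q (code_outputs m F j xs) (code_outputs m F (j + 1) xs ! j)))"
  have qpos: "0 < q (code_outputs m F j xs) (code_outputs m F (j + 1) xs ! j)" if "xs \<in> set_pmf (p (2 * m + j + 1))" for xs
    using good that by (simp add: good_code_def)
  define Ch where "Ch = expect (p (2 * m + j + 1)) h"
  define Dh where "Dh = expect (p (2 * m + 1)) (\<lambda>xs. d (xs ! m) (F xs))"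
  have c: "Ch + \<alpha> * Dh \<le> c" using good by (simp add: good_code_def Ch_def h_def Dh_def)
  have Ch0: "0 \<le> Ch"
    unfolding Ch_def
  proof (intro expectation_ge_const finite_set_block)
    fix xs assume "xs \<in> set_pmf (p (2 * m + j + 1))"
    from qpos[OF this] show "0 \<le> h xs" using q1 by (simp add: h_def)
  qed
  have Dh0: "0 \<le> Dh" unfolding Dh_def by (intro expectation_ge_const finite_set_block d_nonneg)
  let ?B = "log 2 (CARD('b) / \<eta>)" and ?y = "sb_apply kf f"
  have B0: "0 \<le> ?B"
  proof -
    have "1 \<le> real CARD('b)" by (simp add: Suc_le_eq)
    then have "\<eta> \<le> real CARD('b)" using \<eta> by linarith
    then show ?thesis using \<eta> by (simp add: le_divide_eq)
  qed
  have l\<eta>: "0 \<le> - log 2 (1 - \<eta>)" using \<eta> by simp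
  \<comment> \<open>The order \<open>j\<close> kernel looks at the end of the longer context. The
    mixture costs \<open>- log 2 (1 - \<eta>)\<close> at regular positions and caps the cost of any
    letter at \<open>?B\<close>.\<close>
  define q' where "q' = (\<lambda>s b. (1 - \<eta>) * q (last_part j s) b + \<eta> / CARD('b))"
  have q'pos: "0 < q' s b" for s b using \<eta> q by (simp add: q'_def add_nonneg_pos)
  have q'sum: "(\<Sum>b\<in>UNIV. q' s b) \<le> 1" for s
  proof -
    have "(\<Sum>b\<in>UNIV. q' s b) = (1 - \<eta>) * (\<Sum>b\<in>UNIV. q (last_part j s) b) + \<eta>"
      by (simp add: q'_def sum.distrib sum_distrib_left)
    also have "\<dots> \<le> (1 - \<eta>) * 1 + \<eta>" using \<eta> q by (intro add_mono mult_left_mono) auto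
    finally show ?thesis by simp
  qed
  have q'B: "- log 2 (q' s b) \<le> ?B" for s b
  proof -
    have "\<eta> / CARD('b) \<le> q' s b" using \<eta> q by (simp add: q'_def)
    then have "log 2 (\<eta> / CARD('b)) \<le> log 2 (q' s b)" using \<eta> q'pos by (subst log_le_cancel_iff) auto
    then show ?thesis using \<eta> by (simp add: log_divide)
  qed
  have q'q: "- log 2 (q' s b) \<le> - log 2 (q (last_part j s) b) - log 2 (1 - \<eta>)" if "0 < q (last_part j s) b" for s b
  proof -
    have "(1 - \<eta>) * q (last_part j s) b \<le> q' s b" using \<eta> by (simp add: q'_def)
    then have "log 2 ((1 - \<eta>) * q (last_part j s) b) \<le> log 2 (q' s b)"
      using \<eta> q'pos that by (subst log_le_cancel_iff) auto
    then show ?thesis using \<eta> that by (simp add: log_mult)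
  qed
  \<comment> \<open>Positions at which the letter and its \<open>j\<close> predecessors all come
    from central windows that do not wrap; at most \<open>2 * m + j\<close> positions are left
    out.\<close>
  define I where "I = {m + j..<n - m}"
  define blk where "blk = (\<lambda>xs i. take (2 * m + j + 1) (drop (i - j - m) xs) :: 'a list)"
  have letter_cost: "- log 2 (q' (context_of k (?y xs) i) (?y xs ! i)) \<le> (if i \<in> I then h (blk xs i) - log 2 (1 - \<eta>) else ?B)"
    if xs: "xs \<in> set_pmf (p n)" and i: "i \<in> {k..<n}" for xs i
  proof (cases "i \<in> I")
    case True
    have len: "length xs = n" using xs by (rule length_block)
    have iI: "m + j \<le> i" "i + m < n" using True by (auto simp: I_def)
    have nth_y: "?y xs ! t = F (take (2 * m + 1) (drop (t - m) xs))" if "m \<le> t" "t + m < n" for t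
      unfolding f_def using n(1) that len by (intro sb_apply_inner) auto
    have nth_co: "code_outputs m F l (blk xs i) ! t = ?y xs ! (i - j + t)" if "t < l" "l \<le> j + 1" for l t
    proof -
      have "take (2 * m + 1) (drop t (blk xs i)) = take (2 * m + 1) (drop (t + (i - j - m)) xs)"
        using that by (simp add: blk_def drop_take min_def)
      moreover have "i - j + t - m = t + (i - j - m)" using iI by simp
      ultimately show ?thesis using that iI nth_y[of "i - j + t"] by (simp add: code_outputs_def)
    qed
    have ctx: "last_part j (context_of k (?y xs) i) = code_outputs m F j (blk xs i)"
    proof -
      have "last_part j (context_of k (?y xs) i) = take j (drop (i - j) (?y xs))"
      proof -
        have "context_of k (?y xs) i = drop (i - k) (take i (?y xs))"
          using i by (simp add: context_of_def drop_take)
        moreover have "length (drop (i - k) (take i (?y xs))) = k" using i len by simp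
        moreover have "k - j + (i - k) = i - j" using n i by simp
        ultimately have "last_part j (context_of k (?y xs) i) = drop (i - j) (take i (?y xs))"
          by (simp add: last_part_def)
        then show ?thesis using n i by (simp add: drop_take)
      qed
      also have "\<dots> = code_outputs m F j (blk xs i)"
      proof (rule nth_equalityI)
        show "length (take j (drop (i - j) (?y xs))) = length (code_outputs m F j (blk xs i))"
          using iI len by (simp add: code_outputs_def)
        fix t assume "t < length (take j (drop (i - j) (?y xs)))"
        then show "take j (drop (i - j) (?y xs)) ! t = code_outputs m F j (blk xs i) ! t"
          using iI len by (simp add: nth_co)
      qed
      finally show ?thesis .
    qed
    have out: "?y xs ! i = code_outputs m F (j + 1) (blk xs i) ! j"
      using nth_co[of j "j + 1"] iI by simp
    have "blk xs i \<in> set_pmf (p (2 * m + j + 1))"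
      unfolding blk_def using iI by (intro in_set_block_marginal[OF _ xs]) simp
    from q'q[of "context_of k (?y xs) i" "?y xs ! i"] qpos[OF this] show ?thesis
      using True by (simp add: ctx out h_def)
  qed (simp add: q'B)
  let ?R = "{k..<n}"
  have "expect (p n) (\<lambda>xs. emp_cond_entropy k (?y xs))
     \<le> expect (p n) (\<lambda>xs. (\<Sum>i\<in>?R. if i \<in> I then h (blk xs i) - log 2 (1 - \<eta>) else ?B) / (n - k))"
  proof (rule expectation_mono_finite[OF finite_set_block])
    fix xs assume xs: "xs \<in> set_pmf (p n)"
    then have len: "length xs = n" by (rule length_block)
    have "emp_cond_entropy k (?y xs) \<le> (\<Sum>i\<in>{k..<length (?y xs)}. - log 2 (q' (context_of k (?y xs) i) (?y xs ! i))) / real (length (?y xs) - k)"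
      using n len q'pos q'sum by (intro emp_cond_entropy_le) (auto intro: less_imp_le)
    also have "\<dots> \<le> (\<Sum>i\<in>?R. if i \<in> I then h (blk xs i) - log 2 (1 - \<eta>) else ?B) / real (n - k)"
      using len xs by (simp del: of_nat_diff) (intro divide_right_mono sum_mono letter_cost, auto)
    finally show "emp_cond_entropy k (?y xs) \<le> (\<Sum>i\<in>?R. if i \<in> I then h (blk xs i) - log 2 (1 - \<eta>) else ?B) / (n - k)"
      using n by (simp add: of_nat_diff)
  qed
  also have "\<dots> = (\<Sum>i\<in>?R. expect (p n) (\<lambda>xs. if i \<in> I then h (blk xs i) - log 2 (1 - \<eta>) else ?B)) / (n - k)"
    by (simp add: integrable_measure_pmf_finite finite_set_block)
  also have "(\<Sum>i\<in>?R. expect (p n) (\<lambda>xs. if i \<in> I then h (blk xs i) - log 2 (1 - \<eta>) else ?B))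
     \<le> (\<Sum>i\<in>?R. (Ch - log 2 (1 - \<eta>)) + (if i \<in> I then 0 else ?B))"
  proof (rule sum_mono)
    fix i assume i: "i \<in> ?R"
    show "expect (p n) (\<lambda>xs. if i \<in> I then h (blk xs i) - log 2 (1 - \<eta>) else ?B)
      \<le> (Ch - log 2 (1 - \<eta>)) + (if i \<in> I then 0 else ?B)"
    proof (cases "i \<in> I")
      case True
      have "expect (p n) (\<lambda>xs. h (blk xs i)) = Ch"
        unfolding blk_def Ch_def using True by (intro expectation_marginal) (auto simp: I_def)
      then show ?thesis using True by (simp add: integrable_measure_pmf_finite finite_set_block)
    qed (use Ch0 l\<eta> in simp)
  qed
  also have "\<dots> = (n - k) * (Ch - log 2 (1 - \<eta>)) + card (?R - I) * ?B"
    using n by (simp add: sum.distrib sum.If_cases Diff_eq of_nat_diff)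
  also have "\<dots> \<le> (n - k) * (Ch - log 2 (1 - \<eta>)) + (2 * m + j) * ?B"
  proof -
    have "?R - I \<subseteq> {k..<m + j} \<union> {n - m..<n}" by (auto simp: I_def)
    then have "card (?R - I) \<le> card ({k..<m + j} \<union> {n - m..<n})" by (intro card_mono) auto
    also have "\<dots> \<le> card {k..<m + j} + card {n - m..<n}" by (rule card_Un_le)
    also have "\<dots> \<le> 2 * m + j" by simp
    finally have "real (card (?R - I)) \<le> 2 * m + j" by linarith
    then have "card (?R - I) * ?B \<le> (2 * m + j) * ?B" using B0 by (intro mult_right_mono) auto
    then show ?thesis by simp
  qed
  finally have "expect (p n) (\<lambda>xs. emp_cond_entropy k (?y xs))
     \<le> ((n - k) * (Ch - log 2 (1 - \<eta>)) + (2 * m + j) * ?B) / (n - k)"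
    using n by (simp add: divide_right_mono)
  also have "\<dots> = Ch - log 2 (1 - \<eta>) + (2 * m + j) * ?B / (n - k)" using n by (simp add: add_divide_distrib)
  finally have H: "expect (p n) (\<lambda>xs. emp_cond_entropy k (?y xs))
     \<le> Ch - log 2 (1 - \<eta>) + (2 * m + j) * ?B / (n - k)" .
  define I' where "I' = {m..<n - m}"
  define blk' where "blk' = (\<lambda>xs i. take (2 * m + 1) (drop (i - m) xs) :: 'a list)"
  have "expect (p n) (\<lambda>xs. dist_n d xs (?y xs))
    \<le> expect (p n) (\<lambda>xs. (\<Sum>i<n. if i \<in> I' then d (blk' xs i ! m) (F (blk' xs i)) else d_max) / n)"
  proof (rule expectation_mono_finite[OF finite_set_block])
    fix xs assume "xs \<in> set_pmf (p n)"
    then have len: "length xs = n" by (rule length_block)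
    have "d (xs ! i) (?y xs ! i) \<le> (if i \<in> I' then d (blk' xs i ! m) (F (blk' xs i)) else d_max)" if "i < n" for i
    proof (cases "i \<in> I'")
      case True
      then have i: "m \<le> i" "i + m < n" by (auto simp: I'_def)
      have "?y xs ! i = F (blk' xs i)"
        unfolding f_def blk'_def using n(1) i len by (intro sb_apply_inner) auto
      moreover have "blk' xs i ! m = xs ! i" using i len by (simp add: blk'_def)
      ultimately show ?thesis using True by simp
    qed (simp add: d_le_max)
    then show "dist_n d xs (?y xs) \<le> (\<Sum>i<n. if i \<in> I' then d (blk' xs i ! m) (F (blk' xs i)) else d_max) / n"
      unfolding dist_n_def len by (intro divide_right_mono sum_mono) auto
  qed
  also have "\<dots> = (\<Sum>i<n. expect (p n) (\<lambda>xs. if i \<in> I' then d (blk' xs i ! m) (F (blk' xs i)) else d_max)) / n"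
    by (simp add: integrable_measure_pmf_finite finite_set_block)
  also have "\<dots> \<le> (\<Sum>i<n. Dh + (if i \<in> I' then 0 else d_max)) / n"
  proof (intro divide_right_mono sum_mono)
    fix i
    show "expect (p n) (\<lambda>xs. if i \<in> I' then d (blk' xs i ! m) (F (blk' xs i)) else d_max)
       \<le> Dh + (if i \<in> I' then 0 else d_max)"
    proof (cases "i \<in> I'")
      case True
      have "expect (p n) (\<lambda>xs. d (blk' xs i ! m) (F (blk' xs i))) = Dh"
        unfolding blk'_def Dh_def using True by (intro expectation_marginal) (auto simp: I'_def)
      then show ?thesis using True by simp
    qed (use Dh0 in simp)
  qed simp
  also have "(\<Sum>i<n. Dh + (if i \<in> I' then 0 else d_max)) = n * Dh + card ({..<n} - I') * d_max"
    by (simp add: sum.distrib sum.If_cases Diff_eq)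
  also have "\<dots> / n \<le> (n * Dh + 2 * m * d_max) / n"
  proof (intro divide_right_mono add_mono mult_right_mono d_max_nonneg)
    have "{..<n} - I' \<subseteq> {..<m} \<union> {n - m..<n}" by (auto simp: I'_def)
    then have "card ({..<n} - I') \<le> card ({..<m} \<union> {n - m..<n})" by (intro card_mono) auto
    also have "\<dots> \<le> card {..<m} + card {n - m..<n}" by (rule card_Un_le)
    also have "\<dots> \<le> 2 * m" by simp
    finally show "real (card ({..<n} - I')) \<le> real (2 * m)" by (rule of_nat_mono)
  qed (use Dh0 in auto)
  also have "\<dots> = Dh + 2 * m * d_max / n" using n by (simp add: add_divide_distrib)
  finally have "\<alpha> * expect (p n) (\<lambda>xs. dist_n d xs (?y xs)) \<le> \<alpha> * (Dh + 2 * m * d_max / n)"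
    using \<alpha> by (rule mult_left_mono)
  moreover have "expect (p n) (\<lambda>xs. emp_cond_entropy k (?y xs) + \<alpha> * dist_n d xs (?y xs))
    = expect (p n) (\<lambda>xs. emp_cond_entropy k (?y xs)) + \<alpha> * expect (p n) (\<lambda>xs. dist_n d xs (?y xs))"
    by (simp add: integrable_measure_pmf_finite finite_set_block)
  ultimately show ?thesis using H c by (simp add: distrib_left)
qed

end

section \<open>The iterated limit\<close>

lemma max_energy_diff_ge:
  fixes d :: "'a::finite \<Rightarrow> 'b::finite \<Rightarrow> real"
  assumes "f \<in> sb_codes kf" "w \<in> windows kf"
  shows "\<bar>energy d \<alpha> k kf xs (f(w := \<xi>)) - energy d \<alpha> k kf xs (f(w := \<theta>))\<bar> \<le> max_energy_diff d \<alpha> k kf xs"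
  unfolding max_energy_diff_def
proof (rule Max_ge)
  let ?g = "\<lambda>(f, w, \<xi>, \<theta>). \<bar>energy d \<alpha> k kf xs (f(w := \<xi>)) - energy d \<alpha> k kf xs (f(w := \<theta>))\<bar>"
  let ?S = "(sb_codes kf :: ('a list \<Rightarrow> 'b) set) \<times> windows kf \<times> UNIV \<times> UNIV"
  have "{\<bar>energy d \<alpha> k kf xs (f(w := \<xi>)) - energy d \<alpha> k kf xs (f(w := \<theta>))\<bar> | f w \<xi> \<theta>.
            f \<in> sb_codes kf \<and> w \<in> windows kf} \<subseteq> ?g ` ?S"
  proof (rule subsetI, elim CollectE exE conjE)
    fix v and f :: "'a list \<Rightarrow> 'b" and w \<xi> \<theta>
    assume "v = \<bar>energy d \<alpha> k kf xs (f(w := \<xi>)) - energy d \<alpha> k kf xs (f(w := \<theta>))\<bar>"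
      "f \<in> sb_codes kf" "w \<in> windows kf"
    then show "v \<in> ?g ` ?S" by (intro image_eqI[of _ _ "(f, w, \<xi>, \<theta>)"]) simp_all
  qed
  then show "finite {\<bar>energy d \<alpha> k kf xs (f(w := \<xi>)) - energy d \<alpha> k kf xs (f(w := \<theta>))\<bar> | f w \<xi> \<theta>.
            f \<in> sb_codes kf \<and> w \<in> windows kf}"
    by (rule finite_subset) (intro finite_imageI finite_cartesian_product finite_sb_codes finite_windows finite)
qed (use assms in blast)

text \<open>The inner limit is asserted where \<open>k n < n\<close>, so that the conditional
  empirical entropy is defined; this holds for all large \<open>n\<close> because \<open>k n\<close>
  is \<open>o(ln n)\<close>. The minimum over \<open>D\<close> is expressed through a minimiser
  \<open>D0\<close>.\<close>

theorem theorem3: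
  fixes M :: "'w measure"
    and X :: "nat \<Rightarrow> 'w \<Rightarrow> 'a::finite"
    and d :: "'a \<Rightarrow> 'b::finite \<Rightarrow> real"
    and \<alpha> :: real
    and kf k :: "nat \<Rightarrow> nat"
    and Kf :: "nat \<Rightarrow> nat"
    and T0 :: "nat \<Rightarrow> real"
    and \<beta> :: "nat \<Rightarrow> nat \<Rightarrow> real"
    and f0 :: "nat \<Rightarrow> 'a list \<Rightarrow> 'a list \<Rightarrow> 'b"
  assumes source: "stationary_ergodic_source M X"
    and d_nonneg: "\<And>x y. 0 \<le> d x y"
    and alpha_pos: "0 < \<alpha>"
    and kf_pos: "\<And>n. 1 \<le> n \<Longrightarrow> 0 < kf n"
    and kf_lim: "filterlim kf at_top sequentially"
    and Kf_eq: "\<And>n. Kf n = CARD('a) ^ (2 * kf n + 1)"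
    and k_pos: "\<And>n. 1 \<le> n \<Longrightarrow> 0 < k n"
    and k_lim: "filterlim k at_top sequentially"
    and k_small: "(\<lambda>n. real (k n)) \<in> o(\<lambda>n. ln (real n))"
    and T0: "\<And>n xs. k n < n \<Longrightarrow> length xs = n \<Longrightarrow>
               real (Kf n) * max_energy_diff d \<alpha> (k n) (kf n) xs < T0 n"
    and beta_eq: "\<And>n t. 1 \<le> t \<Longrightarrow>
               \<beta> n t = 1 / T0 n * ln (real_of_int \<lfloor>real t / real (Kf n)\<rfloor> + 1)"
    and f0: "\<And>n xs. length xs = n \<Longrightarrow> f0 n xs \<in> sb_codes (kf n)"
  shows "\<exists>L D0.
           (\<forall>n. k n < n \<longrightarrow>
              (\<lambda>r. expected_cost M X d \<alpha> (k n) (kf n) (\<beta> n) (f0 n) n r) \<longlonglongrightarrow> L n) \<and>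
           0 \<le> D0 \<and>
           (\<forall>D\<ge>0. rate_distortion M X d D0 + ereal (\<alpha> * D0)
                     \<le> rate_distortion M X d D + ereal (\<alpha> * D)) \<and>
           (\<lambda>n. ereal (L n)) \<longlonglongrightarrow> rate_distortion M X d D0 + ereal (\<alpha> * D0)"
proof -
  define p where "p = block_pmf M X"
  interpret recurrent_problem p d
    unfolding p_def
  proof (intro recurrent_problem.intro rate_distortion_problem.intro rate_distortion_problem_axioms.intro
      recurrent_problem_axioms.intro)
    show "stationary_blocks (block_pmf M X)" by (rule stationary_blocks_block_pmf[OF source])
    show "\<exists>L. measure_pmf.prob (block_pmf M X (L + length u)) {xs. \<forall>i<L. take (length u) (drop i xs) \<noteq> u} < \<epsilon>"
      if "u \<in> set_pmf (block_pmf M X (length u))" "0 < \<epsilon>" for u and \<epsilon> :: real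
      by (rule ergodic_recurrence[OF source that])
  qed (rule d_nonneg)
  define E where "E = (\<lambda>n xs. energy d \<alpha> (k n) (kf n) xs :: ('a list \<Rightarrow> 'b) \<Rightarrow> real)"
  define U where "U = (\<lambda>n xs. pmf_of_set (minimizers (sb_codes (kf n)) (E n xs)))"
  define cost where "cost = (\<lambda>n xs f. real (lz_length (sb_apply (kf n) f xs)) / real n
      + \<alpha> * dist_n d xs (sb_apply (kf n) f xs))"
  define L where "L = (\<lambda>n. expect (p n) (\<lambda>xs. expect (U n xs) (cost n xs)))"
  have setU: "set_pmf (U n xs) = minimizers (sb_codes (kf n)) (E n xs)" for n xs
  proof -
    have "finite (minimizers (sb_codes (kf n) :: ('a list \<Rightarrow> 'b) set) (E n xs))"
      by (rule finite_subset[OF _ finite_sb_codes]) (auto simp: minimizers_def)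
    then show ?thesis
      unfolding U_def using minimizers_nonempty[OF finite_sb_codes sb_codes_nonempty] by (intro set_pmf_of_set)
  qed
  have finU: "finite (set_pmf (U n xs))" for n xs
    unfolding setU by (rule finite_subset[OF _ finite_sb_codes]) (auto simp: minimizers_def)
  have lim_r: "(\<lambda>r. expected_cost M X d \<alpha> (k n) (kf n) (\<beta> n) (f0 n) n r) \<longlonglongrightarrow> L n" if n: "k n < n" for n
  proof -
    have conv: "(\<lambda>r. expect (annealing (kf n) (E n xs) (\<beta> n) (f0 n xs) r) (cost n xs))
        \<longlonglongrightarrow> expect (U n xs) (cost n xs)" if "xs \<in> set_pmf (p n)" for xs
    proof -
      have len: "length xs = n" using that by (rule length_block)
      let ?\<Delta> = "max_energy_diff d \<alpha> (k n) (kf n) xs"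
      have T: "real (Kf n) * ?\<Delta> < T0 n" by (rule T0[OF n len])
      obtain w where "w \<in> (windows (kf n) :: 'a list set)" using windows_nonempty by blast
      from max_energy_diff_ge[OF f0[OF len] this, of d \<alpha> "k n" xs undefined undefined]
      have "0 \<le> ?\<Delta>" by simp
      then have "0 \<le> real (Kf n) * ?\<Delta>" by simp
      with T have "0 < T0 n" by linarith
      then show ?thesis
        unfolding U_def using T f0[OF len] beta_eq max_energy_diff_ge[of _ "kf n" _ d \<alpha> "k n" xs]
        by (intro annealing_tendsto[where K = "Kf n" and \<Delta> = ?\<Delta> and ?T0.0 = "T0 n"]) (auto simp: E_def Kf_eq)
    qed
    have "(\<lambda>r. \<Sum>xs\<in>set_pmf (p n). pmf (p n) xs * expect (annealing (kf n) (E n xs) (\<beta> n) (f0 n xs) r) (cost n xs))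
        \<longlonglongrightarrow> (\<Sum>xs\<in>set_pmf (p n). pmf (p n) xs * expect (U n xs) (cost n xs))"
      by (intro tendsto_sum tendsto_mult tendsto_const conv)
    moreover have "expected_cost M X d \<alpha> (k n) (kf n) (\<beta> n) (f0 n) n r
       = (\<Sum>xs\<in>set_pmf (p n). pmf (p n) xs * expect (annealing (kf n) (E n xs) (\<beta> n) (f0 n xs) r) (cost n xs))" for r
    proof -
      have "expected_cost M X d \<alpha> (k n) (kf n) (\<beta> n) (f0 n) n r
        = (\<integral>\<omega>. (\<lambda>xs. expect (annealing (kf n) (E n xs) (\<beta> n) (f0 n xs) r) (cost n xs)) (block X n \<omega>) \<partial>M)"
        unfolding expected_cost_def Let_def E_def cost_def ..
      also have "\<dots> = expect (p n) (\<lambda>xs. expect (annealing (kf n) (E n xs) (\<beta> n) (f0 n xs) r) (cost n xs))"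
        unfolding p_def by (rule expectation_block_pmf[OF source])
      finally show ?thesis by (simp add: expectation_finite[OF finite_set_block order_refl])
    qed
    ultimately show ?thesis by (simp add: L_def expectation_finite[OF finite_set_block order_refl])
  qed
  obtain D0 where D0: "D_min \<le> D0" "\<And>D. D_min \<le> D \<Longrightarrow> rate D0 + \<alpha> * D0 \<le> rate D + \<alpha> * D"
    by (rule lagrangian_minimum[OF alpha_pos]) blast
  define J where "J = rate D0 + \<alpha> * D0"
  \<comment> \<open>Choosing a minimiser for each block and applying it to that block is itself a
    test channel.\<close>
  have lower: "J \<le> L n + log 2 (n + 1) / n" if n: "1 \<le> n" for n
  proof -
    define W where "W = (\<lambda>xs. map_pmf (\<lambda>f. sb_apply (kf n) f xs) (U n xs))"
    have W: "W \<in> test_channels n" by (auto simp: test_channels_def W_def)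
    have "expect (W xs) (\<lambda>ys. real (lz_length ys) / n + \<alpha> * dist_n d xs ys)
      = expect (U n xs) (cost n xs)" for xs
      by (simp add: W_def cost_def)
    then show ?thesis using lagrangian_le_lz_cost[OF n W, of J \<alpha>] D0(2) by (simp add: J_def L_def)
  qed
  obtain \<epsilon>lz :: "nat \<Rightarrow> real" where \<epsilon>lz: "\<epsilon>lz \<longlonglongrightarrow> 0"
    and lz: "\<And>n ys :: 'b list. 1 < n \<Longrightarrow> length ys = n \<Longrightarrow> k n < n
        \<Longrightarrow> lz_length ys / n \<le> emp_cond_entropy (k n) ys + \<epsilon>lz n"
    using lz_length_le_emp_cond_entropy[OF k_small, where 'b = 'b] by blast
  have kn_small: "\<forall>\<^sub>F n in sequentially. k n < n \<and> real n / 2 \<le> real (n - k n)"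
  proof -
    have "\<forall>\<^sub>F n in sequentially. norm (real (k n)) \<le> 1 * norm (ln (real n))"
      using k_small by (rule landau_o.smallD) simp
    moreover have "\<forall>\<^sub>F n::nat in sequentially. ln (real n) < real n / 2" by real_asymp
    ultimately show ?thesis
      using eventually_gt_at_top[of 1]
    proof eventually_elim
      case (elim n)
      then have "real (k n) < real n / 2" by simp
      then show ?case by (simp add: of_nat_diff)
    qed
  qed
  have upper: "\<forall>\<^sub>F n in sequentially. L n < J + \<epsilon>" if \<epsilon>: "0 < \<epsilon>" for \<epsilon>
  proof -
    obtain m F j q where good: "good_code \<alpha> (J + \<epsilon> / 4) m F j q"
      unfolding J_def using good_code_exists[OF alpha_pos D0(1), of "\<epsilon> / 4"] \<epsilon> by auto
    \<comment> \<open>Makes \<open>- log 2 (1 - \<eta>)\<close> equal to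
      \<open>\<epsilon> / 4\<close>; the good code and \<open>G n\<close> account for two further
      quarters.\<close>
    define \<eta> where "\<eta> = 1 - 2 powr (- \<epsilon> / 4)"
    have \<eta>: "0 < \<eta>" "\<eta> < 1" "log 2 (1 - \<eta>) = - \<epsilon> / 4" using \<epsilon> by (auto simp: \<eta>_def powr_less_one)
    define B where "B = (2 * m + j) * log 2 (CARD('b) / \<eta>)"
    have B0: "0 \<le> B"
    proof -
      have "1 \<le> real CARD('b)" by (simp add: Suc_le_eq)
      then have "\<eta> \<le> real CARD('b)" using \<eta> by linarith
      then show ?thesis using \<eta> by (simp add: B_def le_divide_eq)
    qed
    define G where "G = (\<lambda>n::nat. 2 * B / n + \<alpha> * (2 * m * d_max / n) + \<epsilon>lz n)"
    have "G \<longlonglongrightarrow> 0 + \<alpha> * 0 + 0"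
      unfolding G_def by (intro tendsto_intros \<epsilon>lz)
    then have "\<forall>\<^sub>F n in sequentially. G n < \<epsilon> / 4" using \<epsilon> by (intro order_tendstoD(2)) auto
    \<comment> \<open>Growing windows and growing order eventually accommodate the window
      \<open>m\<close> and the order \<open>j\<close> of the fixed good code.\<close>
    moreover have "\<forall>\<^sub>F n in sequentially. m \<le> kf n" "\<forall>\<^sub>F n in sequentially. j \<le> k n"
      using kf_lim k_lim by (auto simp: filterlim_at_top)
    ultimately show ?thesis
      using kn_small eventually_gt_at_top[of "1::nat"]
    proof eventually_elim
      case (elim n)
      define f where "f = (\<lambda>w\<in>windows (kf n). F (take (2 * m + 1) (drop (kf n - m) w)))"
      have f: "f \<in> sb_codes (kf n)" by (simp add: f_def sb_codes_def)
      have "L n \<le> expect (p n) (\<lambda>xs. 1 * (emp_cond_entropy (k n) (sb_apply (kf n) f xs)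
          + \<alpha> * dist_n d xs (sb_apply (kf n) f xs)) + \<epsilon>lz n)"
        unfolding L_def
      proof (intro expectation_mono_finite finite_set_block expectation_le_const finU)
        fix xs g assume xs: "xs \<in> set_pmf (p n)" and g: "g \<in> set_pmf (U n xs)"
        have len: "length xs = n" using xs by (rule length_block)
        \<comment> \<open>A minimiser is optimal for its own block, so on every single block it has
          at most the energy of the fixed code \<open>f\<close>, whose expectation is known.\<close>
        have "E n xs g \<le> E n xs f" using g f by (simp add: setU minimizers_def)
        then have "real n * (emp_cond_entropy (k n) (sb_apply (kf n) g xs) + \<alpha> * dist_n d xs (sb_apply (kf n) g xs))
          \<le> real n * (emp_cond_entropy (k n) (sb_apply (kf n) f xs) + \<alpha> * dist_n d xs (sb_apply (kf n) f xs))"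
          by (simp only: E_def energy_def len)
        then have energy_le: "emp_cond_entropy (k n) (sb_apply (kf n) g xs) + \<alpha> * dist_n d xs (sb_apply (kf n) g xs)
          \<le> emp_cond_entropy (k n) (sb_apply (kf n) f xs) + \<alpha> * dist_n d xs (sb_apply (kf n) f xs)"
          using elim by (subst (asm) mult_le_cancel_left_pos) auto
        have "lz_length (sb_apply (kf n) g xs) / n \<le> emp_cond_entropy (k n) (sb_apply (kf n) g xs) + \<epsilon>lz n"
          using elim len by (intro lz) auto
        then have "cost n xs g \<le> emp_cond_entropy (k n) (sb_apply (kf n) g xs) + \<epsilon>lz n
            + \<alpha> * dist_n d xs (sb_apply (kf n) g xs)"
          unfolding cost_def by (rule add_right_mono)
        also have "\<dots> = (emp_cond_entropy (k n) (sb_apply (kf n) g xs) + \<alpha> * dist_n d xs (sb_apply (kf n) g xs)) + \<epsilon>lz n"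
          by (simp only: ac_simps)
        also have "\<dots> \<le> (emp_cond_entropy (k n) (sb_apply (kf n) f xs)
            + \<alpha> * dist_n d xs (sb_apply (kf n) f xs)) + \<epsilon>lz n"
          using energy_le by (rule add_right_mono)
        finally show "cost n xs g \<le> 1 * (emp_cond_entropy (k n) (sb_apply (kf n) f xs)
          + \<alpha> * dist_n d xs (sb_apply (kf n) f xs)) + \<epsilon>lz n"
          by (simp only: mult_1)
      qed
      also have "\<dots> = 1 * expect (p n) (\<lambda>xs. emp_cond_entropy (k n) (sb_apply (kf n) f xs)
          + \<alpha> * dist_n d xs (sb_apply (kf n) f xs)) + \<epsilon>lz n"
        by (rule expectation_affine[OF finite_set_block])
      also have "expect (p n) (\<lambda>xs. emp_cond_entropy (k n) (sb_apply (kf n) f xs)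
          + \<alpha> * dist_n d xs (sb_apply (kf n) f xs))
        \<le> J + \<epsilon> / 4 - log 2 (1 - \<eta>) + (2 * m + j) * log 2 (CARD('b) / \<eta>) / real (n - k n) + \<alpha> * (2 * m * d_max / n)"
        using good_code_expected_energy[OF good less_imp_le[OF alpha_pos] \<eta>(1,2), of "kf n" "k n" n] elim
        unfolding f_def by simp
      also have "(2 * m + j) * log 2 (CARD('b) / \<eta>) / real (n - k n) \<le> 2 * B / n"
      proof -
        have "B / real (n - k n) \<le> B / (real n / 2)" using elim B0 by (intro divide_left_mono mult_pos_pos) auto
        then show ?thesis using elim by (simp add: B_def of_nat_diff mult.commute)
      qed
      finally have "L n \<le> J + \<epsilon> / 4 - log 2 (1 - \<eta>) + G n" by (simp add: G_def)
      then show ?case using elim \<eta>(3) \<epsilon> by linarith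
    qed
  qed
  have L_lim: "L \<longlonglongrightarrow> J"
  proof (rule order_tendstoI)
    fix a assume "J < a"
    then show "\<forall>\<^sub>F n in sequentially. L n < a" using upper[of "a - J"] by simp
  next
    fix a assume a: "a < J"
    have "(\<lambda>n::nat. log 2 (n + 1) / n) \<longlonglongrightarrow> 0" by real_asymp
    then have "\<forall>\<^sub>F n::nat in sequentially. log 2 (n + 1) / n < J - a" using a by (intro order_tendstoD(2)) auto
    then show "\<forall>\<^sub>F n in sequentially. a < L n"
      using eventually_ge_at_top[of "1::nat"]
    proof eventually_elim
      case (elim n)
      have "J \<le> L n + log 2 (real n + 1) / n" using lower[OF elim(2)] by (simp add: add.commute)
      with elim(1) show ?case by linarith
    qed
  qed
  have rdn: "rate_distortion_n M X d n D = (if D_min \<le> D then ereal (rate_n n D) else \<infinity>)" if "1 \<le> n" for n D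
    unfolding rate_distortion_n_def using rate_distortion_infimum[OF that, of D] by (simp only: p_def)
  have rd: "rate_distortion M X d D = (if D_min \<le> D then ereal (rate D) else \<infinity>)" for D
  proof -
    have "(\<lambda>n. rate_distortion_n M X d n D) \<longlonglongrightarrow> (if D_min \<le> D then ereal (rate D) else \<infinity>)"
    proof (rule Lim_transform_eventually)
      show "(\<lambda>n. if D_min \<le> D then ereal (rate_n n D) else \<infinity>) \<longlonglongrightarrow> (if D_min \<le> D then ereal (rate D) else \<infinity>)"
        using rate_n_tendsto[of D] by auto
      show "\<forall>\<^sub>F n in sequentially. (if D_min \<le> D then ereal (rate_n n D) else \<infinity>) = rate_distortion_n M X d n D"
        using eventually_ge_at_top[of "1::nat"] by eventually_elim (simp add: rdn)
    qed
    then show ?thesis unfolding rate_distortion_def by (rule limI)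
  qed
  have J: "rate_distortion M X d D0 + ereal (\<alpha> * D0) = ereal J" using D0(1) by (simp add: rd J_def)
  show ?thesis
  proof (intro exI[of _ L] exI[of _ D0] conjI allI impI)
    show "0 \<le> D0" using D_min_nonneg D0(1) by linarith
    show "rate_distortion M X d D0 + ereal (\<alpha> * D0) \<le> rate_distortion M X d D + ereal (\<alpha> * D)" for D
      unfolding J using D0(2)[of D] by (simp add: rd J_def)
    show "(\<lambda>n. ereal (L n)) \<longlonglongrightarrow> rate_distortion M X d D0 + ereal (\<alpha> * D0)"
      unfolding J using L_lim by simp
  qed (rule lim_r)
qed

end
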